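(* Let $I$ be a compact subset of $\mathbb{R}^d$, let $Z=\{Z(t): t\in I\}$ be a random field with values in $\mathbb{R}^d$, and let $u\in\mathbb{R}^d$. Assume that: (A0) $Z$ is Gaussian; (A1) almost surely $t\mapsto Z(t)$ is of class $C^1$; (A2) for each $t\in I$, $Z(t)$ has a nondegenerate distribution (i.e. $\mathrm{Var}(Z(t))\succ 0$); (A3) $\mathrm{P}\{\exists t\in \dot I:\ Z(t)=u,\ \det(Z'(t))=0\}=0$; (A4) $\lambda(\partial I)=0$. Then $$\mathrm{E}\big(N_u^Z(I)\big)=\int_I \mathrm{E}\big(|\det(Z'(t))|\,\big/\,Z(t)=u\big)\,p_{Z(t)}(u)\,dt,$$ and both members are finite.
   Context: $\dot I$ and $\partial I$ denote the interior and the boundary of $I$; $\lambda$ is Lebesgue measure on $\mathbb{R}^d$. $N_u^Z(I)$ is the number of $t\in I$ with $Z(t)=u$. $Z'(t)$ is the derivative (a $d\times d$ matrix). $\mathrm{Var}(\xi)$ is the variance–covariance matrix of a random vector $\xi$, and $M\succ0$ means that $M$ is positive definite. $p_{\xi}(x)$ is the value at $x$ of the density of the random vector $\xi$. $\mathrm{E}(\,\cdot\,/\,Z(t)=u)$ denotes conditional expectation given $Z(t)=u$ (the version given by Gaussian regression). *)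

theory Defs
  imports "HOL-Probability.Probability"
begin

text \<open>Degenerate (constant) normal distributions are allowed.\<close>

definition gaussian_rv :: "'w measure \<Rightarrow> ('w \<Rightarrow> real) \<Rightarrow> bool" where
  "gaussian_rv M X \<longleftrightarrow> X \<in> borel_measurable M \<and>
     ((\<exists>\<mu> \<sigma>. 0 < \<sigma> \<and> distributed M lborel X (\<lambda>x. ennreal (normal_density \<mu> \<sigma> x))) \<or>
      (\<exists>\<mu>. AE \<omega> in M. X \<omega> = \<mu>))"

text \<open>The finite-dimensional distributions are Gaussian: every finite linear combination of
  coordinates of values of the field is a Gaussian random variable.\<close>

definition gaussian_field ::
  "'w measure \<Rightarrow> 'p set \<Rightarrow> ('p \<Rightarrow> 'w \<Rightarrow> real ^ 'd) \<Rightarrow> bool" where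
  "gaussian_field M I Z \<longleftrightarrow>
     (\<forall>T a. finite T \<and> T \<subseteq> I \<longrightarrow> gaussian_rv M (\<lambda>\<omega>. \<Sum>t\<in>T. a t \<bullet> Z t \<omega>))"

text \<open>Since \<open>I\<close> need not be open, differentiability at a point of \<open>I\<close> is relative to \<open>I\<close>.
  In particular, restrictions to \<open>I\<close> of functions that are \<open>C\<^sup>1\<close> on an open neighbourhood of \<open>I\<close>
  are covered. At boundary points the derivative may fail to be unique.\<close>

definition C1_on :: "(real ^ 'n) set \<Rightarrow> (real ^ 'n \<Rightarrow> real ^ 'm) \<Rightarrow> bool" where
  "C1_on I f \<longleftrightarrow>
     (\<exists>J :: real ^ 'n \<Rightarrow> real ^ 'n ^ 'm. continuous_on I J \<and>
        (\<forall>t\<in>I. (f has_derivative (\<lambda>h. J t *v h)) (at t within I)))"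

text \<open>For \<open>t\<close> in the interior of \<open>I\<close> this is the usual Jacobian matrix. Elsewhere it is some
  Jacobian matrix relative to \<open>I\<close>, if there is one.\<close>

definition field_deriv ::
  "(real ^ 'n) set \<Rightarrow> (real ^ 'n \<Rightarrow> 'w \<Rightarrow> real ^ 'm) \<Rightarrow> real ^ 'n \<Rightarrow> 'w \<Rightarrow> real ^ 'n ^ 'm" where
  "field_deriv I Z t \<omega> = jacobian (\<lambda>s. Z s \<omega>) (at t within I)"

text \<open>The number of solutions is \<open>\<infinity>\<close> when there are infinitely many.\<close>

definition level_count :: "'p set \<Rightarrow> ('p \<Rightarrow> 'w \<Rightarrow> 'v) \<Rightarrow> 'v \<Rightarrow> 'w \<Rightarrow> ennreal" where
  "level_count I Z u \<omega> = emeasure (count_space UNIV) {t \<in> I. Z t \<omega> = u}"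

definition cov_matrix ::
  "'w measure \<Rightarrow> ('w \<Rightarrow> real ^ 'm) \<Rightarrow> ('w \<Rightarrow> real ^ 'n) \<Rightarrow> real ^ 'n ^ 'm" where
  "cov_matrix M X Y = (\<chi> i j. \<integral>\<omega>.
     (X \<omega> $ i - (\<integral>\<omega>'. X \<omega>' $ i \<partial>M)) * (Y \<omega> $ j - (\<integral>\<omega>'. Y \<omega>' $ j \<partial>M)) \<partial>M)"

definition var_matrix :: "'w measure \<Rightarrow> ('w \<Rightarrow> real ^ 'n) \<Rightarrow> real ^ 'n ^ 'n" where
  "var_matrix M X = cov_matrix M X X"

definition positive_definite :: "real ^ 'n ^ 'n \<Rightarrow> bool" where
  "positive_definite A \<longleftrightarrow> transpose A = A \<and> (\<forall>x. x \<noteq> 0 \<longrightarrow> 0 < x \<bullet> (A *v x))"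

text \<open>A density is only determined almost everywhere; its value at a point is that of the
  continuous version, which is unique when it exists (as for nondegenerate Gaussian vectors).\<close>

definition density_at :: "'w measure \<Rightarrow> ('w \<Rightarrow> real ^ 'n) \<Rightarrow> real ^ 'n \<Rightarrow> real" where
  "density_at M X = (THE p. continuous_on UNIV p \<and> (\<forall>x. 0 \<le> p x) \<and>
     distributed M lborel X (\<lambda>x. ennreal (p x)))"

text \<open>If \<open>(X, Y)\<close> is Gaussian with \<open>Var Y\<close> invertible and \<open>B = Cov(X, Y) Var(Y)\<^sup>-\<^sup>1\<close>, then
  \<open>X - B Y\<close> is independent of \<open>Y\<close>, and the version of the conditional expectation given by
  Gaussian regression is \<open>E(\<phi>(X) / Y = u) = E(\<phi>(X - B Y + B u))\<close>. For a random matrix \<open>X\<close> the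
  regression is carried out row by row, \<open>B\<^sub>i\<close> being the coefficient matrix of the \<open>i\<close>-th row;
  this is the regression of the vector of all entries of \<open>X\<close>.\<close>

definition regression_coeff ::
  "'w measure \<Rightarrow> ('w \<Rightarrow> real ^ 'm) \<Rightarrow> ('w \<Rightarrow> real ^ 'n) \<Rightarrow> real ^ 'n ^ 'm" where
  "regression_coeff M X Y = cov_matrix M X Y ** matrix_inv (var_matrix M Y)"

definition regression_expectation ::
  "'w measure \<Rightarrow> (real ^ 'k ^ 'm \<Rightarrow> ennreal) \<Rightarrow> ('w \<Rightarrow> real ^ 'k ^ 'm) \<Rightarrow> ('w \<Rightarrow> real ^ 'n)
     \<Rightarrow> real ^ 'n \<Rightarrow> ennreal" where
  "regression_expectation M \<phi> X Y u =
     (\<integral>\<^sup>+\<omega>. \<phi> (\<chi> i. let B = regression_coeff M (\<lambda>\<omega>'. X \<omega>' $ i) Y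
                   in X \<omega> $ i - B *v Y \<omega> + B *v u) \<partial>M)"

text \<open>The integrand of the Kac--Rice formula. The derivative of the field exists only almost
  surely, so it is measurable only with respect to the completion of \<open>M\<close>.\<close>

definition rice_integrand ::
  "'w measure \<Rightarrow> (real ^ 'd) set \<Rightarrow> (real ^ 'd \<Rightarrow> 'w \<Rightarrow> real ^ 'd) \<Rightarrow> real ^ 'd \<Rightarrow> real ^ 'd
     \<Rightarrow> ennreal" where
  "rice_integrand M I Z u t =
     regression_expectation (completion M) (\<lambda>A. ennreal \<bar>det A\<bar>) (field_deriv I Z t) (Z t) u
       * ennreal (density_at M (Z t) u)"

end

theory Submission
  imports Defs
begin

text \<open>
  Fix a base point \<open>s\<close> and regress: \<open>Z t = A t Z s + Z\<^sup>\<bottom> t\<close>, where \<open>Z\<^sup>\<bottom>\<close> is independent of \<open>Z s\<close> and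
  \<open>A s\<close> is the identity. Near \<open>s\<close> the matrix \<open>A t\<close> is invertible, so \<open>Z t = u\<close> if and only if
  \<open>Y t = Z s\<close> with \<open>Y t = (A t)\<^sup>-\<^sup>1 (u - Z\<^sup>\<bottom> t)\<close>. The level \<open>Z s\<close> has a density \<open>p\<close> and is independent
  of \<open>Y\<close>, hence conditioning on \<open>Y\<close> and the area formula for \<open>Y\<close> show that the expected number of
  solutions in a set \<open>B\<close> near \<open>s\<close> is the integral of \<open>g\<^sub>s(t) = E(\<bar>det Y'(t)\<bar> p(Y t))\<close> over the
  interior points of \<open>B\<close>; boundary points do not contribute, as \<open>Y\<close> maps null sets to null sets.
  At \<open>t = s\<close> the value \<open>g\<^sub>s(s)\<close> is exactly the Kac--Rice integrand. Since \<open>g\<^sub>s\<close> and \<open>g\<^sub>t\<close> are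
  continuous densities of the same measure near \<open>t\<close>, they agree there, so \<open>g\<^sub>s\<close> is the
  Kac--Rice integrand near \<open>s\<close>. Compactness of \<open>I\<close> gives the global formula and finiteness.
\<close>

section \<open>Gaussian random variables\<close>

text \<open>The area formula by itself only yields integrals over levels, hence an identity for
  almost every \<open>u\<close>; the obstacle is the fixed level. Regression exchanges the roles:
  \<open>u\<close> enters the field \<open>Y\<close>, and the level to integrate over becomes the
  random vector \<open>Z s\<close>, which has a bounded continuous density. No limit in
  \<open>u\<close> is then taken. What remains is continuity and local boundedness of
  \<open>g\<^sub>s\<close>, for which no integrable majorant of the paths is at hand. Two facts on
  Gaussian variables replace it: pathwise bounds and limits upgrade themselves to mean-square ones,
  and every even moment is controlled by a power of the second. The entries of \<open>Y'\<close> are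
  affine in the field and its derivative, so both facts apply to the determinant. Derivatives on
  \<open>I\<close> are only relative and may be ambiguous on the frontier; there \<open>Y\<close> is
  merely Lipschitz, which is enough for null images. Paths are smooth only almost surely, so a
  version that is smooth everywhere is used, and the completion of the measure absorbs the
  difference.\<close>

lemma prob_space_std_normal: "prob_space std_normal_distribution"
  by (simp add: prob_space_normal_density)

lemma measure_std_normal_UNIV [simp]: "measure std_normal_distribution UNIV = 1"
  using prob_space.prob_space[OF prob_space_std_normal] by simp

lemma gaussian_rv_measurable: "gaussian_rv M X \<Longrightarrow> X \<in> borel_measurable M"
  by (simp add: gaussian_rv_def)

lemma distr_std_normal_affine:
  assumes "0 < \<sigma>"
  shows "distr std_normal_distribution borel (\<lambda>x. \<mu> + \<sigma> * x)
    = density lborel (\<lambda>x. ennreal (normal_density \<mu> \<sigma> x))"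
proof -
  interpret prob_space std_normal_distribution by (rule prob_space_std_normal)
  have "distributed std_normal_distribution lborel (\<lambda>x. x) (normal_density 0 1)"
    unfolding distributed_def
    by (auto simp: distr_id2 intro!: measure_eqI)
  from normal_density_affine[OF this, of \<sigma> \<mu>] assms
  have "distributed std_normal_distribution lborel (\<lambda>x. \<mu> + \<sigma> * x) (normal_density \<mu> \<sigma>)"
    by simp
  then show ?thesis
    unfolding distributed_def by (metis distr_cong sets_lborel)
qed

text \<open>Allowing \<open>\<sigma> = 0\<close> merges the nondegenerate and the constant case, so
  that moments and characteristic functions are computed without a case distinction.\<close>

lemma (in prob_space) gaussian_rv_iff_distr:
  "gaussian_rv M X \<longleftrightarrow> X \<in> borel_measurable M \<and>
     (\<exists>\<mu> \<sigma>. 0 \<le> \<sigma> \<and> distr M borel X = distr std_normal_distribution borel (\<lambda>x. \<mu> + \<sigma> * x))"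
proof (cases "X \<in> borel_measurable M")
  case [measurable]: True
  interpret N: prob_space std_normal_distribution by (rule prob_space_std_normal)
  have pos: "distributed M lborel X (\<lambda>x. ennreal (normal_density \<mu> \<sigma> x)) \<longleftrightarrow>
      distr M borel X = distr std_normal_distribution borel (\<lambda>x. \<mu> + \<sigma> * x)" if "0 < \<sigma>" for \<mu> \<sigma>
    unfolding distributed_def distr_std_normal_affine[OF that]
    by (auto cong: distr_cong)
  have zero: "(AE \<omega> in M. X \<omega> = \<mu>) \<longleftrightarrow>
      distr M borel X = distr std_normal_distribution borel (\<lambda>x. \<mu> + 0 * x)" for \<mu>
  proof
    assume "AE \<omega> in M. X \<omega> = \<mu>"
    then have "distr M borel X = distr M borel (\<lambda>_. \<mu>)"
      by (intro distr_cong_AE) auto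
    then show "distr M borel X = distr std_normal_distribution borel (\<lambda>x. \<mu> + 0 * x)"
      by (simp add: distr_const N.distr_const)
  next
    assume eq: "distr M borel X = distr std_normal_distribution borel (\<lambda>x. \<mu> + 0 * x)"
    have "AE x in distr M borel X. x = \<mu>"
      unfolding eq by (subst AE_distr_iff) auto
    then show "AE \<omega> in M. X \<omega> = \<mu>"
      by (simp add: AE_distr_iff)
  qed
  show ?thesis
    unfolding gaussian_rv_def using pos zero
    by (metis less_eq_real_def order_refl True)
qed (simp add: gaussian_rv_def)

lemma (in prob_space) gaussian_rv_normal_form:
  assumes "gaussian_rv M X"
  obtains \<mu> \<sigma> where "0 \<le> \<sigma>" "distr M borel X = distr std_normal_distribution borel (\<lambda>x. \<mu> + \<sigma> * x)"
  using assms gaussian_rv_iff_distr by blast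

section \<open>Moments and characteristic functions of Gaussian variables\<close>

lemma integrable_std_normal_poly:
  "integrable std_normal_distribution (\<lambda>x::real. (1 + x\<^sup>2) ^ k)"
proof -
  interpret prob_space std_normal_distribution by (rule prob_space_std_normal)
  have "integrable std_normal_distribution (\<lambda>x::real. \<Sum>i\<le>k. of_nat (k choose i) * x ^ (2 * (k - i)))"
    by (intro Bochner_Integration.integrable_sum integrable_mult_right integrable_std_normal_distribution_moment)
  also have "(\<lambda>x::real. \<Sum>i\<le>k. of_nat (k choose i) * x ^ (2 * (k - i))) = (\<lambda>x. (1 + x\<^sup>2) ^ k)"
    by (simp add: binomial_ring power_mult fun_eq_iff)
  finally show ?thesis .
qed

text \<open>Cauchy-Schwarz for the vectors \<open>(a, b)\<close> and \<open>(1, x)\<close>; the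
  defect is the square of the determinant \<open>a * x - b\<close>.\<close>

lemma affine_square_le: "(a + b * x)\<^sup>2 \<le> (a\<^sup>2 + b\<^sup>2) * (1 + (x::real)\<^sup>2)"
proof -
  have "(a\<^sup>2 + b\<^sup>2) * (1 + x\<^sup>2) - (a + b * x)\<^sup>2 = (a * x - b)\<^sup>2"
    by (simp add: power2_eq_square algebra_simps)
  then show ?thesis by (metis diff_ge_0_iff_ge zero_le_power2)
qed

lemma affine_power_le: "(a + b * x) ^ (2 * k) \<le> (a\<^sup>2 + b\<^sup>2) ^ k * (1 + (x::real)\<^sup>2) ^ k"
  unfolding power_mult power_mult_distrib[symmetric]
  by (intro power_mono affine_square_le) auto

lemma integrable_std_normal_affine_power:
  "integrable std_normal_distribution (\<lambda>x::real. (a + b * x) ^ (2 * k))"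
  by (rule Bochner_Integration.integrable_bound[OF integrable_mult_right[OF integrable_std_normal_poly, of "(a\<^sup>2 + b\<^sup>2) ^ k" k]])
     (auto intro!: AE_I2 order.trans[OF _ affine_power_le] simp: power_mult)

lemma std_normal_second_moment:
  "(\<integral>x. (a + b * x)\<^sup>2 \<partial>std_normal_distribution) = a\<^sup>2 + b\<^sup>2"
proof -
  interpret prob_space std_normal_distribution by (rule prob_space_std_normal)
  note int = integrable_std_normal_distribution_moment
  have "(\<integral>x. (a + b * x)\<^sup>2 \<partial>std_normal_distribution)
     = (\<integral>x. a\<^sup>2 + (2 * a * b) * x ^ 1 + b\<^sup>2 * x ^ 2 \<partial>std_normal_distribution)"
    by (simp add: power2_eq_square algebra_simps)
  also have "\<dots> = a\<^sup>2 + b\<^sup>2"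
    using int[of 1] int[of 2] integral_std_normal_distribution_moment_odd[of 1] std_normal_distribution_even_moments[of 1]
    by (subst Bochner_Integration.integral_add Bochner_Integration.integrable_add, simp_all add: prob_space)+
  finally show ?thesis .
qed

lemma std_normal_first_moment:
  "integrable std_normal_distribution (\<lambda>x. a + b * x)"
  "(\<integral>x. a + b * x \<partial>std_normal_distribution) = a"
proof -
  interpret prob_space std_normal_distribution by (rule prob_space_std_normal)
  note int = integrable_std_normal_distribution_moment[of 1]
  show "integrable std_normal_distribution (\<lambda>x. a + b * x)"
    using int by simp
  show "(\<integral>x. a + b * x \<partial>std_normal_distribution) = a"
    using int integral_std_normal_distribution_moment_odd[of 1] by (simp add: prob_space)
qed

text \<open>The weight comes from \<open>affine_power_le\<close>. Since
  \<open>\<mu> + \<sigma> * x\<close> has second moment \<open>\<mu>^2 + \<sigma>^2\<close>, one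
  constant per \<open>k\<close> bounds the moment of order \<open>2 * k\<close> for all means and
  variances at once.\<close>

definition gauss_const :: "nat \<Rightarrow> real" where
  "gauss_const k = (\<integral>x. (1 + x\<^sup>2) ^ k \<partial>std_normal_distribution)"

lemma gauss_const_ge_1: "1 \<le> gauss_const k"
proof -
  interpret prob_space std_normal_distribution by (rule prob_space_std_normal)
  have "(\<integral>x. 1 \<partial>std_normal_distribution) \<le> gauss_const k"
    unfolding gauss_const_def
    by (intro integral_mono integrable_std_normal_poly) (auto intro: one_le_power)
  then show ?thesis by (simp add: prob_space)
qed

context prob_space
begin

text \<open>All integrals are transported to the standard normal law through
  \<open>\<mu> + \<sigma> * x\<close>. The moment bound is a reverse Hoelder inequality: for
  Gaussian variables the second moment controls every higher one.\<close>

lemma gaussian_rv_moments: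
  assumes "gaussian_rv M X"
  shows gaussian_rv_integrable: "integrable M X"
    and gaussian_rv_integrable_power: "integrable M (\<lambda>\<omega>. X \<omega> ^ (2 * k))"
    and gaussian_rv_integrable_square: "integrable M (\<lambda>\<omega>. (X \<omega>)\<^sup>2)"
    and gaussian_rv_moment_le: "expectation (\<lambda>\<omega>. X \<omega> ^ (2 * k)) \<le> gauss_const k * (expectation (\<lambda>\<omega>. (X \<omega>)\<^sup>2)) ^ k"
    and gaussian_rv_char: "(CLINT \<omega>|M. iexp (s * X \<omega>)) =
      iexp (s * expectation X) * exp (- (s\<^sup>2 * variance X) / 2)"
proof -
  have [measurable]: "X \<in> borel_measurable M" using assms by (rule gaussian_rv_measurable)
  obtain \<mu> \<sigma> where "0 \<le> \<sigma>" and D: "distr M borel X = distr std_normal_distribution borel (\<lambda>x. \<mu> + \<sigma> * x)"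
    using gaussian_rv_normal_form[OF assms] .
  have int: "integrable M (\<lambda>\<omega>. f (X \<omega>)) \<longleftrightarrow> integrable std_normal_distribution (\<lambda>x. f (\<mu> + \<sigma> * x))"
    if [measurable]: "f \<in> borel_measurable borel" for f :: "real \<Rightarrow> real"
    using integrable_distr_eq[of X M borel f] integrable_distr_eq[of "\<lambda>x. \<mu> + \<sigma> * x" std_normal_distribution borel f] D
    by simp
  have ex: "expectation (\<lambda>\<omega>. f (X \<omega>)) = (\<integral>x. f (\<mu> + \<sigma> * x) \<partial>std_normal_distribution)"
    if [measurable]: "f \<in> borel_measurable borel" for f :: "real \<Rightarrow> real"
    using integral_distr[of X M borel f] integral_distr[of "\<lambda>x. \<mu> + \<sigma> * x" std_normal_distribution borel f] D
    by simp
  show i1: "integrable M X"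
    using int[of "\<lambda>x. x"] std_normal_first_moment(1) by simp
  have m1: "expectation X = \<mu>"
    using ex[of "\<lambda>x. x"] std_normal_first_moment(2) by simp
  show ik: "integrable M (\<lambda>\<omega>. X \<omega> ^ (2 * k))" for k
    using int[of "\<lambda>x. x ^ (2*k)"] integrable_std_normal_affine_power by simp
  show i2: "integrable M (\<lambda>\<omega>. (X \<omega>)\<^sup>2)"
    using ik[of 1] by simp
  have m2: "expectation (\<lambda>\<omega>. (X \<omega>)\<^sup>2) = \<mu>\<^sup>2 + \<sigma>\<^sup>2"
    using ex[of "\<lambda>x. x\<^sup>2"] std_normal_second_moment by simp
  have "expectation (\<lambda>\<omega>. X \<omega> ^ (2 * k)) = (\<integral>x. (\<mu> + \<sigma> * x) ^ (2 * k) \<partial>std_normal_distribution)"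
    using ex[of "\<lambda>x. x ^ (2*k)"] by simp
  also have "\<dots> \<le> (\<integral>x. (\<mu>\<^sup>2 + \<sigma>\<^sup>2) ^ k * (1 + x\<^sup>2) ^ k \<partial>std_normal_distribution)"
    by (intro integral_mono integrable_std_normal_affine_power integrable_mult_right integrable_std_normal_poly affine_power_le)
  finally show "expectation (\<lambda>\<omega>. X \<omega> ^ (2 * k)) \<le> gauss_const k * (expectation (\<lambda>\<omega>. (X \<omega>)\<^sup>2)) ^ k"
    by (simp add: gauss_const_def m2 mult.commute)
  have v: "variance X = \<sigma>\<^sup>2"
    using variance_eq[OF i1 i2] m1 m2 by simp
  have "(CLINT \<omega>|M. iexp (s * X \<omega>)) = (CLINT x|distr M borel X. iexp (s * x))"
    by (subst integral_distr) auto
  also have "\<dots> = (CLINT x|std_normal_distribution. iexp (s * (\<mu> + \<sigma> * x)))"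
    unfolding D by (subst integral_distr) auto
  also have "\<dots> = (CLINT x|std_normal_distribution. iexp (s * \<mu>) * iexp ((s * \<sigma>) * x))"
    by (simp add: exp_add[symmetric] algebra_simps)
  also have "\<dots> = iexp (s * \<mu>) * char std_normal_distribution (s * \<sigma>)"
    unfolding char_def by (rule Bochner_Integration.integral_mult_right_zero)
  also have "\<dots> = iexp (s * \<mu>) * exp (- (s\<^sup>2 * \<sigma>\<^sup>2) / 2)"
    by (simp add: char_std_normal_distribution power_mult_distrib)
  finally show "(CLINT \<omega>|M. iexp (s * X \<omega>)) = iexp (s * expectation X) * exp (- (s\<^sup>2 * variance X) / 2)"
    unfolding v unfolding m1 .
qed

text \<open>Levy's uniqueness theorem identifies the law. This form is suited to limits, where only
  limits of means and variances are known, and \<open>v = 0\<close> covers degenerate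
  limits.\<close>

lemma gaussian_rv_of_char:
  assumes [measurable]: "X \<in> borel_measurable M" and "0 \<le> v"
    and char: "\<And>s. (CLINT \<omega>|M. iexp (s * X \<omega>)) = iexp (s * \<mu>) * exp (- (s\<^sup>2 * v) / 2)"
  shows "gaussian_rv M X"
proof -
  interpret N: prob_space std_normal_distribution by (rule prob_space_std_normal)
  let ?N = "distr std_normal_distribution borel (\<lambda>x. \<mu> + sqrt v * x)"
  have "char ?N s = char (distr M borel X) s" for s
  proof -
    have "char ?N s = (CLINT x|std_normal_distribution. iexp (s * (\<mu> + sqrt v * x)))"
      unfolding char_def by (subst integral_distr) auto
    also have "\<dots> = (CLINT x|std_normal_distribution. iexp (s * \<mu>) * iexp ((s * sqrt v) * x))"
      by (simp add: exp_add[symmetric] algebra_simps)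
    also have "\<dots> = iexp (s * \<mu>) * char std_normal_distribution (s * sqrt v)"
      unfolding char_def by (rule Bochner_Integration.integral_mult_right_zero)
    also have "\<dots> = iexp (s * \<mu>) * exp (- (s\<^sup>2 * v) / 2)"
      using \<open>0 \<le> v\<close> by (simp add: char_std_normal_distribution power_mult_distrib)
    also have "\<dots> = (CLINT \<omega>|M. iexp (s * X \<omega>))"
      by (rule char[symmetric])
    also have "\<dots> = char (distr M borel X) s"
      unfolding char_def by (subst integral_distr) auto
    finally show ?thesis .
  qed
  then have "distr M borel X = ?N"
    by (intro Levy_uniqueness real_distribution_distr N.real_distribution_distr) auto
  then show ?thesis
    unfolding gaussian_rv_iff_distr using \<open>0 \<le> v\<close> by (intro conjI exI[of _ \<mu>] exI[of _ "sqrt v"]) auto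
qed

end

section \<open>Mean-square control from almost sure control\<close>

context prob_space
begin

text \<open>
  A Paley--Zygmund argument with fourth moments. It turns almost sure bounds and limits of Gaussian
  variables into bounds and limits in \<open>L\<^sup>2\<close>.
\<close>

lemma gaussian_rv_square_le_of_prob:
  assumes X: "gaussian_rv M X"
    and small: "prob {\<omega>\<in>space M. K < \<bar>X \<omega>\<bar>} < 1 / (4 * gauss_const 2)"
    and "0 \<le> K"
  shows "expectation (\<lambda>\<omega>. (X \<omega>)\<^sup>2) \<le> 2 * K\<^sup>2"
proof (rule ccontr)
  define m where "m = expectation (\<lambda>\<omega>. (X \<omega>)\<^sup>2)"
  define C where "C = gauss_const 2"
  define A where "A = {\<omega>\<in>space M. K < \<bar>X \<omega>\<bar>}"
  have [measurable]: "X \<in> borel_measurable M" using X by (rule gaussian_rv_measurable)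
  have A [measurable]: "A \<in> events" unfolding A_def by measurable
  assume "\<not> ?thesis"
  then have m: "2 * K\<^sup>2 < m" by (simp add: m_def)
  then have "0 < m" by (smt (verit) zero_le_power2)
  have "0 < C" using gauss_const_ge_1[of 2] by (simp add: C_def)
  have i4: "integrable M (\<lambda>\<omega>. X \<omega> ^ 4)"
    using gaussian_rv_integrable_power[OF X, of 2] by simp
  \<comment> \<open>AM-GM with weights fitted to \<open>E X^4 \<le> C * m^2\<close>: the quartic
    term then costs at most \<open>m / 4\<close>, and the term on \<open>A\<close> at most
    \<open>m / 4\<close> because \<open>prob A < 1 / (4 * C)\<close>. With
    \<open>K^2 < m / 2\<close> the total is below \<open>m\<close>.\<close>
  have pw: "(X \<omega>)\<^sup>2 \<le> K\<^sup>2 + X \<omega> ^ 4 / (4 * C * m) + C * m * indicator A \<omega>" if "\<omega> \<in> space M" for \<omega>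
  proof (cases "\<omega> \<in> A")
    case True
    have "0 \<le> ((X \<omega>)\<^sup>2 - 2 * C * m)\<^sup>2 / (4 * C * m)"
      using \<open>0 < m\<close> \<open>0 < C\<close> by simp
    also have "\<dots> = X \<omega> ^ 4 / (4 * C * m) + C * m - (X \<omega>)\<^sup>2"
      using \<open>0 < m\<close> \<open>0 < C\<close> by (simp add: field_simps power2_eq_square power4_eq_xxxx)
    finally have "(X \<omega>)\<^sup>2 \<le> X \<omega> ^ 4 / (4 * C * m) + C * m" by simp
    moreover have "0 \<le> K\<^sup>2" by simp
    ultimately have "(X \<omega>)\<^sup>2 \<le> K\<^sup>2 + X \<omega> ^ 4 / (4 * C * m) + C * m" by linarith
    then show ?thesis using True by simp
  next
    case False
    then have "\<bar>X \<omega>\<bar> \<le> K" using that by (auto simp: A_def)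
    then have "(X \<omega>)\<^sup>2 \<le> K\<^sup>2" using abs_le_square_iff[of "X \<omega>" K] by simp
    moreover have "0 \<le> X \<omega> ^ 4 / (4 * C * m)"
      using \<open>0 < m\<close> \<open>0 < C\<close> by simp
    ultimately show ?thesis using False by simp
  qed
  have iA: "integrable M (indicator A :: 'a \<Rightarrow> real)"
    using A by (intro integrable_real_indicator) (auto simp: emeasure_eq_measure)
  have "integrable M (\<lambda>\<omega>. K\<^sup>2 + X \<omega> ^ 4 / (4 * C * m) + C * m * indicator A \<omega>)"
    using i4 iA by (intro Bochner_Integration.integrable_add integrable_mult_right integrable_divide) auto
  with gaussian_rv_integrable_square[OF X]
  have "expectation (\<lambda>\<omega>. (X \<omega>)\<^sup>2) \<le> expectation (\<lambda>\<omega>. K\<^sup>2 + X \<omega> ^ 4 / (4 * C * m) + C * m * indicator A \<omega>)"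
    by (rule integral_mono) (rule pw)
  then have "m \<le> expectation (\<lambda>\<omega>. K\<^sup>2 + X \<omega> ^ 4 / (4 * C * m) + C * m * indicator A \<omega>)"
    by (simp only: m_def[symmetric])
  also have "\<dots> = K\<^sup>2 + expectation (\<lambda>\<omega>. X \<omega> ^ 4) / (4 * C * m) + C * m * prob A"
    using i4 iA A by (simp add: prob_space)
  also have "\<dots> \<le> K\<^sup>2 + C * m\<^sup>2 / (4 * C * m) + C * m * prob A"
    using gaussian_rv_moment_le[OF X, of 2] \<open>0 < m\<close> \<open>0 < C\<close>
    by (intro add_mono divide_right_mono) (auto simp: C_def m_def)
  also have "C * m\<^sup>2 / (4 * C * m) = m / 4"
    using \<open>0 < m\<close> \<open>0 < C\<close> by (simp add: power2_eq_square)
  also have "K\<^sup>2 + m / 4 + C * m * prob A < m / 2 + m / 4 + C * m * (1 / (4 * C))"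
    using small m \<open>0 < m\<close> \<open>0 < C\<close>
    by (intro add_less_le_mono mult_left_mono) (auto simp: C_def A_def)
  also have "\<dots> = m" using \<open>0 < C\<close> by simp
  finally show False by simp
qed

lemma prob_tendsto_0:
  assumes [measurable]: "\<And>n. A n \<in> events"
    and "AE \<omega> in M. eventually (\<lambda>n. \<omega> \<notin> A n) sequentially"
  shows "(\<lambda>n. prob (A n)) \<longlonglongrightarrow> 0"
proof -
  have "(\<lambda>n. expectation (indicator (A n) :: _ \<Rightarrow> real)) \<longlonglongrightarrow> expectation (\<lambda>_. 0)"
  proof (rule integral_dominated_convergence[where w="\<lambda>_. 1"])
    show "AE \<omega> in M. (\<lambda>n. indicator (A n) \<omega> :: real) \<longlonglongrightarrow> 0"
      using assms(2) by eventually_elim (rule tendsto_eventually, auto elim: eventually_mono)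
  qed (auto simp: indicator_def)
  then show ?thesis by simp
qed

text \<open>The events \<open>A k\<close> decrease to a null set, so a single threshold
  \<open>k\<close> has small enough exceptional probability for all \<open>n\<close>
  simultaneously.\<close>

lemma gaussian_seq_bounded:
  fixes X :: "nat \<Rightarrow> 'a \<Rightarrow> real"
  assumes X: "\<And>n. gaussian_rv M (X n)"
    and bdd: "AE \<omega> in M. \<exists>B. \<forall>n. \<bar>X n \<omega>\<bar> \<le> B"
  shows "\<exists>C. \<forall>n. expectation (\<lambda>\<omega>. (X n \<omega>)\<^sup>2) \<le> C"
proof -
  have [measurable]: "X n \<in> borel_measurable M" for n using X by (rule gaussian_rv_measurable)
  define A where "A k = {\<omega>\<in>space M. \<exists>n. real k < \<bar>X n \<omega>\<bar>}" for k
  have A [measurable]: "A k \<in> events" for k unfolding A_def by measurable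
  have "(\<lambda>k. prob (A k)) \<longlonglongrightarrow> 0"
  proof (rule prob_tendsto_0)
    show "AE \<omega> in M. eventually (\<lambda>k. \<omega> \<notin> A k) sequentially"
      using bdd
    proof eventually_elim
      case (elim \<omega>)
      then obtain B where "\<And>n. \<bar>X n \<omega>\<bar> \<le> B" by auto
      moreover obtain k0 :: nat where "B \<le> k0" using real_arch_simple by blast
      ultimately have "\<bar>X n \<omega>\<bar> \<le> real k" if "k0 \<le> k" for n k
        using that by (meson of_nat_le_iff order.trans)
      then show ?case unfolding eventually_sequentially A_def
        by (intro exI[of _ k0]) (auto simp: not_less)
    qed
  qed fact
  moreover have "0 < 1 / (4 * gauss_const 2)" using gauss_const_ge_1[of 2] by simp
  ultimately have "eventually (\<lambda>k. prob (A k) < 1 / (4 * gauss_const 2)) sequentially"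
    by (rule order_tendstoD)
  then obtain k where k: "prob (A k) < 1 / (4 * gauss_const 2)"
    by (auto simp: eventually_sequentially)
  have "expectation (\<lambda>\<omega>. (X n \<omega>)\<^sup>2) \<le> 2 * (real k)\<^sup>2" for n
  proof (rule gaussian_rv_square_le_of_prob[OF X])
    have "prob {\<omega>\<in>space M. real k < \<bar>X n \<omega>\<bar>} \<le> prob (A k)"
      by (rule finite_measure_mono) (auto simp: A_def)
    then show "prob {\<omega>\<in>space M. real k < \<bar>X n \<omega>\<bar>} < 1 / (4 * gauss_const 2)"
      using k by simp
  qed simp
  then show ?thesis by blast
qed

lemma gaussian_seq_null:
  fixes X :: "nat \<Rightarrow> 'a \<Rightarrow> real"
  assumes X: "\<And>n. gaussian_rv M (X n)"
    and lim: "AE \<omega> in M. (\<lambda>n. X n \<omega>) \<longlonglongrightarrow> 0"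
  shows "(\<lambda>n. expectation (\<lambda>\<omega>. (X n \<omega>)\<^sup>2)) \<longlonglongrightarrow> 0"
proof (rule LIMSEQ_I)
  fix e :: real assume "0 < e"
  have [measurable]: "X n \<in> borel_measurable M" for n using X by (rule gaussian_rv_measurable)
  \<comment> \<open>Chosen so that the resulting bound \<open>2 * K^2\<close> is
    \<open>e / 2\<close>.\<close>
  define K where "K = sqrt (e / 4)"
  have K: "0 < K" "2 * K\<^sup>2 < e" using \<open>0 < e\<close> by (auto simp: K_def)
  have "(\<lambda>n. prob {\<omega>\<in>space M. K < \<bar>X n \<omega>\<bar>}) \<longlonglongrightarrow> 0"
  proof (rule prob_tendsto_0)
    show "AE \<omega> in M. eventually (\<lambda>n. \<omega> \<notin> {\<omega>\<in>space M. K < \<bar>X n \<omega>\<bar>}) sequentially"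
      using lim
    proof eventually_elim
      case (elim \<omega>)
      then have "eventually (\<lambda>n. \<bar>X n \<omega>\<bar> < K) sequentially"
        using order_tendstoD(2)[OF tendsto_rabs_zero[OF elim]] K by auto
      then show ?case by eventually_elim auto
    qed
  qed measurable
  moreover have "0 < 1 / (4 * gauss_const 2)" using gauss_const_ge_1[of 2] by simp
  ultimately have "eventually (\<lambda>n. prob {\<omega>\<in>space M. K < \<bar>X n \<omega>\<bar>} < 1 / (4 * gauss_const 2)) sequentially"
    by (rule order_tendstoD)
  then obtain N where N: "\<And>n. n \<ge> N \<Longrightarrow> prob {\<omega>\<in>space M. K < \<bar>X n \<omega>\<bar>} < 1 / (4 * gauss_const 2)"
    by (auto simp: eventually_sequentially)
  have "norm (expectation (\<lambda>\<omega>. (X n \<omega>)\<^sup>2) - 0) < e" if "n \<ge> N" for n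
    using gaussian_rv_square_le_of_prob[OF X N[OF that]] K by (simp add: integral_nonneg_AE)
  then show "\<exists>N. \<forall>n\<ge>N. norm (expectation (\<lambda>\<omega>. (X n \<omega>)\<^sup>2) - 0) < e" by blast
qed

lemma gaussian_rv_mean_square_le:
  assumes "gaussian_rv M X"
  shows "(expectation X)\<^sup>2 \<le> expectation (\<lambda>\<omega>. (X \<omega>)\<^sup>2)" "variance X \<le> expectation (\<lambda>\<omega>. (X \<omega>)\<^sup>2)"
  using variance_eq[OF gaussian_rv_integrable gaussian_rv_integrable_square, OF assms assms]
    variance_positive[of X] by (auto simp del: variance_positive)

text \<open>Means and variances stay bounded, hence converge along a subsequence. Along it the
  characteristic functions converge to a Gaussian one, and by dominated convergence also to that of
  \<open>Y\<close>.\<close>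

lemma gaussian_rv_AE_limit:
  fixes X :: "nat \<Rightarrow> 'a \<Rightarrow> real"
  assumes X: "\<And>n. gaussian_rv M (X n)" and [measurable]: "Y \<in> borel_measurable M"
    and lim: "AE \<omega> in M. (\<lambda>n. X n \<omega>) \<longlonglongrightarrow> Y \<omega>"
  shows "gaussian_rv M Y"
proof -
  have [measurable]: "X n \<in> borel_measurable M" for n using X by (rule gaussian_rv_measurable)
  have "AE \<omega> in M. \<exists>B. \<forall>n. \<bar>X n \<omega>\<bar> \<le> B"
    using lim
  proof eventually_elim
    case (elim \<omega>)
    then have "Bseq (\<lambda>n. X n \<omega>)" by (intro convergent_imp_Bseq convergentI)
    then show ?case by (auto simp: Bseq_def)
  qed
  then obtain C where C: "\<And>n. expectation (\<lambda>\<omega>. (X n \<omega>)\<^sup>2) \<le> C"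
    using gaussian_seq_bounded[of X, OF X] by blast
  define p where "p n = (expectation (X n), variance (X n))" for n
  have p: "\<bar>fst (p n)\<bar> \<le> sqrt C" "0 \<le> snd (p n)" "snd (p n) \<le> C" for n
  proof -
    have "(expectation (X n))\<^sup>2 \<le> C"
      using gaussian_rv_mean_square_le(1)[OF X[of n]] C[of n] by simp
    then show "\<bar>fst (p n)\<bar> \<le> sqrt C"
      by (simp add: p_def real_le_rsqrt)
    show "0 \<le> snd (p n)" by (simp add: p_def)
    show "snd (p n) \<le> C"
      using gaussian_rv_mean_square_le(2)[OF X[of n]] C[of n] by (simp add: p_def)
  qed
  have "norm (p n) \<le> sqrt C + C" for n
    using p[of n] norm_Pair_le[of "fst (p n)" "snd (p n)"] by auto
  then have "bounded (range p)" unfolding bounded_iff by blast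
  then obtain l r where r: "strict_mono r" and l: "(p \<circ> r) \<longlonglongrightarrow> l"
    using bounded_imp_convergent_subsequence by blast
  have l1: "(\<lambda>n. expectation (X (r n))) \<longlonglongrightarrow> fst l" and l2: "(\<lambda>n. variance (X (r n))) \<longlonglongrightarrow> snd l"
    using tendsto_fst[OF l] tendsto_snd[OF l] by (auto simp: p_def o_def)
  have "0 \<le> snd l"
    using l2 by (rule LIMSEQ_le_const) auto
  moreover have "(CLINT \<omega>|M. iexp (s * Y \<omega>)) = iexp (s * fst l) * exp (- (s\<^sup>2 * snd l) / 2)" for s
  proof (rule LIMSEQ_unique)
    show "(\<lambda>n. CLINT \<omega>|M. iexp (s * X (r n) \<omega>)) \<longlonglongrightarrow> (CLINT \<omega>|M. iexp (s * Y \<omega>))"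
    proof (rule integral_dominated_convergence[where w="\<lambda>_. 1"])
      show "AE \<omega> in M. (\<lambda>n. iexp (s * X (r n) \<omega>)) \<longlonglongrightarrow> iexp (s * Y \<omega>)"
        using lim
      proof eventually_elim
        case (elim \<omega>)
        have "(\<lambda>n. X (r n) \<omega>) \<longlonglongrightarrow> Y \<omega>"
          using LIMSEQ_subseq_LIMSEQ[OF elim r] by (simp add: o_def)
        then show ?case by (intro tendsto_intros)
      qed
    qed auto
    have "(\<lambda>n. iexp (s * expectation (X (r n))) * exp (- (s\<^sup>2 * variance (X (r n))) / 2))
        \<longlonglongrightarrow> iexp (s * fst l) * exp (- (s\<^sup>2 * snd l) / 2)"
      using l1 l2 by (intro tendsto_intros) auto
    then show "(\<lambda>n. CLINT \<omega>|M. iexp (s * X (r n) \<omega>)) \<longlonglongrightarrow> iexp (s * fst l) * exp (- (s\<^sup>2 * snd l) / 2)"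
      by (simp only: gaussian_rv_char[OF X])
  qed
  ultimately show ?thesis by (intro gaussian_rv_of_char) auto
qed

end

section \<open>Independence of uncorrelated Gaussian variables\<close>

lemma (in prob_space) integrable_mult_bounded:
  fixes f g :: "'a \<Rightarrow> 'b::{real_normed_div_algebra, banach, second_countable_topology}"
  assumes "f \<in> borel_measurable M" "g \<in> borel_measurable M" "\<And>\<omega>. norm (f \<omega>) \<le> B" "\<And>\<omega>. norm (g \<omega>) \<le> 1"
  shows "integrable M (\<lambda>\<omega>. f \<omega> * g \<omega>)"
proof (rule integrable_const_bound[of _ B])
  have "norm (f \<omega>) * norm (g \<omega>) \<le> B * 1" for \<omega>
    using assms order.trans[OF norm_ge_zero assms(3)] by (intro mult_mono) auto
  then show "AE x in M. norm (f x * g x) \<le> B" by (simp add: norm_mult)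
qed (use assms in measurable)

text \<open>Levy's theorem concerns probability laws, while \<open>W\<close> is signed. Its positive
  and negative parts have the same mass \<open>c\<close> (take \<open>s = 0\<close>); divided by
  \<open>c\<close> they are densities of two probability measures under which \<open>X\<close> has
  the same characteristic function. For \<open>c = 0\<close> both parts vanish almost
  everywhere.\<close>

lemma (in prob_space) integral_indicator_eq_of_char_real:
  fixes W :: "'a \<Rightarrow> real"
  assumes [measurable]: "W \<in> borel_measurable M" "X \<in> borel_measurable M" "A \<in> sets borel"
    and bdd: "\<And>\<omega>. \<bar>W \<omega>\<bar> \<le> B"
    and char: "\<And>s. (CLINT \<omega>|M. W \<omega> * iexp (s * X \<omega>)) = 0"
  shows "expectation (\<lambda>\<omega>. W \<omega> * indicator A (X \<omega>)) = 0"
proof -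
  define U where "U = (\<lambda>\<omega>. max 0 (W \<omega>))"
  define V where "V = (\<lambda>\<omega>. max 0 (- W \<omega>))"
  have [measurable]: "U \<in> borel_measurable M" "V \<in> borel_measurable M"
    unfolding U_def V_def by measurable
  have W: "W \<omega> = U \<omega> - V \<omega>" for \<omega> by (auto simp: U_def V_def max_def)
  have UV: "0 \<le> U \<omega>" "0 \<le> V \<omega>" "\<bar>U \<omega>\<bar> \<le> B" "\<bar>V \<omega>\<bar> \<le> B" for \<omega>
    using bdd[of \<omega>] by (auto simp: U_def V_def max_def)
  note int = integrable_mult_bounded[where B = B]
  have iU: "integrable M U" and iV: "integrable M V"
    using int[of U "\<lambda>_. 1"] int[of V "\<lambda>_. 1"] UV by auto
  have UVchar: "(CLINT \<omega>|M. U \<omega> * iexp (s * X \<omega>)) = (CLINT \<omega>|M. V \<omega> * iexp (s * X \<omega>))" for s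
  proof -
    have "(CLINT \<omega>|M. U \<omega> * iexp (s * X \<omega>)) - (CLINT \<omega>|M. V \<omega> * iexp (s * X \<omega>))
      = (CLINT \<omega>|M. U \<omega> * iexp (s * X \<omega>) - V \<omega> * iexp (s * X \<omega>))"
      by (rule Bochner_Integration.integral_diff[symmetric]; rule int) (use UV in auto)
    also have "\<dots> = 0" using char[of s] by (simp add: W left_diff_distrib)
    finally show ?thesis by simp
  qed
  define c where "c = expectation U"
  have "complex_of_real (expectation U) = complex_of_real (expectation V)"
    using UVchar[of 0] by (simp add: integral_complex_of_real)
  then have c: "expectation V = c" by (simp add: c_def)
  have "0 \<le> c" unfolding c_def by (rule integral_nonneg_AE) (use UV in auto)
  have split: "expectation (\<lambda>\<omega>. W \<omega> * indicator A (X \<omega>))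
    = expectation (\<lambda>\<omega>. U \<omega> * indicator A (X \<omega>)) - expectation (\<lambda>\<omega>. V \<omega> * indicator A (X \<omega>))"
    unfolding W left_diff_distrib
    by (rule Bochner_Integration.integral_diff; rule int) (use UV in \<open>auto simp: indicator_def\<close>)
  show ?thesis
  proof (cases "c = 0")
    case True
    have "AE \<omega> in M. U \<omega> = 0"
      using integral_nonneg_eq_0_iff_AE[OF iU] UV True by (simp add: c_def)
    moreover have "AE \<omega> in M. V \<omega> = 0"
      using integral_nonneg_eq_0_iff_AE[OF iV] UV True c by simp
    ultimately have "AE \<omega> in M. W \<omega> * indicator A (X \<omega>) = 0"
      by eventually_elim (simp add: W)
    then show ?thesis by (rule integral_eq_zero_AE)
  next
    case False
    with \<open>0 \<le> c\<close> have "0 < c" by simp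
    have main: "real_distribution (distr (density M (\<lambda>\<omega>. ennreal (Y \<omega> / c))) borel X) \<and>
       measure (distr (density M (\<lambda>\<omega>. ennreal (Y \<omega> / c))) borel X) A = expectation (\<lambda>\<omega>. Y \<omega> * indicator A (X \<omega>)) / c \<and>
       (\<forall>s. char (distr (density M (\<lambda>\<omega>. ennreal (Y \<omega> / c))) borel X) s = (CLINT \<omega>|M. Y \<omega> * iexp (s * X \<omega>)) / c)"
      if [measurable]: "Y \<in> borel_measurable M" and Y: "\<And>\<omega>. 0 \<le> Y \<omega>" and iY: "integrable M Y" and eY: "expectation Y = c" for Y
    proof -
      let ?D = "density M (\<lambda>\<omega>. ennreal (Y \<omega> / c))"
      have "emeasure ?D (space ?D) = (\<integral>\<^sup>+ \<omega>. ennreal (Y \<omega> / c) \<partial>M)"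
        by (simp add: emeasure_density cong: nn_integral_cong)
      also have "\<dots> = ennreal (expectation (\<lambda>\<omega>. Y \<omega> / c))"
        by (rule nn_integral_eq_integral) (use iY Y \<open>0 < c\<close> in auto)
      also have "\<dots> = 1" using eY \<open>0 < c\<close> by simp
      finally interpret D: prob_space ?D by (rule prob_spaceI)
      have "real_distribution (distr ?D borel X)" by (rule D.real_distribution_distr) simp
      moreover have "measure (distr ?D borel X) A = expectation (\<lambda>\<omega>. Y \<omega> * indicator A (X \<omega>)) / c"
      proof -
        have "measure (distr ?D borel X) A = (\<integral>x. indicator A x \<partial>distr ?D borel X)" by simp
        also have "\<dots> = (\<integral>\<omega>. indicator A (X \<omega>) \<partial>?D)" by (rule integral_distr) auto
        also have "\<dots> = (\<integral>\<omega>. (Y \<omega> / c) *\<^sub>R indicator A (X \<omega>) \<partial>M)"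
          by (rule integral_density) (use Y \<open>0 < c\<close> in auto)
        finally show ?thesis by simp
      qed
      moreover have "char (distr ?D borel X) s = (CLINT \<omega>|M. Y \<omega> * iexp (s * X \<omega>)) / c" for s
      proof -
        have "char (distr ?D borel X) s = (\<integral>\<omega>. iexp (s * X \<omega>) \<partial>?D)"
          unfolding char_def by (rule integral_distr) auto
        also have "\<dots> = (\<integral>\<omega>. (Y \<omega> / c) *\<^sub>R iexp (s * X \<omega>) \<partial>M)"
          by (rule integral_density) (use Y \<open>0 < c\<close> in auto)
        also have "\<dots> = (CLINT \<omega>|M. Y \<omega> * iexp (s * X \<omega>) / c)"
          by (simp add: scaleR_conv_of_real)
        also have "\<dots> = (CLINT \<omega>|M. Y \<omega> * iexp (s * X \<omega>)) / c"
          by (rule integral_divide_zero)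
        finally show ?thesis .
      qed
      ultimately show ?thesis by blast
    qed
    note mU = main[of U, OF _ UV(1) iU] and mV = main[of V, OF _ UV(2) iV c]
    have "distr (density M (\<lambda>\<omega>. ennreal (U \<omega> / c))) borel X = distr (density M (\<lambda>\<omega>. ennreal (V \<omega> / c))) borel X"
      using mU mV UVchar by (intro Levy_uniqueness ext) (auto simp: c_def)
    then have "expectation (\<lambda>\<omega>. U \<omega> * indicator A (X \<omega>)) / c = expectation (\<lambda>\<omega>. V \<omega> * indicator A (X \<omega>)) / c"
      using mU mV by (auto simp: c_def)
    then show ?thesis using split \<open>0 < c\<close> by simp
  qed
qed

text \<open>Replacing \<open>s\<close> by \<open>- s\<close> and conjugating shows that
  \<open>cnj W\<close> satisfies the same hypothesis, hence so do the real and the imaginary part of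
  \<open>W\<close>.\<close>

lemma (in prob_space) integral_indicator_eq_of_char:
  fixes W :: "'a \<Rightarrow> complex"
  assumes [measurable]: "W \<in> borel_measurable M" "X \<in> borel_measurable M" "A \<in> sets borel"
    and bdd: "\<And>\<omega>. norm (W \<omega>) \<le> B"
    and char: "\<And>s. (CLINT \<omega>|M. W \<omega> * iexp (s * X \<omega>)) = 0"
  shows "(CLINT \<omega>|M. W \<omega> * indicator A (X \<omega>)) = 0"
proof -
  note int = integrable_mult_bounded[where B = B]
  have [measurable]: "(\<lambda>\<omega>. cnj (W \<omega>)) \<in> borel_measurable M"
    by (rule measurable_compose[OF assms(1) borel_measurable_continuous_onI]) (intro continuous_intros)
  have cnj: "(CLINT \<omega>|M. cnj (W \<omega>) * iexp (s * X \<omega>)) = 0" for s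
  proof -
    have eq: "(\<lambda>\<omega>. cnj (W \<omega>) * iexp (s * X \<omega>)) = (\<lambda>\<omega>. cnj (W \<omega> * iexp ((- s) * X \<omega>)))"
      by (rule ext) (simp add: exp_cnj)
    then have "(CLINT \<omega>|M. cnj (W \<omega>) * iexp (s * X \<omega>)) = (CLINT \<omega>|M. cnj (W \<omega> * iexp ((- s) * X \<omega>)))"
      by (simp only: eq)
    also have "\<dots> = cnj (CLINT \<omega>|M. W \<omega> * iexp ((- s) * X \<omega>))" by (rule Bochner_Integration.integral_cnj)
    finally show ?thesis by (simp only: char complex_cnj_zero)
  qed
  have re: "expectation (\<lambda>\<omega>. Re (W \<omega>) * indicator A (X \<omega>)) = 0"
  proof (rule integral_indicator_eq_of_char_real[where B=B])
    fix s
    have eq: "(\<lambda>\<omega>. Re (W \<omega>) * iexp (s * X \<omega>)) = (\<lambda>\<omega>. (W \<omega> * iexp (s * X \<omega>) + cnj (W \<omega>) * iexp (s * X \<omega>)) / 2)"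
      by (rule ext) (simp add: complex_add_cnj distrib_right[symmetric])
    have "(CLINT \<omega>|M. Re (W \<omega>) * iexp (s * X \<omega>)) = (CLINT \<omega>|M. W \<omega> * iexp (s * X \<omega>) + cnj (W \<omega>) * iexp (s * X \<omega>)) / 2"
      by (simp only: eq integral_divide_zero)
    also have "\<dots> = 0"
      by (subst Bochner_Integration.integral_add; (rule int)?) (use char cnj bdd in \<open>auto simp del: of_real_mult\<close>)
    finally show "(CLINT \<omega>|M. Re (W \<omega>) * iexp (s * X \<omega>)) = 0" .
  qed (use bdd abs_Re_le_cmod in \<open>auto intro: order.trans\<close>)
  have im: "expectation (\<lambda>\<omega>. Im (W \<omega>) * indicator A (X \<omega>)) = 0"
  proof (rule integral_indicator_eq_of_char_real[where B=B])
    fix s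
    have eq: "(\<lambda>\<omega>. Im (W \<omega>) * iexp (s * X \<omega>)) = (\<lambda>\<omega>. (W \<omega> * iexp (s * X \<omega>) - cnj (W \<omega>) * iexp (s * X \<omega>)) / (2 * \<i>))"
      by (rule ext) (simp only: complex_diff_cnj left_diff_distrib[symmetric], simp add: field_simps)
    have "(CLINT \<omega>|M. Im (W \<omega>) * iexp (s * X \<omega>)) = (CLINT \<omega>|M. W \<omega> * iexp (s * X \<omega>) - cnj (W \<omega>) * iexp (s * X \<omega>)) / (2 * \<i>)"
      by (simp only: eq integral_divide_zero)
    also have "\<dots> = 0"
      by (subst Bochner_Integration.integral_diff; (rule int)?) (use char cnj bdd in \<open>auto simp del: of_real_mult\<close>)
    finally show "(CLINT \<omega>|M. Im (W \<omega>) * iexp (s * X \<omega>)) = 0" .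
  qed (use bdd abs_Im_le_cmod in \<open>auto intro: order.trans\<close>)
  have Re_ind: "Re (indicator A x) = indicator A x" and Im_ind: "Im (indicator A x) = 0" for x
    by (simp_all add: indicator_def)
  have "integrable M (\<lambda>\<omega>. W \<omega> * indicator A (X \<omega>))"
    by (rule int) (use bdd in \<open>auto simp: indicator_def\<close>)
  then have "Re (CLINT \<omega>|M. W \<omega> * indicator A (X \<omega>)) = 0" "Im (CLINT \<omega>|M. W \<omega> * indicator A (X \<omega>)) = 0"
    using re im by (simp_all add: integral_Re[symmetric] integral_Im[symmetric] Re_ind Im_ind)
  then show ?thesis by (simp add: complex_eq_iff)
qed

text \<open>
  Replacing exponentials by indicators one variable at a time reduces the joint law to
  Levy's one-dimensional uniqueness theorem.
\<close>

lemma (in prob_space) integral_prod_indicator_eq_of_char: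
  fixes W :: "'a \<Rightarrow> complex" and X :: "'i \<Rightarrow> 'a \<Rightarrow> real"
  assumes "finite K" "W \<in> borel_measurable M" "\<And>i. i \<in> K \<Longrightarrow> X i \<in> borel_measurable M"
    "\<And>i. i \<in> K \<Longrightarrow> A i \<in> sets borel"
    and "\<And>\<omega>. norm (W \<omega>) \<le> B"
    and "\<And>s. (CLINT \<omega>|M. W \<omega> * (\<Prod>i\<in>K. iexp (s i * X i \<omega>))) = 0"
  shows "(CLINT \<omega>|M. W \<omega> * (\<Prod>i\<in>K. indicator (A i) (X i \<omega>))) = 0"
  using assms
proof (induction K arbitrary: W B rule: finite_induct)
  case empty
  then show ?case by simp
next
  case (insert k K)
  note [measurable] = insert.prems(1)
  have Xk [measurable]: "X k \<in> borel_measurable M" and Ak [measurable]: "A k \<in> sets borel"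
    using insert.prems by auto
  have XK [measurable]: "i \<in> K \<Longrightarrow> X i \<in> borel_measurable M" and AK [measurable]: "i \<in> K \<Longrightarrow> A i \<in> sets borel" for i
    using insert.prems by auto
  have "(CLINT \<omega>|M. (W \<omega> * (\<Prod>i\<in>K. indicator (A i) (X i \<omega>))) * indicator (A k) (X k \<omega>)) = 0"
  proof (rule integral_indicator_eq_of_char[where B=B])
    show "cmod (W \<omega> * (\<Prod>i\<in>K. indicator (A i) (X i \<omega>))) \<le> B" for \<omega>
    proof -
      have "norm (\<Prod>i\<in>K. indicator (A i) (X i \<omega>) :: complex) \<le> 1"
        unfolding prod_norm[symmetric] by (rule prod_le_1) (auto simp: indicator_def)
      then have "norm (W \<omega>) * norm (\<Prod>i\<in>K. indicator (A i) (X i \<omega>) :: complex) \<le> B * 1"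
        using insert.prems(4)[of \<omega>] order.trans[OF norm_ge_zero insert.prems(4)] by (intro mult_mono) auto
      then show ?thesis by (simp add: norm_mult)
    qed
    fix s
    \<comment> \<open>The exponential in \<open>X k\<close> joins the weight without changing its
      bound \<open>B\<close>, so the induction hypothesis applies for each fixed
      \<open>s\<close>.\<close>
    have "(CLINT \<omega>|M. (W \<omega> * iexp (s * X k \<omega>)) * (\<Prod>i\<in>K. indicator (A i) (X i \<omega>))) = 0"
    proof (rule insert.IH)
      show "cmod (W \<omega> * iexp (s * X k \<omega>)) \<le> B" for \<omega>
        using insert.prems(4)[of \<omega>] by (simp add: norm_mult)
      fix t :: "'i \<Rightarrow> real"
      have "(\<Prod>i\<in>insert k K. iexp ((t(k := s)) i * X i \<omega>)) = iexp (s * X k \<omega>) * (\<Prod>i\<in>K. iexp (t i * X i \<omega>))" for \<omega>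
        using insert.hyps by (simp add: prod.insert) (rule prod.cong; auto)
      then show "(CLINT \<omega>|M. (W \<omega> * iexp (s * X k \<omega>)) * (\<Prod>i\<in>K. iexp (t i * X i \<omega>))) = 0"
        using insert.prems(5)[of "t(k := s)"] by (simp only: mult.assoc)
    qed auto
    then show "(CLINT \<omega>|M. (W \<omega> * (\<Prod>i\<in>K. indicator (A i) (X i \<omega>))) * iexp (s * X k \<omega>)) = 0"
      by (simp only: mult.assoc mult.commute[of "iexp _"])
  qed auto
  then show ?case using insert.hyps by (simp add: mult_ac)
qed

section \<open>Covariances and spaces of jointly Gaussian variables\<close>

definition covariance :: "'w measure \<Rightarrow> ('w \<Rightarrow> real) \<Rightarrow> ('w \<Rightarrow> real) \<Rightarrow> real" where
  "covariance M X Y = (\<integral>\<omega>. (X \<omega> - (\<integral>\<omega>'. X \<omega>' \<partial>M)) * (Y \<omega> - (\<integral>\<omega>'. Y \<omega>' \<partial>M)) \<partial>M)"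

lemma cov_matrix_nth: "cov_matrix M X Y $ i $ j = covariance M (\<lambda>\<omega>. X \<omega> $ i) (\<lambda>\<omega>. Y \<omega> $ j)"
  by (simp add: cov_matrix_def covariance_def)

lemma covariance_commute: "covariance M X Y = covariance M Y X"
  by (simp add: covariance_def mult.commute)

text \<open>Closure under linear combinations, together with Gaussian members, means that the
  members are jointly Gaussian; this is what lets zero covariance imply independence.\<close>

locale gaussian_space = prob_space M for M :: "'w measure" +
  fixes H :: "('w \<Rightarrow> real) set"
  assumes gaussian: "X \<in> H \<Longrightarrow> gaussian_rv M X"
    and add_mem: "X \<in> H \<Longrightarrow> Y \<in> H \<Longrightarrow> (\<lambda>\<omega>. X \<omega> + Y \<omega>) \<in> H"
    and scale_mem: "X \<in> H \<Longrightarrow> (\<lambda>\<omega>. c * X \<omega>) \<in> H"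
    and const_mem: "(\<lambda>_. c) \<in> H"
begin

lemma measurable_mem: "X \<in> H \<Longrightarrow> X \<in> borel_measurable M"
  using gaussian gaussian_rv_measurable by blast

lemma diff_mem: "X \<in> H \<Longrightarrow> Y \<in> H \<Longrightarrow> (\<lambda>\<omega>. X \<omega> - Y \<omega>) \<in> H"
  using add_mem[OF _ scale_mem[of Y "-1"], of X] by simp

lemma minus_mem: "X \<in> H \<Longrightarrow> (\<lambda>\<omega>. - X \<omega>) \<in> H"
  using scale_mem[of X "-1"] by simp

lemma sum_mem: "(\<And>i. i \<in> K \<Longrightarrow> X i \<in> H) \<Longrightarrow> (\<lambda>\<omega>. \<Sum>i\<in>K. X i \<omega>) \<in> H"
proof (induction K rule: infinite_finite_induct)
  case (insert i K)
  then show ?case using add_mem[of "X i" "\<lambda>\<omega>. \<Sum>i\<in>K. X i \<omega>"] by simp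
qed (auto simp: const_mem)

lemmas H_intros = add_mem scale_mem const_mem diff_mem minus_mem sum_mem

lemma integrable_mem: "X \<in> H \<Longrightarrow> integrable M X"
  using gaussian gaussian_rv_integrable by blast

lemma integrable_square_mem: "X \<in> H \<Longrightarrow> integrable M (\<lambda>\<omega>. (X \<omega>)\<^sup>2)"
  using gaussian gaussian_rv_integrable_square by blast

lemma integrable_mult_mem:
  assumes "X \<in> H" "Y \<in> H"
  shows "integrable M (\<lambda>\<omega>. X \<omega> * Y \<omega>)"
proof (rule Bochner_Integration.integrable_bound)
  show "integrable M (\<lambda>\<omega>. (X \<omega>)\<^sup>2 + (Y \<omega>)\<^sup>2)"
    using assms integrable_square_mem by auto
  show "(\<lambda>\<omega>. X \<omega> * Y \<omega>) \<in> borel_measurable M"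
    using assms[THEN measurable_mem] by measurable
  have "\<bar>x * y\<bar> \<le> x\<^sup>2 + y\<^sup>2" for x y :: real
  proof -
    have "2 * \<bar>x * y\<bar> \<le> x\<^sup>2 + y\<^sup>2"
      using zero_le_power2[of "\<bar>x\<bar> - \<bar>y\<bar>"] by (simp add: power2_diff abs_mult)
    then show ?thesis by (smt (verit) abs_ge_zero)
  qed
  then show "AE \<omega> in M. norm (X \<omega> * Y \<omega>) \<le> norm ((X \<omega>)\<^sup>2 + (Y \<omega>)\<^sup>2)"
    by (intro AE_I2) (simp add: abs_of_nonneg)
qed

lemma covariance_eq:
  assumes "X \<in> H" "Y \<in> H"
  shows "covariance M X Y = expectation (\<lambda>\<omega>. X \<omega> * Y \<omega>) - expectation X * expectation Y"
proof -
  have "covariance M X Y = expectation (\<lambda>\<omega>. X \<omega> * Y \<omega> - expectation Y * X \<omega> - expectation X * Y \<omega> + expectation X * expectation Y)"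
    unfolding covariance_def by (rule Bochner_Integration.integral_cong) (auto simp: algebra_simps)
  also have "\<dots> = expectation (\<lambda>\<omega>. X \<omega> * Y \<omega>) - expectation X * expectation Y"
    using assms by (simp add: integrable_mult_mem integrable_mem prob_space)
  finally show ?thesis .
qed

lemma covariance_add:
  assumes "X \<in> H" "X' \<in> H" "Y \<in> H"
  shows "covariance M (\<lambda>\<omega>. X \<omega> + X' \<omega>) Y = covariance M X Y + covariance M X' Y"
  using assms by (simp add: covariance_eq add_mem distrib_right integrable_mult_mem integrable_mem)

lemma covariance_scale:
  assumes "X \<in> H" "Y \<in> H"
  shows "covariance M (\<lambda>\<omega>. c * X \<omega>) Y = c * covariance M X Y"
  using assms by (simp add: covariance_eq scale_mem mult.assoc right_diff_distrib)

lemma covariance_const: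
  assumes "Y \<in> H"
  shows "covariance M (\<lambda>\<omega>. c) Y = 0"
  using assms by (simp add: covariance_eq const_mem prob_space)

lemma covariance_minus:
  assumes "X \<in> H" "Y \<in> H"
  shows "covariance M (\<lambda>\<omega>. - X \<omega>) Y = - covariance M X Y"
  using covariance_scale[OF assms, of "-1"] by simp

lemma covariance_diff:
  assumes "X \<in> H" "X' \<in> H" "Y \<in> H"
  shows "covariance M (\<lambda>\<omega>. X \<omega> - X' \<omega>) Y = covariance M X Y - covariance M X' Y"
  using covariance_add[OF assms(1) minus_mem[OF assms(2)] assms(3)] covariance_minus[OF assms(2,3)] by simp

lemma covariance_sum:
  assumes "\<And>i. i \<in> K \<Longrightarrow> X i \<in> H" "Y \<in> H"
  shows "covariance M (\<lambda>\<omega>. \<Sum>i\<in>K. X i \<omega>) Y = (\<Sum>i\<in>K. covariance M (X i) Y)"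
  using assms
proof (induction K rule: infinite_finite_induct)
  case (insert i K)
  then show ?case using covariance_add[of "X i" "\<lambda>\<omega>. \<Sum>i\<in>K. X i \<omega>" Y] sum_mem[of K X] by simp
qed (auto simp: covariance_const)

lemma variance_eq_covariance: "variance X = covariance M X X"
  by (simp add: covariance_def power2_eq_square)

lemma covariance_nonneg: "0 \<le> covariance M X X"
  by (simp add: variance_eq_covariance[symmetric])

text \<open>Cauchy-Schwarz in additive form, from the variances of \<open>X + e * Y\<close> and
  \<open>X - e * Y\<close>. The free weight \<open>e\<close> makes one term small at the expense of
  the other, without square roots.\<close>

lemma covariance_le: 
  assumes "X \<in> H" "Y \<in> H" "0 < e"
  shows "2 * \<bar>covariance M X Y\<bar> \<le> covariance M X X / e + e * covariance M Y Y"
proof -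
  have "0 \<le> covariance M X X + 2 * c * covariance M X Y + c\<^sup>2 * covariance M Y Y" for c
  proof -
    let ?W = "\<lambda>\<omega>. X \<omega> + c * Y \<omega>"
    have "0 \<le> covariance M ?W ?W" by (rule covariance_nonneg)
    also have "\<dots> = covariance M X ?W + c * covariance M Y ?W"
      using assms by (simp add: covariance_add covariance_scale H_intros)
    also have "\<dots> = covariance M X X + 2 * c * covariance M X Y + c\<^sup>2 * covariance M Y Y"
      using assms by (simp add: covariance_commute[of M _ ?W] covariance_add covariance_scale H_intros
        covariance_commute[of M Y X] power2_eq_square algebra_simps)
    finally show ?thesis .
  qed
  from this[of e] this[of "-e"]
  have "2 * e * \<bar>covariance M X Y\<bar> \<le> covariance M X X + e\<^sup>2 * covariance M Y Y"
    using \<open>0 < e\<close> by (auto simp: abs_if)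
  then have "(2 * e * \<bar>covariance M X Y\<bar>) / e \<le> (covariance M X X + e\<^sup>2 * covariance M Y Y) / e"
    using \<open>0 < e\<close> by (intro divide_right_mono) auto
  then show ?thesis using \<open>0 < e\<close> by (simp add: add_divide_distrib power2_eq_square)
qed

lemma covariance_self_le: "X \<in> H \<Longrightarrow> covariance M X X \<le> expectation (\<lambda>\<omega>. (X \<omega>)\<^sup>2)"
  using gaussian_rv_mean_square_le(2)[OF gaussian, of X] by (simp add: variance_eq_covariance)

text \<open>An almost sure limit of Gaussian variables is a mean-square limit, and covariance with a
  fixed variable is continuous in mean square. No dominating variable is asked for.\<close>

lemma covariance_tendsto_0:
  assumes X: "\<And>n. X n \<in> H" and Y: "Y \<in> H"
    and lim: "AE \<omega> in M. (\<lambda>n. X n \<omega>) \<longlonglongrightarrow> 0"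
  shows "(\<lambda>n. covariance M (X n) Y) \<longlonglongrightarrow> 0"
proof (rule LIMSEQ_I)
  fix r :: real assume "0 < r"
  define v where "v = covariance M Y Y"
  have "0 \<le> v" by (simp add: v_def covariance_nonneg)
  \<comment> \<open>The two terms of \<open>covariance_le\<close> are to be at most \<open>r\<close>
    each, because the left side carries the factor 2; \<open>v + 1\<close> avoids a division by
    zero.\<close>
  define e where "e = r / (v + 1)"
  have e: "0 < e" "e * v \<le> r" using \<open>0 < r\<close> \<open>0 \<le> v\<close> by (auto simp: e_def field_simps)
  have "(\<lambda>n. expectation (\<lambda>\<omega>. (X n \<omega>)\<^sup>2)) \<longlonglongrightarrow> 0"
    by (rule gaussian_seq_null) (use X gaussian lim in auto)
  then have "eventually (\<lambda>n. expectation (\<lambda>\<omega>. (X n \<omega>)\<^sup>2) < r * e) sequentially"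
    using \<open>0 < r\<close> e by (intro order_tendstoD(2)) auto
  then obtain N where N: "\<And>n. n \<ge> N \<Longrightarrow> expectation (\<lambda>\<omega>. (X n \<omega>)\<^sup>2) < r * e"
    by (auto simp: eventually_sequentially)
  have "norm (covariance M (X n) Y - 0) < r" if "n \<ge> N" for n
  proof -
    have "covariance M (X n) (X n) / e < r"
      using covariance_self_le[OF X, of n] N[OF that] e by (simp add: field_simps)
    then show ?thesis
      using covariance_le[OF X[of n] Y e(1)] e(2) by (simp add: v_def)
  qed
  then show "\<exists>N. \<forall>n\<ge>N. norm (covariance M (X n) Y - 0) < r" by blast
qed

text \<open>\<open>X + Y\<close> is again Gaussian because \<open>H\<close> is closed under sums.
  Its mean and, by the vanishing covariance, its variance are additive, so its characteristic
  function factorises.\<close>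

lemma char_add_uncorrelated:
  assumes "X \<in> H" "Y \<in> H" "covariance M X Y = 0"
  shows "(CLINT \<omega>|M. iexp (X \<omega>) * iexp (Y \<omega>)) = (CLINT \<omega>|M. iexp (X \<omega>)) * (CLINT \<omega>|M. iexp (Y \<omega>))"
proof -
  let ?W = "\<lambda>\<omega>. X \<omega> + Y \<omega>"
  have W: "?W \<in> H" using assms by (intro H_intros)
  have v: "covariance M ?W ?W = covariance M X X + covariance M Y Y"
  proof -
    have "covariance M ?W ?W = covariance M X ?W + covariance M Y ?W"
      using assms by (simp add: covariance_add H_intros)
    also have "\<dots> = covariance M X X + covariance M Y Y"
      using assms by (simp add: covariance_commute[of M _ ?W] covariance_add H_intros
        covariance_commute[of M Y X])
    finally show ?thesis .
  qed
  have e: "expectation ?W = expectation X + expectation Y"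
    using assms by (simp add: integrable_mem)
  have "(CLINT \<omega>|M. iexp (X \<omega>) * iexp (Y \<omega>)) = (CLINT \<omega>|M. iexp (1 * ?W \<omega>))"
    by (simp add: exp_add[symmetric] distrib_left)
  also have "\<dots> = iexp (1 * expectation ?W) * exp (- (1\<^sup>2 * covariance M ?W ?W) / 2)"
    unfolding gaussian_rv_char[OF gaussian[OF W]] variance_eq_covariance ..
  also have "\<dots> = (iexp (1 * expectation X) * exp (- (1\<^sup>2 * covariance M X X) / 2)) * (iexp (1 * expectation Y) * exp (- (1\<^sup>2 * covariance M Y Y) / 2))"
    unfolding v e
    by (simp add: exp_add[symmetric] distrib_left add_divide_distrib exp_of_real[symmetric] del: exp_of_real)
       (simp add: algebra_simps diff_divide_distrib)
  also have "\<dots> = (CLINT \<omega>|M. iexp (1 * X \<omega>)) * (CLINT \<omega>|M. iexp (1 * Y \<omega>))"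
    unfolding gaussian_rv_char[OF gaussian[OF assms(1)]] gaussian_rv_char[OF gaussian[OF assms(2)]] variance_eq_covariance ..
  finally show ?thesis by simp
qed

text \<open>With one factor centred, independence becomes the vanishing of an integral, the form
  treated by \<open>integral_prod_indicator_eq_of_char\<close>. The product formula holds for
  exponentials on both sides; indicators are substituted on the \<open>X\<close> side first, and
  then on the \<open>Y\<close> side.\<close>

lemma prob_inter_uncorrelated:
  fixes X :: "'i \<Rightarrow> 'w \<Rightarrow> real" and Y :: "'j \<Rightarrow> 'w \<Rightarrow> real"
  assumes fin: "finite K" "finite L"
    and X: "\<And>i. i \<in> K \<Longrightarrow> X i \<in> H" and Y: "\<And>j. j \<in> L \<Longrightarrow> Y j \<in> H"
    and cov: "\<And>i j. i \<in> K \<Longrightarrow> j \<in> L \<Longrightarrow> covariance M (X i) (Y j) = 0"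
    and A: "\<And>i. i \<in> K \<Longrightarrow> A i \<in> sets borel" and B: "\<And>j. j \<in> L \<Longrightarrow> B j \<in> sets borel"
  shows "prob {\<omega>\<in>space M. (\<forall>i\<in>K. X i \<omega> \<in> A i) \<and> (\<forall>j\<in>L. Y j \<omega> \<in> B j)} =
    prob {\<omega>\<in>space M. \<forall>i\<in>K. X i \<omega> \<in> A i} * prob {\<omega>\<in>space M. \<forall>j\<in>L. Y j \<omega> \<in> B j}"
proof -
  note mX [measurable] = X[THEN measurable_mem] and mY [measurable] = Y[THEN measurable_mem]
  note [measurable] = A B
  let ?eX = "\<lambda>s \<omega>. \<Prod>i\<in>K. iexp (s i * X i \<omega>)"
  let ?eY = "\<lambda>s \<omega>. \<Prod>j\<in>L. iexp (s j * Y j \<omega>)"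
  let ?iX = "\<lambda>\<omega>. (\<Prod>i\<in>K. indicator (A i) (X i \<omega>)) :: complex"
  let ?iY = "\<lambda>\<omega>. (\<Prod>j\<in>L. indicator (B j) (Y j \<omega>)) :: complex"
  have bX: "cmod (?eX s \<omega>) \<le> 1" and bY: "cmod (?eY t \<omega>) \<le> 1"
    and biX: "cmod (?iX \<omega>) \<le> 1" and biY: "cmod (?iY \<omega>) \<le> 1" for s t \<omega>
    unfolding prod_norm[symmetric] by (rule prod_le_1; simp add: indicator_def)+
  note int = integrable_mult_bounded[where B = 1]
  have int1: "integrable M f"
    if "f \<in> borel_measurable M" "\<And>\<omega>. norm (f \<omega>) \<le> 1" for f :: "'w \<Rightarrow> complex"
    using int[of f "\<lambda>_. 1"] that by simp
  have cm: "cmod (CLINT \<omega>|M. f \<omega>) \<le> 1" if "\<And>\<omega>. norm (f \<omega>) \<le> 1" for f :: "'w \<Rightarrow> complex"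
  proof -
    have "cmod (CLINT \<omega>|M. f \<omega>) \<le> (\<integral>\<omega>. norm (f \<omega>) \<partial>M)" by (rule integral_norm_bound)
    also have "\<dots> \<le> 1"
    proof (cases "integrable M (\<lambda>\<omega>. norm (f \<omega>))")
      case True
      have "(\<integral>\<omega>. norm (f \<omega>) \<partial>M) \<le> (\<integral>\<omega>. 1 \<partial>M)"
        by (rule integral_mono) (use True that in auto)
      then show ?thesis by (simp add: prob_space)
    qed (simp add: not_integrable_integral_eq)
    finally show ?thesis .
  qed
  have step: "(CLINT \<omega>|M. (f \<omega> - (CLINT \<omega>|M. f \<omega>)) * g \<omega>) =
      (CLINT \<omega>|M. f \<omega> * g \<omega>) - (CLINT \<omega>|M. f \<omega>) * (CLINT \<omega>|M. g \<omega>)"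
    if "f \<in> borel_measurable M" "g \<in> borel_measurable M" "\<And>\<omega>. norm (f \<omega>) \<le> 1" "\<And>\<omega>. norm (g \<omega>) \<le> 1"
    for f g :: "'w \<Rightarrow> complex"
    using int[OF that] int1[OF that(2,4)] by (simp add: left_diff_distrib)
  have c2: "cmod (f \<omega> - (CLINT \<omega>|M. f \<omega>)) \<le> 2" if "\<And>\<omega>. norm (f \<omega>) \<le> 1" for f \<omega>
    using norm_triangle_ineq4[of "f \<omega>" "CLINT \<omega>|M. f \<omega>"] that[of \<omega>] cm[of f, OF that] by simp
  have e: "(CLINT \<omega>|M. ?eY t \<omega> * ?eX s \<omega>) = (CLINT \<omega>|M. ?eY t \<omega>) * (CLINT \<omega>|M. ?eX s \<omega>)" for s t
  proof -
    let ?U = "\<lambda>\<omega>. \<Sum>i\<in>K. s i * X i \<omega>" and ?V = "\<lambda>\<omega>. \<Sum>j\<in>L. t j * Y j \<omega>"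
    have U: "?U \<in> H" and V: "?V \<in> H" using X Y by (auto intro!: H_intros)
    have "covariance M ?V ?U = (\<Sum>j\<in>L. t j * covariance M (Y j) ?U)"
      using Y U by (subst covariance_sum) (auto simp: covariance_scale intro!: H_intros)
    also have "\<dots> = 0"
    proof (intro sum.neutral ballI)
      fix j assume "j \<in> L"
      have "covariance M (Y j) ?U = (\<Sum>i\<in>K. s i * covariance M (X i) (Y j))"
        using X Y \<open>j \<in> L\<close> by (subst covariance_commute, subst covariance_sum) (auto simp: covariance_scale intro!: H_intros)
      also have "\<dots> = 0" using cov \<open>j \<in> L\<close> by simp
      finally show "t j * covariance M (Y j) ?U = 0" by simp
    qed
    finally have "covariance M ?V ?U = 0" .
    from char_add_uncorrelated[OF V U this]
    show ?thesis using fin by (simp add: exp_sum[symmetric] sum_distrib_left)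
  qed
  have e2: "(CLINT \<omega>|M. ?eY t \<omega> * ?iX \<omega>) = (CLINT \<omega>|M. ?eY t \<omega>) * (CLINT \<omega>|M. ?iX \<omega>)" for t
  proof -
    have "(CLINT \<omega>|M. (?eY t \<omega> - (CLINT \<omega>|M. ?eY t \<omega>)) * ?iX \<omega>) = 0"
      by (rule integral_prod_indicator_eq_of_char[where B=2])
         (use fin mX A e bX bY in \<open>auto simp: step intro!: c2\<close>)
    then show ?thesis using bY biX by (subst (asm) step) auto
  qed
  have e3: "(CLINT \<omega>|M. ?iX \<omega> * ?iY \<omega>) = (CLINT \<omega>|M. ?iX \<omega>) * (CLINT \<omega>|M. ?iY \<omega>)"
  proof -
    have "(CLINT \<omega>|M. (?iX \<omega> - (CLINT \<omega>|M. ?iX \<omega>)) * ?iY \<omega>) = 0"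
    proof (rule integral_prod_indicator_eq_of_char[where B=2])
      show "(CLINT \<omega>|M. (?iX \<omega> - (CLINT \<omega>|M. ?iX \<omega>)) * ?eY t \<omega>) = 0" for t
        using e2[of t] biX bY by (subst step) (auto simp: mult.commute)
    qed (use fin mY B biX in \<open>auto intro!: c2\<close>)
    then show ?thesis using biX biY by (subst (asm) step) auto
  qed
  have iX: "?iX \<omega> = complex_of_real (indicator {\<omega>\<in>space M. \<forall>i\<in>K. X i \<omega> \<in> A i} \<omega>)" if "\<omega> \<in> space M" for \<omega>
    using fin that by (auto simp: indicator_def prod.If_cases intro!: prod_zero) 
  have iY: "?iY \<omega> = complex_of_real (indicator {\<omega>\<in>space M. \<forall>j\<in>L. Y j \<omega> \<in> B j} \<omega>)" if "\<omega> \<in> space M" for \<omega>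
    using fin that by (auto simp: indicator_def prod.If_cases intro!: prod_zero)
  have iXY: "?iX \<omega> * ?iY \<omega> = complex_of_real (indicator {\<omega>\<in>space M. (\<forall>i\<in>K. X i \<omega> \<in> A i) \<and> (\<forall>j\<in>L. Y j \<omega> \<in> B j)} \<omega>)" if "\<omega> \<in> space M" for \<omega>
    unfolding iX[OF that] iY[OF that] using that by (auto simp: indicator_def)
  have int_ind: "(CLINT \<omega>|M. complex_of_real (indicator S \<omega>)) = complex_of_real (prob S)" if "S \<in> events" for S
    using that by (simp only: integral_complex_of_real) simp
  have "complex_of_real (prob {\<omega>\<in>space M. (\<forall>i\<in>K. X i \<omega> \<in> A i) \<and> (\<forall>j\<in>L. Y j \<omega> \<in> B j)})
    = (CLINT \<omega>|M. ?iX \<omega> * ?iY \<omega>)"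
    using fin by (subst Bochner_Integration.integral_cong[OF refl iXY]) (auto simp: int_ind simp del: integral_complex_of_real)
  also have "\<dots> = (CLINT \<omega>|M. ?iX \<omega>) * (CLINT \<omega>|M. ?iY \<omega>)" by (rule e3)
  also have "(CLINT \<omega>|M. ?iX \<omega>) = complex_of_real (prob {\<omega>\<in>space M. \<forall>i\<in>K. X i \<omega> \<in> A i})"
    using fin by (subst Bochner_Integration.integral_cong[OF refl iX]) (auto simp: int_ind simp del: integral_complex_of_real)
  also have "(CLINT \<omega>|M. ?iY \<omega>) = complex_of_real (prob {\<omega>\<in>space M. \<forall>j\<in>L. Y j \<omega> \<in> B j})"
    using fin by (subst Bochner_Integration.integral_cong[OF refl iY]) (auto simp: int_ind simp del: integral_complex_of_real)
  finally show ?thesis unfolding of_real_mult[symmetric] of_real_eq_iff .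
qed

end

section \<open>The area formula\<close>

text \<open>
  The change of variables theorem and Sard's lemma of HOL-Analysis require a well-ordered index
  type; \<open>'a widx\<close> is a copy of the finite type \<open>'a\<close> with an arbitrary well-order.
\<close>

typedef 'a widx = "UNIV :: 'a set" ..

definition enc_finite :: "'a::finite \<Rightarrow> nat" where
  "enc_finite = (SOME f. inj f)"

lemma inj_enc_finite: "inj (enc_finite :: 'a::finite \<Rightarrow> nat)"
proof -
  have "\<exists>f :: 'a \<Rightarrow> nat. inj f"
    using finite_imp_inj_to_nat_seg[of "UNIV :: 'a set"] by (metis finite_class.finite_UNIV)
  then show ?thesis unfolding enc_finite_def by (rule someI_ex)
qed

instance widx :: (finite) finite
proof
  have "finite (Abs_widx ` (UNIV :: 'a set))"
    by (rule finite_imageI, rule finite_class.finite_UNIV)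
  then show "finite (UNIV :: 'a widx set)"
    by (subst type_definition.univ[OF type_definition_widx])
qed

instantiation widx :: (finite) wellorder
begin

definition less_eq_widx :: "'a widx \<Rightarrow> 'a widx \<Rightarrow> bool" where
  "less_eq_widx i j \<longleftrightarrow> enc_finite (Rep_widx i) \<le> enc_finite (Rep_widx j)"

definition less_widx :: "'a widx \<Rightarrow> 'a widx \<Rightarrow> bool" where
  "less_widx i j \<longleftrightarrow> enc_finite (Rep_widx i) < enc_finite (Rep_widx j)"

instance
proof
  fix x y z :: "'a widx"
  show "x < y \<longleftrightarrow> x \<le> y \<and> \<not> y \<le> x"
    unfolding less_eq_widx_def less_widx_def by linarith
  show "x \<le> x"
    unfolding less_eq_widx_def by (rule order_refl)
  show "x \<le> z" if "x \<le> y" "y \<le> z"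
    using that unfolding less_eq_widx_def by (rule order_trans)
  show "x = y" if "x \<le> y" "y \<le> x"
  proof -
    have "enc_finite (Rep_widx x) = enc_finite (Rep_widx y)"
      using that unfolding less_eq_widx_def by (rule antisym)
    then have "Rep_widx x = Rep_widx y" by (rule injD[OF inj_enc_finite])
    then show ?thesis by (simp only: Rep_widx_inject)
  qed
  show "x \<le> y \<or> y \<le> x"
    unfolding less_eq_widx_def by (rule linear)
next
  fix P :: "'a widx \<Rightarrow> bool" and a
  assume step: "\<And>x. (\<And>y. y < x \<Longrightarrow> P y) \<Longrightarrow> P x"
  have "\<forall>a. enc_finite (Rep_widx a) = n \<longrightarrow> P a" for n
  proof (induction n rule: less_induct)
    case (less n)
    show ?case
    proof (intro allI impI)
      fix a :: "'a widx"
      assume a: "enc_finite (Rep_widx a) = n"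
      show "P a"
      proof (rule step)
        fix y assume "y < a"
        then have "enc_finite (Rep_widx y) < n" using a by (simp only: less_widx_def)
        then show "P y" using less by blast
      qed
    qed
  qed
  then show "P a" by blast
qed

end

section \<open>Transport of volume and determinants to the well-ordered index type\<close>

definition reidx :: "real ^ 'd \<Rightarrow> real ^ ('d::finite) widx" where
  "reidx x = (\<chi> i. x $ Rep_widx i)"

definition unidx :: "real ^ ('d::finite) widx \<Rightarrow> real ^ 'd" where
  "unidx x = (\<chi> i. x $ Abs_widx i)"

lemma unidx_reidx [simp]: "unidx (reidx x) = x" and reidx_unidx [simp]: "reidx (unidx y) = y"
  by (simp_all add: reidx_def unidx_def vec_eq_iff Abs_widx_inverse Rep_widx_inverse)

lemma linear_reidx: "linear reidx" and linear_unidx: "linear unidx"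
  by (auto intro!: linearI simp: reidx_def unidx_def vec_eq_iff)

lemma bounded_linear_reidx: "bounded_linear reidx" and bounded_linear_unidx: "bounded_linear unidx"
  using linear_reidx linear_unidx by (auto simp: linear_conv_bounded_linear)

lemma measurable_reidx [measurable]: "reidx \<in> borel_measurable borel"
  and measurable_unidx [measurable]: "unidx \<in> borel_measurable borel"
  by (rule borel_measurable_continuous_onI[OF linear_continuous_on[OF bounded_linear_reidx]],
      rule borel_measurable_continuous_onI[OF linear_continuous_on[OF bounded_linear_unidx]])

lemma inj_reidx: "inj reidx" and inj_unidx: "inj unidx"
  by (rule inj_on_inverseI[of _ unidx], simp, rule inj_on_inverseI[of _ reidx], simp)

lemma Basis_cart: "(Basis :: (real ^ 'n) set) = range (\<lambda>i. axis i 1)"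
  by (auto simp: Basis_vec_def)

lemma prod_Basis_cart: "(\<Prod>b\<in>(Basis :: (real ^ 'n) set). f b) = (\<Prod>i\<in>UNIV. f (axis i 1))"
  unfolding Basis_cart by (subst prod.reindex) (auto simp: inj_on_def axis_eq_axis)

text \<open>Boxes determine the measure, and renaming coordinates turns a box into one with the same
  side lengths.\<close>

lemma distr_reidx: "distr lborel borel (reidx :: real ^ 'd \<Rightarrow> real ^ 'd widx) = lborel"
proof (rule lborel_eqI[symmetric])
  fix l u :: "real ^ 'd widx"
  assume le: "\<And>b. b \<in> Basis \<Longrightarrow> l \<bullet> b \<le> u \<bullet> b"
  have le': "l $ i \<le> u $ i" for i using le[of "axis i 1"] by (simp add: inner_axis axis_in_Basis_iff)
  have "reidx -` box l u = box (unidx l) (unidx u)"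
  proof -
    have "(\<forall>i. l $ i < x $ Rep_widx i \<and> x $ Rep_widx i < u $ i) \<longleftrightarrow>
      (\<forall>j. l $ Abs_widx j < x $ j \<and> x $ j < u $ Abs_widx j)" for x
      by (metis Abs_widx_inverse UNIV_I Rep_widx_inverse)
    then show ?thesis by (simp add: vimage_def set_eq_iff mem_box_cart reidx_def unidx_def)
  qed
  then have "emeasure (distr lborel borel reidx) (box l u) = emeasure lborel (box (unidx l) (unidx u))"
    by (subst emeasure_distr) auto
  also have "\<dots> = (\<Prod>b\<in>Basis. (unidx u - unidx l) \<bullet> b)"
  proof (rule emeasure_lborel_box)
    fix b :: "real^'d" assume "b \<in> Basis"
    then show "unidx l \<bullet> b \<le> unidx u \<bullet> b"
      using le' by (auto simp: Basis_vec_def inner_axis unidx_def)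
  qed
  also have "(\<Prod>b\<in>Basis. (unidx u - unidx l) \<bullet> b) = (\<Prod>i\<in>UNIV. (unidx u - unidx l) $ i)"
    by (simp add: prod_Basis_cart inner_axis)
  also have "\<dots> = (\<Prod>i\<in>UNIV. (u - l) $ i)"
    by (rule prod.reindex_bij_witness[of _ Rep_widx Abs_widx]) (auto simp: unidx_def Abs_widx_inverse Rep_widx_inverse)
  also have "\<dots> = (\<Prod>b\<in>Basis. (u - l) \<bullet> b)"
    by (simp add: prod_Basis_cart inner_axis)
  finally show "emeasure (distr lborel borel reidx) (box l u) = (\<Prod>b\<in>Basis. (u - l) \<bullet> b)" .
qed simp

text \<open>Conjugation with \<open>r\<close> is a sign-preserving bijection between the
  permutations, hence between the terms of the two Leibniz sums.\<close>

lemma det_reindex: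
  fixes A :: "'a::comm_ring_1 ^ 'n ^ 'n" and r :: "'m::finite \<Rightarrow> 'n::finite"
  assumes "bij r"
  shows "det (\<chi> i j. A $ r i $ r j) = det A"
proof -
  let ?m = "map_permutation (UNIV :: 'm set) r"
  let ?g = "map_permutation (UNIV :: 'n set) (inv r)"
  have r: "bij_betw r UNIV UNIV" and ir: "bij_betw (inv r) UNIV UNIV"
    using assms by (auto simp: bij_imp_bij_inv)
  have inj: "inj r" using assms by (rule bij_is_inj)
  show ?thesis
    unfolding det_def
  proof (rule sum.reindex_bij_witness[of _ ?g ?m])
    fix p :: "'m \<Rightarrow> 'm" assume "p \<in> {p. p permutes UNIV}"
    then have p: "p permutes UNIV" by simp
    show "?g (?m p) = p" by (rule map_permutation_compose_inv[OF r p]) (use inj in auto)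
    show "?m p \<in> {p. p permutes UNIV}" using map_permutation_permutes[OF r p] by simp
    have "(\<Prod>i\<in>UNIV. A $ i $ ?m p i) = (\<Prod>i\<in>UNIV. A $ r i $ r (p i))"
      using prod.reindex_bij_betw[OF r, of "\<lambda>i. A $ i $ ?m p i"] map_permutation_apply[OF inj, of _ p]
      by simp
    then show "of_int (sign (?m p)) * (\<Prod>i\<in>UNIV. A $ i $ ?m p i) =
        of_int (sign p) * (\<Prod>i\<in>UNIV. (\<chi> i j. A $ r i $ r j) $ i $ p i)"
      using sign_map_permutation[OF inj p] by simp
  next
    fix q :: "'n \<Rightarrow> 'n" assume "q \<in> {p. p permutes UNIV}"
    then have q: "q permutes UNIV" by simp
    show "?m (?g q) = q" by (rule map_permutation_compose_inv[OF ir q]) (use assms in \<open>auto simp: bij_is_surj surj_f_inv_f\<close>)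
    show "?g q \<in> {p. p permutes UNIV}" using map_permutation_permutes[OF ir q] by simp
  qed
qed

section \<open>F-sigma sets\<close>

lemma closed_imp_fsigma: "closed S \<Longrightarrow> fsigma S"
  using fsigma.intros[of "\<lambda>_. S"] by simp

lemma fsigma_UN:
  assumes "\<And>n::nat. fsigma (S n)"
  shows "fsigma (\<Union>n. S n)"
proof -
  have "\<exists>F. (\<forall>k::nat. closed (F k)) \<and> S n = (\<Union>k. F k)" for n
    using assms[of n] by (auto elim!: fsigma.cases)
  then obtain F where F: "\<And>n k::nat. closed (F n k)" "\<And>n. S n = (\<Union>k. F n k)" by metis
  have "(\<Union>n. S n) = (\<Union>m. F (fst (prod_decode m)) (snd (prod_decode m)))"
  proof (intro equalityI subsetI)
    fix x assume "x \<in> (\<Union>n. S n)"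
    then obtain n k where "x \<in> F n k" using F(2) by blast
    then have "x \<in> F (fst (prod_decode (prod_encode (n, k)))) (snd (prod_decode (prod_encode (n, k))))"
      by simp
    then show "x \<in> (\<Union>m. F (fst (prod_decode m)) (snd (prod_decode m)))" by blast
  next
    fix x assume "x \<in> (\<Union>m. F (fst (prod_decode m)) (snd (prod_decode m)))"
    then show "x \<in> (\<Union>n. S n)" using F(2) by blast
  qed
  then show ?thesis using fsigma.intros[of "\<lambda>m. F (fst (prod_decode m)) (snd (prod_decode m))"] F(1) by simp
qed

lemma fsigma_Int:
  assumes "fsigma S" "fsigma T"
  shows "fsigma (S \<inter> T)"
proof -
  obtain F where F: "\<And>n::nat. closed (F n)" "S = (\<Union>n. F n)" using assms(1) by (auto elim!: fsigma.cases)
  obtain G where G: "\<And>n::nat. closed (G n)" "T = (\<Union>n. G n)" using assms(2) by (auto elim!: fsigma.cases)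
  have "S \<inter> T = (\<Union>n. \<Union>k. F n \<inter> G k)" unfolding F(2) G(2) by blast
  moreover have "fsigma (\<Union>n. \<Union>k. F n \<inter> G k)"
    by (rule fsigma_UN, rule fsigma_UN, rule closed_imp_fsigma, rule closed_Int[OF F(1) G(1)])
  ultimately show ?thesis by simp
qed

lemma open_imp_fsigma:
  fixes S :: "'a::euclidean_space set"
  assumes "open S"
  shows "fsigma S"
proof (cases "S = {}")
  case False
  obtain D where D: "countable D" "D \<subseteq> Pow S" "\<And>X. X \<in> D \<Longrightarrow> \<exists>a b. X = cbox a b" "\<Union>D = S"
    by (rule open_countable_Union_open_cbox[OF assms]) (rule that)
  then have "D \<noteq> {}" using False by auto
  then have "S = (\<Union>n. from_nat_into D n)" using D(1,4) by (simp add: range_from_nat_into)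
  moreover have "closed (from_nat_into D n)" for n
  proof -
    obtain a b where "from_nat_into D n = cbox a b"
      using D(3)[OF from_nat_into[OF \<open>D \<noteq> {}\<close>, of n]] by blast
    then show ?thesis by (simp add: closed_cbox)
  qed
  then have "fsigma (\<Union>n. from_nat_into D n)" by (rule fsigma.intros)
  ultimately show ?thesis by simp
qed (simp add: closed_imp_fsigma)

lemma fsigma_imp_borel: "fsigma S \<Longrightarrow> S \<in> sets borel"
  by (erule fsigma.cases) (simp add: borel_closed sets.countable_UN)

lemma fsigma_compacts:
  fixes S :: "'a::euclidean_space set"
  assumes "fsigma S"
  obtains K where "\<And>n::nat. compact (K n)" "S = (\<Union>n. K n)"
proof -
  from assms obtain F :: "nat \<Rightarrow> 'a set" where "range F \<subseteq> Collect compact" "S = \<Union>(F ` UNIV)"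
    unfolding fsigma_Union_compact by blast
  then show thesis by (intro that[of F]) auto
qed

text \<open>The reason for working with F-sigma sets: they are countable unions of compact sets, so
  their continuous images are Borel. Continuous images of arbitrary Borel sets need not be.\<close>

lemma fsigma_continuous_image:
  fixes f :: "'a::euclidean_space \<Rightarrow> 'b::euclidean_space"
  assumes "fsigma S" "continuous_on S f"
  shows "fsigma (f ` S)"
proof -
  obtain K where K: "\<And>n::nat. compact (K n)" "S = (\<Union>n. K n)" by (rule fsigma_compacts[OF assms(1)]) (rule that)
  have "compact (f ` K n)" for n
    using K assms(2) by (intro compact_continuous_image continuous_on_subset[OF assms(2)]) auto
  then show ?thesis
    unfolding K(2) image_UN by (intro fsigma_UN closed_imp_fsigma compact_imp_closed)
qed

lemma nn_integral_change_of_variables_wellorder: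
  fixes f :: "real ^ 'n::{finite,wellorder} \<Rightarrow> real ^ 'n::_" and p :: "real ^ 'n::_ \<Rightarrow> real"
  assumes S: "fsigma S"
    and f: "\<And>t. t \<in> S \<Longrightarrow> (f has_derivative (\<lambda>h. J t *v h)) (at t within S)"
    and J: "continuous_on S J"
    and inj: "inj_on f S"
    and p: "integrable lborel p" "continuous_on UNIV p" "\<And>x. 0 \<le> p x"
  shows "(\<integral>\<^sup>+x\<in>f ` S. ennreal (p x) \<partial>lborel) = (\<integral>\<^sup>+t\<in>S. ennreal (\<bar>det (J t)\<bar> * p (f t)) \<partial>lborel)"
proof -
  have cf: "continuous_on S f"
    by (intro differentiable_imp_continuous_on) (use f in \<open>auto simp: differentiable_on_def differentiable_def\<close>)
  have [measurable]: "S \<in> sets borel" "f ` S \<in> sets borel" "p \<in> borel_measurable borel"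
    using S cf fsigma_continuous_image fsigma_imp_borel p borel_measurable_continuous_onI by auto
  have SL: "S \<in> sets lebesgue" "f ` S \<in> sets lebesgue" by auto
  define D where "D = (\<lambda>t. \<bar>det (J t)\<bar> * p (f t))"
  have cD: "continuous_on S D"
    unfolding D_def det_def using J continuous_on_compose2[OF p(2) cf]
    by (intro continuous_intros) auto
  have mD: "(\<lambda>t. indicator S t *\<^sub>R D t) \<in> borel_measurable borel"
    by (rule borel_measurable_continuous_on_indicator[OF _ cD]) simp
  have D0: "0 \<le> D t" for t using p by (simp add: D_def)
  have ip: "integrable lborel (\<lambda>x. indicator (f ` S) x *\<^sub>R p x)"
    using p(1) by (intro integrable_mult_indicator) auto
  have "set_integrable lebesgue (f ` S) p"
    unfolding set_integrable_def by (rule integrable_completion[THEN iffD2, OF _ ip]) measurable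
  then have pai: "p absolutely_integrable_on (f ` S)" .
  \<comment> \<open>The change of variables theorem applied here has vector-valued integrands, so
    the scalar \<open>p\<close> enters as a vector of length one.\<close>
  let ?v = "\<lambda>x. vec (p x) :: real ^ 1"
  have "?v absolutely_integrable_on (f ` S) \<and> integral (f ` S) ?v = vec (integral (f ` S) p)"
    using pai by (simp add: absolutely_integrable_on_1_iff integral_on_1_eq o_def)
  then have "(\<lambda>x. \<bar>det (matrix (\<lambda>h. J x *v h))\<bar> *\<^sub>R ?v (f x)) absolutely_integrable_on S \<and>
     integral S (\<lambda>x. \<bar>det (matrix (\<lambda>h. J x *v h))\<bar> *\<^sub>R ?v (f x)) = vec (integral (f ` S) p)"
    using has_absolute_integral_change_of_variables[OF SL(1) f inj, where f="?v"] by blast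
  then have D: "D absolutely_integrable_on S" "integral S D = integral (f ` S) p"
    by (simp_all add: absolutely_integrable_on_1_iff integral_on_1_eq o_def D_def)
  have conv: "(\<integral>\<^sup>+x\<in>T. ennreal (g x) \<partial>lborel) = ennreal (integral T g)"
    if g: "g absolutely_integrable_on T" and T: "(\<lambda>t. indicator T t *\<^sub>R g t) \<in> borel_measurable borel" and g0: "\<And>x. 0 \<le> g x"
    for g :: "real ^ 'n::{finite,wellorder} \<Rightarrow> real" and T
  proof -
    have "integrable lebesgue (\<lambda>t. indicator T t *\<^sub>R g t)"
      using g by (simp add: set_integrable_def)
    then have i: "integrable lborel (\<lambda>t. indicator T t *\<^sub>R g t)"
      using T by (subst (asm) integrable_completion) auto
    have "(\<integral>\<^sup>+x\<in>T. ennreal (g x) \<partial>lborel) = (\<integral>\<^sup>+x. ennreal (indicator T x *\<^sub>R g x) \<partial>lborel)"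
      by (rule nn_integral_cong) (auto simp: indicator_def)
    also have "\<dots> = ennreal (\<integral>x. indicator T x *\<^sub>R g x \<partial>lborel)"
      by (rule nn_integral_eq_integral[OF i]) (simp add: g0)
    also have "(\<integral>x. indicator T x *\<^sub>R g x \<partial>lborel) = (\<integral>x. indicator T x *\<^sub>R g x \<partial>lebesgue)"
      by (rule integral_completion[symmetric]) (use T in auto)
    also have "\<dots> = integral T g"
      using set_lebesgue_integral_eq_integral(2)[OF g] by (simp add: set_lebesgue_integral_def)
    finally show ?thesis .
  qed
  have "(\<integral>\<^sup>+x\<in>f ` S. ennreal (p x) \<partial>lborel) = ennreal (integral (f ` S) p)"
    by (rule conv[OF pai _ p(3)]) measurable
  also have "\<dots> = (\<integral>\<^sup>+t\<in>S. ennreal (D t) \<partial>lborel)"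
    using conv[OF D(1) mD D0] D(2) by simp
  finally show ?thesis by (simp add: D_def)
qed

lemma has_derivative_conjugate_reidx:
  fixes f :: "real ^ 'd \<Rightarrow> real ^ 'd"
  assumes "(f has_derivative (\<lambda>h. A *v h)) (at t within S)"
  shows "((\<lambda>y. reidx (f (unidx y))) has_derivative
    (\<lambda>h. (\<chi> i j. A $ Rep_widx i $ Rep_widx j) *v h)) (at (reidx t) within reidx ` S)"
proof -
  have 1: "((\<lambda>y. f (unidx y)) has_derivative (\<lambda>h. A *v unidx h)) (at (reidx t) within reidx ` S)"
  proof -
    have u: "(unidx has_derivative unidx) (at (reidx t) within reidx ` S)"
      by (rule bounded_linear_imp_has_derivative[OF bounded_linear_unidx])
    have f: "(f has_derivative (\<lambda>h. A *v h)) (at (unidx (reidx t)) within unidx ` reidx ` S)"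
      using assms by (simp add: image_image)
    show ?thesis by (rule has_derivative_in_compose[OF u f])
  qed
  have 2: "((\<lambda>y. reidx (f (unidx y))) has_derivative (\<lambda>h. reidx (A *v unidx h))) (at (reidx t) within reidx ` S)"
    by (rule bounded_linear.has_derivative[OF bounded_linear_reidx 1])
  have 3: "reidx (A *v unidx h) = (\<chi> i j. A $ Rep_widx i $ Rep_widx j) *v h" for h
  proof -
    have "(\<Sum>j\<in>UNIV. A $ Rep_widx i $ j * h $ Abs_widx j) = (\<Sum>k\<in>UNIV. A $ Rep_widx i $ Rep_widx k * h $ k)" for i
      by (rule sum.reindex_bij_witness[of _ Rep_widx Abs_widx]) (auto simp: Abs_widx_inverse Rep_widx_inverse)
    then show ?thesis by (simp add: vec_eq_iff reidx_def unidx_def matrix_vector_mult_def)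
  qed
  show ?thesis using 2 unfolding 3 .
qed

lemma bij_Rep_widx: "bij Rep_widx"
  by (rule bij_betw_byWitness[of _ Abs_widx]) (auto simp: Abs_widx_inverse Rep_widx_inverse)

lemma nn_integral_lborel_reidx:
  assumes "F \<in> borel_measurable borel"
  shows "(\<integral>\<^sup>+y. F y \<partial>lborel) = (\<integral>\<^sup>+x. F (reidx x) \<partial>lborel)"
  by (subst distr_reidx[symmetric], subst nn_integral_distr) (use assms in auto)

lemma nn_integral_change_of_variables:
  fixes f :: "real ^ 'd \<Rightarrow> real ^ 'd" and p :: "real ^ 'd \<Rightarrow> real"
  assumes S: "fsigma S"
    and f: "\<And>t. t \<in> S \<Longrightarrow> (f has_derivative (\<lambda>h. J t *v h)) (at t within S)"
    and J: "continuous_on S J"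
    and inj: "inj_on f S"
    and p: "integrable lborel p" "continuous_on UNIV p" "\<And>x. 0 \<le> p x"
  shows "(\<integral>\<^sup>+x\<in>f ` S. ennreal (p x) \<partial>lborel) = (\<integral>\<^sup>+t\<in>S. ennreal (\<bar>det (J t)\<bar> * p (f t)) \<partial>lborel)"
proof -
  define g where "g = (\<lambda>y. reidx (f (unidx y)))"
  define T where "T = reidx ` S"
  define K where "K = (\<lambda>y. (\<chi> i j. J (unidx y) $ Rep_widx i $ Rep_widx j) :: real ^ 'd widx ^ 'd widx)"
  have unT: "unidx y \<in> S" if "y \<in> T" for y using that by (auto simp: T_def)
  have T: "fsigma T"
    unfolding T_def by (rule fsigma_continuous_image[OF S]) (rule linear_continuous_on[OF bounded_linear_reidx])
  have cu: "continuous_on T unidx" by (rule linear_continuous_on[OF bounded_linear_unidx])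
  have g: "(g has_derivative (\<lambda>h. K y *v h)) (at y within T)" if "y \<in> T" for y
    using has_derivative_conjugate_reidx[OF f[OF unT[OF that]]] by (simp add: g_def K_def T_def)
  have K: "continuous_on T K"
    unfolding K_def
    by (intro continuous_intros continuous_on_compose2[OF J cu]) (use unT in auto)
  have injg: "inj_on g T"
    using inj unfolding g_def T_def inj_on_def
    by (metis (no_types, lifting) imageE unidx_reidx)
  have detK: "det (K (reidx x)) = det (J x)" for x
    unfolding K_def using det_reindex[OF bij_Rep_widx, of "J x"] by simp
  have ipr: "integrable lborel (\<lambda>y. p (unidx y))"
    by (subst distr_reidx[symmetric], subst integrable_distr_eq)
      (use p in \<open>auto intro!: measurable_compose[OF measurable_unidx] borel_measurable_continuous_onI\<close>)
  have cpr: "continuous_on UNIV (\<lambda>y. p (unidx y))"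
    by (rule continuous_on_compose2[OF p(2) linear_continuous_on[OF bounded_linear_unidx]]) auto
  have cg: "continuous_on T g"
    by (intro differentiable_imp_continuous_on) (use g in \<open>auto simp: differentiable_on_def differentiable_def\<close>)
  have gT: "g ` T = reidx ` f ` S" by (auto simp: g_def T_def image_image)
  have mem: "reidx x \<in> reidx ` A \<longleftrightarrow> x \<in> A" for x :: "real ^ 'd" and A
    by (auto dest: injD[OF inj_reidx])
  have [measurable]: "T \<in> sets borel" "g ` T \<in> sets borel" "(\<lambda>y. p (unidx y)) \<in> borel_measurable borel"
    using T fsigma_imp_borel fsigma_continuous_image[OF T cg] borel_measurable_continuous_onI[OF cpr] by auto
  have mL: "(\<lambda>y. ennreal (p (unidx y)) * indicator (g ` T) y) \<in> borel_measurable borel"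
    by measurable
  have cD: "continuous_on T (\<lambda>y. \<bar>det (K y)\<bar> * p (unidx (g y)))"
    unfolding det_def using K continuous_on_compose2[OF cpr cg]
    by (intro continuous_intros) auto
  have "(\<lambda>y. indicator T y *\<^sub>R (\<bar>det (K y)\<bar> * p (unidx (g y)))) \<in> borel_measurable borel"
    by (rule borel_measurable_continuous_on_indicator[OF _ cD]) simp
  then have "(\<lambda>y. ennreal (indicator T y *\<^sub>R (\<bar>det (K y)\<bar> * p (unidx (g y))))) \<in> borel_measurable borel"
    by measurable
  also have "(\<lambda>y. ennreal (indicator T y *\<^sub>R (\<bar>det (K y)\<bar> * p (unidx (g y))))) =
      (\<lambda>y. ennreal (\<bar>det (K y)\<bar> * p (unidx (g y))) * indicator T y)"
    by (auto simp: fun_eq_iff indicator_def)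
  finally have mD: "(\<lambda>y. ennreal (\<bar>det (K y)\<bar> * p (unidx (g y))) * indicator T y) \<in> borel_measurable borel" .
  have "(\<integral>\<^sup>+x\<in>f ` S. ennreal (p x) \<partial>lborel) = (\<integral>\<^sup>+y\<in>g ` T. ennreal (p (unidx y)) \<partial>lborel)"
    by (subst nn_integral_lborel_reidx[OF mL]) (auto simp: gT mem indicator_def intro!: nn_integral_cong)
  also have "\<dots> = (\<integral>\<^sup>+y\<in>T. ennreal (\<bar>det (K y)\<bar> * p (unidx (g y))) \<partial>lborel)"
    by (rule nn_integral_change_of_variables_wellorder[OF T g K injg ipr cpr]) (use p in auto)
  also have "\<dots> = (\<integral>\<^sup>+t\<in>S. ennreal (\<bar>det (J t)\<bar> * p (f t)) \<partial>lborel)"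
    by (subst nn_integral_lborel_reidx[OF mD])
       (auto simp: T_def mem detK g_def indicator_def intro!: nn_integral_cong)
  finally show ?thesis .
qed

lemma negligible_critical_values:
  fixes f :: "real ^ 'd \<Rightarrow> real ^ 'd"
  assumes f: "\<And>t. t \<in> S \<Longrightarrow> (f has_derivative (\<lambda>h. J t *v h)) (at t within S)"
    and J: "\<And>t. t \<in> S \<Longrightarrow> det (J t) = 0"
  shows "negligible (f ` S)"
proof -
  define g where "g = (\<lambda>y. reidx (f (unidx y)))"
  define K where "K = (\<lambda>y. (\<chi> i j. J (unidx y) $ Rep_widx i $ Rep_widx j) :: real ^ 'd widx ^ 'd widx)"
  have "negligible (g ` reidx ` S)"
  proof (rule baby_Sard)
    fix y assume y: "y \<in> reidx ` S"
    then have "unidx y \<in> S" by auto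
    then show "(g has_derivative (\<lambda>h. K y *v h)) (at y within reidx ` S)"
      using has_derivative_conjugate_reidx[OF f] y by (auto simp: g_def K_def)
    have "det (K y) = 0"
      unfolding K_def using det_reindex[OF bij_Rep_widx, of "J (unidx y)"] J \<open>unidx y \<in> S\<close> by simp
    then show "rank (matrix (\<lambda>h. K y *v h)) < CARD('d widx)"
      by (simp add: det_eq_0_rank)
  qed simp
  moreover have "DIM(real ^ 'd widx) = DIM(real ^ 'd)"
    using bij_betw_same_card[OF bij_Rep_widx] by simp
  ultimately have "negligible (unidx ` (g ` reidx ` S))"
    using linear_imp_differentiable_on[OF linear_unidx, of "g ` reidx ` S"]
    by (intro negligible_differentiable_image_negligible[of "g ` reidx ` S" unidx]) simp_all
  then show ?thesis by (simp add: image_image g_def)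
qed

text \<open>An injective linear map satisfies \<open>c * norm h \<le> norm (A *v h)\<close>, and
  close to \<open>t\<close> the differentiation error consumes at most half of this. A single
  integer \<open>m\<close> encodes both the radius and the rate, so that countably many conditions
  exhaust all points with nonzero determinant.\<close>

lemma separated_if_det_nonzero:
  fixes f :: "real ^ 'd \<Rightarrow> real ^ 'd"
  assumes f: "(f has_derivative (\<lambda>h. A *v h)) (at t)" and A: "det A \<noteq> 0"
  shows "\<exists>m::nat. \<forall>s. dist s t < 1 / (real m + 1) \<longrightarrow> dist s t / (real m + 1) \<le> dist (f s) (f t)"
proof -
  have "inj ((*v) A)" using A by (simp add: inj_matrix_vector_mult invertible_det_nz)
  then obtain c where c: "c > 0" "\<And>h. c * norm h \<le> norm (A *v h)"
    using linear_inj_bounded_below_pos[OF matrix_vector_mul_linear, of A] by metis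
  obtain d where d: "d > 0" "\<And>s. norm (s - t) < d \<Longrightarrow> norm (f s - f t - A *v (s - t)) \<le> c / 2 * norm (s - t)"
    using f c(1) unfolding has_derivative_at_alt by (meson half_gt_zero)
  obtain m :: nat where m: "max (1 / d) (2 / c) < m" using reals_Archimedean2 by blast
  then have m1: "1 / (real m + 1) < d" and m2: "1 / (real m + 1) \<le> c / 2"
    using c d by (auto simp: field_simps max_less_iff_conj)
  have "dist s t / (real m + 1) \<le> dist (f s) (f t)" if "dist s t < 1 / (real m + 1)" for s
  proof -
    have "norm (f s - f t - A *v (s - t)) \<le> c / 2 * norm (s - t)"
      using that m1 by (intro d(2)) (simp add: dist_norm)
    moreover have "c * norm (s - t) \<le> norm (A *v (s - t))" by (rule c(2))
    moreover have "norm (A *v (s - t)) \<le> norm (f s - f t) + norm (f s - f t - A *v (s - t))"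
      using norm_triangle_ineq4[of "f s - f t" "f s - f t - A *v (s - t)"] by simp
    ultimately have "c / 2 * norm (s - t) \<le> norm (f s - f t)" by simp
    moreover have "1 / (real m + 1) * norm (s - t) \<le> c / 2 * norm (s - t)"
      using m2 by (intro mult_right_mono) auto
    ultimately have "1 / (real m + 1) * norm (s - t) \<le> norm (f s - f t)" by linarith
    then show ?thesis by (simp add: dist_norm)
  qed
  then show ?thesis by blast
qed

section \<open>Countable partitions of the space into small cells\<close>

definition mesh_center :: "nat \<Rightarrow> 'a::euclidean_space" where
  "mesh_center = from_nat_into (SOME D. countable D \<and> (\<forall>V. open V \<longrightarrow> V \<noteq> {} \<longrightarrow> (\<exists>d\<in>D. d \<in> V)))"

lemma mesh_center_dense:
  assumes "open V" "V \<noteq> {}"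
  shows "\<exists>n. (mesh_center n :: 'a::euclidean_space) \<in> V"
proof -
  let ?P = "\<lambda>D :: 'a set. countable D \<and> (\<forall>V. open V \<longrightarrow> V \<noteq> {} \<longrightarrow> (\<exists>d\<in>D. d \<in> V))"
  define D where "D = (SOME D. ?P D)"
  have "\<exists>D. ?P D"
    by (rule countable_dense_setE) blast
  then have D: "?P D" unfolding D_def by (rule someI_ex)
  then obtain d where d: "d \<in> D" "d \<in> V" using assms by blast
  then have "mesh_center (to_nat_on D d) = d"
    unfolding mesh_center_def D_def[symmetric] using D by simp
  then show ?thesis using d by metis
qed

text \<open>Making balls around a dense sequence disjoint gives F-sigma cells of arbitrarily small
  diameter. The cells depend neither on a map nor on a sample point, which is what makes them useful
  for measurability.\<close>

definition mesh :: "nat \<Rightarrow> nat \<Rightarrow> 'a::euclidean_space set" where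
  "mesh k = disjointed (\<lambda>j. ball (mesh_center j) (1 / (real k + 1)))"

lemma disjoint_mesh: "disjoint_family (mesh k)"
  unfolding mesh_def by (rule disjoint_family_disjointed)

lemma UN_mesh: "(\<Union>j. mesh k j) = (UNIV :: 'a::euclidean_space set)"
proof -
  have "\<exists>j. dist (mesh_center j) x < 1 / (real k + 1)" for x :: 'a
    using mesh_center_dense[of "ball x (1 / (real k + 1))"] by (auto simp: dist_commute)
  then show ?thesis unfolding mesh_def UN_disjointed_eq by auto
qed

lemma dist_mesh_center: "t \<in> mesh k j \<Longrightarrow> dist (mesh_center j) t < 1 / (real k + 1)"
  using disjointed_subset[of "\<lambda>j. ball (mesh_center j) (1 / (real k + 1))" j] unfolding mesh_def by auto

lemma dist_mesh:
  assumes "s \<in> mesh k j" "t \<in> mesh k j"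
  shows "dist s t < 2 / (real k + 1)"
  using dist_triangle3[of s t "mesh_center j"] dist_mesh_center[OF assms(1)] dist_mesh_center[OF assms(2)]
  by simp

lemma fsigma_mesh: "fsigma (mesh k j :: 'a::euclidean_space set)"
proof -
  let ?b = "\<lambda>j. ball (mesh_center j :: 'a) (1 / (real k + 1))"
  have "mesh k j = ?b j \<inter> - (\<Union>i\<in>{0..<j}. ?b i)" by (auto simp: mesh_def disjointed_def)
  moreover have "closed (- (\<Union>i\<in>{0..<j}. ?b i))" by (intro closed_Compl open_UN) auto
  ultimately show ?thesis
    using fsigma_Int[OF open_imp_fsigma[OF open_ball] closed_imp_fsigma] by simp
qed

section \<open>Counting preimages\<close>

definition count_preimage :: "('a \<Rightarrow> 'b) \<Rightarrow> 'a set \<Rightarrow> 'b \<Rightarrow> ennreal" where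
  "count_preimage f B x = emeasure (count_space UNIV) {t \<in> B. f t = x}"

lemma count_preimage_UN:
  assumes "disjoint_family T"
  shows "count_preimage f (\<Union>n::nat. T n) x = (\<Sum>n. count_preimage f (T n) x)"
proof -
  have "(\<Sum>n. emeasure (count_space UNIV) ((\<lambda>n. {t \<in> T n. f t = x}) n)) =
      emeasure (count_space UNIV) (\<Union>n. {t \<in> T n. f t = x})"
    by (rule suminf_emeasure) (use assms in \<open>auto simp: disjoint_family_on_def\<close>)
  also have "(\<Union>n. {t \<in> T n. f t = x}) = {t \<in> (\<Union>n. T n). f t = x}" by auto
  finally show ?thesis by (simp add: count_preimage_def)
qed

lemma count_preimage_inj_on:
  assumes "inj_on f T"
  shows "count_preimage f T x = indicator (f ` T) x"
proof (cases "x \<in> f ` T")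
  case True
  then obtain t where "t \<in> T" "f t = x" by auto
  then have "{t \<in> T. f t = x} = {t}" using assms by (auto simp: inj_on_def)
  then show ?thesis using True by (simp add: count_preimage_def)
next
  case False
  then have e: "{t \<in> T. f t = x} = {}" by auto
  show ?thesis using False unfolding count_preimage_def e by simp
qed

text \<open>
  Near a point with nonzero Jacobian \<open>f\<close> does not contract distances too much. Hence countably many
  pieces on which \<open>f\<close> is injective cover these points, and the others have a null image.
\<close>

theorem area_formula:
  fixes f :: "real ^ 'd \<Rightarrow> real ^ 'd" and p :: "real ^ 'd \<Rightarrow> real"
  assumes U: "open U" and B: "fsigma B" "B \<subseteq> U"
    and f: "\<And>t. t \<in> U \<Longrightarrow> (f has_derivative (\<lambda>h. J t *v h)) (at t)"
    and J: "continuous_on U J"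
    and p: "integrable lborel p" "continuous_on UNIV p" "\<And>x. 0 \<le> p x"
  shows "(\<integral>\<^sup>+x. count_preimage f B x * ennreal (p x) \<partial>lborel) = (\<integral>\<^sup>+t\<in>B. ennreal (\<bar>det (J t)\<bar> * p (f t)) \<partial>lborel)"
proof -
  have fc: "continuous_on U f"
    using f has_derivative_continuous continuous_at_imp_continuous_on by blast
  \<comment> \<open>On \<open>E m\<close> distances shrink at most by the factor
    \<open>m + 1\<close> within radius \<open>1 / (m + 1)\<close>. The condition is stable under
    limits in \<open>t\<close>, as \<open>f\<close> is continuous, so \<open>E m\<close> is
    relatively closed in \<open>U\<close>.\<close>
  define E where "E m = {t\<in>U. \<forall>s\<in>U. dist s t < 1 / (real m + 1) \<longrightarrow> dist s t / (real m + 1) \<le> dist (f s) (f t)}" for m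
  have "\<exists>C. closed C \<and> E m = U \<inter> C" for m
  proof -
    have "closedin (top_of_set U) (E m)"
      unfolding closedin_limpt
    proof (intro conjI allI impI)
      show "E m \<subseteq> U" by (auto simp: E_def)
      fix t assume t: "t islimpt E m \<and> t \<in> U"
      then obtain w where w: "\<And>n. w n \<in> E m" "w \<longlonglongrightarrow> t"
        by (auto simp: islimpt_sequential)
      have fw: "(\<lambda>n. f (w n)) \<longlonglongrightarrow> f t"
        using continuous_on_tendsto_compose[OF fc w(2)] t w(1) by (auto simp: E_def)
      have "dist s t / (real m + 1) \<le> dist (f s) (f t)" if s: "s \<in> U" "dist s t < 1 / (real m + 1)" for s
      proof (rule tendsto_le[OF trivial_limit_sequentially])
        show "(\<lambda>n. dist (f s) (f (w n))) \<longlonglongrightarrow> dist (f s) (f t)" by (intro tendsto_intros fw)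
        show "(\<lambda>n. dist s (w n) / (real m + 1)) \<longlonglongrightarrow> dist s t / (real m + 1)" by (intro tendsto_intros w) auto
        have "(\<lambda>n. dist s (w n)) \<longlonglongrightarrow> dist s t" by (intro tendsto_intros w)
        then have "\<forall>\<^sub>F n in sequentially. dist s (w n) < 1 / (real m + 1)"
          using s(2) by (rule order_tendstoD)
        then show "\<forall>\<^sub>F n in sequentially. dist s (w n) / (real m + 1) \<le> dist (f s) (f (w n))"
          by eventually_elim (use w(1) s(1) in \<open>auto simp: E_def\<close>)
      qed
      then show "t \<in> E m" using t by (auto simp: E_def)
    qed
    then show ?thesis by (auto simp: closedin_closed)
  qed
  then obtain C where C: "\<And>m. closed (C m)" "\<And>m. E m = U \<inter> C m" by metis
  \<comment> \<open>With this radius two points of a cell are at distance at most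
    \<open>2 / (3 * (m + 1))\<close>, which is less than \<open>1 / (m + 1)\<close>, so the estimate
    defining \<open>E m\<close> applies to them and makes \<open>f\<close> injective on the part in
    \<open>B\<close>.\<close>
  define Q where "Q k = (case prod_decode k of (m, j) \<Rightarrow> C m \<inter> cball (mesh_center j) (1 / (3 * (real m + 1))))" for k
  have Qc: "closed (Q k)" for k by (auto simp: Q_def C split: prod.split)
  define T where "T k = B \<inter> disjointed Q k" for k
  have Tf: "fsigma (T k)" for k
  proof -
    have "T k = (B \<inter> Q k) \<inter> - (\<Union>i\<in>{0..<k}. Q i)" by (auto simp: T_def disjointed_def)
    moreover have "open (- (\<Union>i\<in>{0..<k}. Q i))" using Qc by (intro open_Compl closed_UN) auto
    ultimately show ?thesis
      using fsigma_Int[OF fsigma_Int[OF B(1) closed_imp_fsigma[OF Qc[of k]]] open_imp_fsigma] by simp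
  qed
  have dT: "disjoint_family T"
    using disjoint_family_disjointed[of Q] by (auto simp: T_def disjoint_family_on_def)
  have UT: "(\<Union>k. T k) = B \<inter> (\<Union>k. Q k)"
    using UN_disjointed_eq[of Q] by (auto simp: T_def)
  have TB: "T k \<subseteq> B" for k by (auto simp: T_def)
  have injT: "inj_on f (T k)" for k
  proof (rule inj_onI)
    fix s t assume st: "s \<in> T k" "t \<in> T k" "f s = f t"
    obtain m j where k: "prod_decode k = (m, j)" by fastforce
    have "s \<in> Q k" "t \<in> Q k" using st disjointed_subset[of Q k] by (auto simp: T_def)
    then have s: "s \<in> C m" "dist (mesh_center j) s \<le> 1 / (3 * (real m + 1))" and t: "t \<in> C m" "dist (mesh_center j) t \<le> 1 / (3 * (real m + 1))"
      by (auto simp: Q_def k)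
    have "dist s t \<le> 1 / (3 * (real m + 1)) + 1 / (3 * (real m + 1))"
      using dist_triangle3[of s t "mesh_center j"] s t by simp
    also have "\<dots> < 1 / (real m + 1)" by (simp add: field_simps)
    finally have "dist s t < 1 / (real m + 1)" .
    moreover have "t \<in> E m" "s \<in> U" using st TB B t unfolding C(2) by auto
    ultimately have "dist s t / (real m + 1) \<le> dist (f s) (f t)" by (auto simp: E_def)
    then show "s = t" using st(3) by (simp add: divide_le_0_iff)
  qed
  have det0: "det (J t) = 0" if "t \<in> B" "t \<notin> (\<Union>k. Q k)" for t
  proof (rule ccontr)
    assume "det (J t) \<noteq> 0"
    moreover have tU: "t \<in> U" using that B by auto
    ultimately obtain m :: nat where "\<forall>s. dist s t < 1 / (real m + 1) \<longrightarrow> dist s t / (real m + 1) \<le> dist (f s) (f t)"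
      using separated_if_det_nonzero[OF f] by blast
    then have "t \<in> E m" using tU by (auto simp: E_def add.commute)
    then have "t \<in> C m" using C(2) by auto
    moreover obtain j where "mesh_center j \<in> ball t (1 / (3 * (real m + 1)))"
      using mesh_center_dense[of "ball t (1 / (3 * (real m + 1)))"] by auto
    ultimately have "t \<in> Q (prod_encode (m, j))" by (auto simp: Q_def dist_commute)
    then show False using that by auto
  qed
  \<comment> \<open>What the pieces miss has zero Jacobian: on the left its image is null, on the
    right its integrand vanishes.\<close>
  define N where "N = f ` (B - (\<Union>k. Q k))"
  have "negligible N"
    unfolding N_def
    by (rule negligible_critical_values) (use f B det0 in \<open>auto intro: has_derivative_at_withinI\<close>)
  then have "AE x in lebesgue. x \<notin> N"
    unfolding negligible_iff_null_sets by (rule AE_not_in)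
  then have AEN: "AE x in lborel. x \<notin> N"
    by (simp only: AE_completion_iff)
  have fT: "(f has_derivative (\<lambda>h. J t *v h)) (at t within T k)" if "t \<in> T k" for t k
    using f B(2) TB that by (blast intro: has_derivative_at_withinI)
  have cJ: "continuous_on (T k) J" for k
    by (rule continuous_on_subset[OF J]) (use TB B(2) in blast)
  have [measurable]: "T k \<in> sets borel" "B \<in> sets borel" for k using Tf B fsigma_imp_borel by auto
  have "continuous_on (T k) f" for k using fc continuous_on_subset TB B(2) by blast
  then have [measurable]: "f ` T k \<in> sets borel" for k using Tf fsigma_continuous_image fsigma_imp_borel by blast
  have [measurable]: "p \<in> borel_measurable borel" using p borel_measurable_continuous_onI by auto
  have "(\<integral>\<^sup>+x. count_preimage f B x * ennreal (p x) \<partial>lborel) = (\<integral>\<^sup>+x. (\<Sum>k. ennreal (p x) * indicator (f ` T k) x) \<partial>lborel)"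
  proof (rule nn_integral_cong_AE)
    show "AE x in lborel. count_preimage f B x * ennreal (p x) = (\<Sum>k. ennreal (p x) * indicator (f ` T k) x)"
      using AEN
    proof eventually_elim
      case (elim x)
      then have "{t \<in> B. f t = x} = {t \<in> (\<Union>k. T k). f t = x}"
        unfolding UT N_def by auto
      then have "count_preimage f B x = count_preimage f (\<Union>k. T k) x" by (simp add: count_preimage_def)
      also have "\<dots> = (\<Sum>k. indicator (f ` T k) x)"
        unfolding count_preimage_UN[OF dT] by (simp add: count_preimage_inj_on[OF injT])
      finally show ?case by (simp add: mult.commute[of _ "ennreal (p x)"] ennreal_suminf_cmult)
    qed
  qed
  also have "\<dots> = (\<Sum>k. \<integral>\<^sup>+x\<in>f ` T k. ennreal (p x) \<partial>lborel)"
    by (rule nn_integral_suminf) measurable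
  also have "\<dots> = (\<Sum>k. \<integral>\<^sup>+t\<in>T k. ennreal (\<bar>det (J t)\<bar> * p (f t)) \<partial>lborel)"
    by (intro suminf_cong nn_integral_change_of_variables[OF Tf fT cJ injT p])
  \<comment> \<open>\<open>J\<close> and \<open>f\<close> are controlled on \<open>U\<close> only.
    The extra indicator is 1 on every \<open>T k\<close> and yields an integrand that is Borel
    measurable on the whole space.\<close>
  also have "\<dots> = (\<Sum>k. \<integral>\<^sup>+t. ennreal (indicator U t *\<^sub>R (\<bar>det (J t)\<bar> * p (f t))) * indicator (T k) t \<partial>lborel)"
    by (intro suminf_cong nn_integral_cong) (use TB B(2) in \<open>auto simp: indicator_def\<close>)
  also have "\<dots> = (\<integral>\<^sup>+t\<in>(\<Union>k. T k). ennreal (indicator U t *\<^sub>R (\<bar>det (J t)\<bar> * p (f t))) \<partial>lborel)"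
  proof (rule nn_integral_disjoint_family[symmetric])
    have "continuous_on U (\<lambda>t. \<bar>det (J t)\<bar> * p (f t))"
      unfolding det_def using J continuous_on_compose2[OF p(2) fc]
      by (intro continuous_intros) auto
    then have "(\<lambda>t. indicator U t *\<^sub>R (\<bar>det (J t)\<bar> * p (f t))) \<in> borel_measurable borel"
      by (rule borel_measurable_continuous_on_indicator[OF borel_open[OF U]])
    then show "(\<lambda>t. ennreal (indicator U t *\<^sub>R (\<bar>det (J t)\<bar> * p (f t)))) \<in> borel_measurable lborel" by simp
  qed (use dT in auto)
  also have "\<dots> = (\<integral>\<^sup>+t\<in>B. ennreal (\<bar>det (J t)\<bar> * p (f t)) \<partial>lborel)"
    by (rule nn_integral_cong) (use det0 B(2) in \<open>auto simp: indicator_def UT\<close>)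
  finally show ?thesis .
qed

lemma indicator_image_le_count_preimage: "indicator (f ` T) x \<le> count_preimage f T x"
proof (cases "x \<in> f ` T")
  case True
  then obtain t where "t \<in> T" "f t = x" by auto
  then have "emeasure (count_space UNIV) {t} \<le> count_preimage f T x"
    unfolding count_preimage_def by (intro emeasure_mono) auto
  then show ?thesis using True by simp
qed simp

section \<open>Measurability of the number of solutions\<close>

lemma count_preimage_mesh:
  "count_preimage f B x = (\<Sum>j. count_preimage f (B \<inter> mesh k j) x)"
proof -
  have "count_preimage f B x = count_preimage f (\<Union>j. B \<inter> mesh k j) x"
    by (simp only: Int_UN_distrib[symmetric] UN_mesh Int_UNIV_right)
  also have "\<dots> = (\<Sum>j. count_preimage f (B \<inter> mesh k j) x)"
    by (rule count_preimage_UN) (use disjoint_mesh[of k] in \<open>auto simp: disjoint_family_on_def\<close>)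
  finally show ?thesis .
qed

text \<open>Finitely many preimages fall into distinct cells once the cells are smaller than their
  mutual distances, while a cell that meets the preimage always holds at least one point. Counting
  is thereby reduced to membership in images. The meshes are not nested, hence a supremum rather
  than a limit.\<close>

lemma count_preimage_eq_SUP:
  "count_preimage f B x = (SUP k. \<Sum>j. indicator (f ` (B \<inter> mesh k j)) x)"
proof (rule antisym)
  let ?S = "SUP k. \<Sum>j. indicator (f ` (B \<inter> mesh k j)) x :: ennreal"
  let ?A = "{t \<in> B. f t = x}"
  have fin: "of_nat (card F) \<le> ?S" if F: "finite F" "F \<subseteq> ?A" for F
  proof -
    have "\<exists>k. \<forall>s\<in>F. \<forall>t\<in>F. s \<noteq> t \<longrightarrow> 2 / (real k + 1) \<le> dist s t"
    proof -
      \<comment> \<open>The extra element 1 keeps the minimum defined and positive when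
        \<open>F\<close> has fewer than two points.\<close>
      define P where "P = insert 1 ((\<lambda>z. dist (fst z) (snd z)) ` {z \<in> F \<times> F. fst z \<noteq> snd z})"
      define d where "d = Min P"
      have P: "finite P" "P \<noteq> {}" using F(1) by (auto simp: P_def)
      have "d \<in> P" unfolding d_def by (rule Min_in[OF P])
      then have d1: "d > 0" by (auto simp: P_def)
      have "d \<le> dist s t" if "s \<in> F" "t \<in> F" "s \<noteq> t" for s t
        unfolding d_def using that by (intro Min_le P) (force simp: P_def)
      note d = d1 this
      obtain k :: nat where "2 / d < k" using reals_Archimedean2 by blast
      then have "2 / (real k + 1) \<le> d" using d(1) by (simp add: field_simps)
      then show ?thesis using d(2) by (meson order.trans)
    qed
    then obtain k where k: "\<And>s t. s \<in> F \<Longrightarrow> t \<in> F \<Longrightarrow> s \<noteq> t \<Longrightarrow> 2 / (real k + 1) \<le> dist s t" by blast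
    have "inj_on f (F \<inter> mesh k j)" for j
    proof (rule inj_onI)
      fix s t assume "s \<in> F \<inter> mesh k j" "t \<in> F \<inter> mesh k j"
      then show "s = t" using k[of s t] dist_mesh[of s k j t] by force
    qed
    then have "count_preimage f F x = (\<Sum>j. indicator (f ` (F \<inter> mesh k j)) x)"
      unfolding count_preimage_mesh[of f F x k] by (simp add: count_preimage_inj_on)
    also have "\<dots> \<le> (\<Sum>j. indicator (f ` (B \<inter> mesh k j)) x)"
      using F(2) by (intro suminf_le) (auto simp: indicator_def)
    also have "\<dots> \<le> ?S" by (rule SUP_upper) simp
    also have "count_preimage f F x = of_nat (card F)"
    proof -
      have "{t \<in> F. f t = x} = F" using F(2) by auto
      then show ?thesis using F(1) by (simp add: count_preimage_def)
    qed
    finally show ?thesis .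
  qed
  show "count_preimage f B x \<le> ?S"
  proof (cases "finite ?A")
    case True
    then show ?thesis using fin[of ?A] by (simp add: count_preimage_def)
  next
    case False
    have "of_nat n \<le> ?S" for n
      using infinite_arbitrarily_large[OF False, of n] fin by blast
    then have "?S = top"
      by (metis ennreal_Ex_less_of_nat leD top.not_eq_extremum)
    then show ?thesis by (simp only: top_greatest)
  qed
  show "?S \<le> count_preimage f B x"
  proof (rule SUP_least)
    fix k
    show "(\<Sum>j. indicator (f ` (B \<inter> mesh k j)) x) \<le> count_preimage f B x"
      unfolding count_preimage_mesh[of f B x k]
      by (intro suminf_le indicator_image_le_count_preimage) auto
  qed
qed

text \<open>The image of a compact set is closed, so membership means approximability to every
  precision \<open>1 / (n + 1)\<close>. By continuity the approximating points can be taken in a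
  countable dense subset, which leaves countable quantifiers only.\<close>

lemma measurable_indicator_image_compact:
  fixes Y :: "'a::euclidean_space \<Rightarrow> 'w \<Rightarrow> 'b::euclidean_space"
  assumes C: "compact C" and Y: "\<And>t. t \<in> C \<Longrightarrow> Y t \<in> borel_measurable F"
    and cont: "\<And>\<omega>. \<omega> \<in> space F \<Longrightarrow> continuous_on C (\<lambda>t. Y t \<omega>)"
  shows "{p \<in> space (F \<Otimes>\<^sub>M borel). snd p \<in> (\<lambda>t. Y t (fst p)) ` C} \<in> sets (F \<Otimes>\<^sub>M borel)"
proof -
  obtain D where D: "countable D" "D \<subseteq> C" "C \<subseteq> closure D"
    using separable by blast
  have [measurable]: "(\<lambda>p. Y d (fst p)) \<in> borel_measurable (F \<Otimes>\<^sub>M borel)" if "d \<in> D" for d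
    using Y[of d] D that by (intro measurable_compose[OF measurable_fst]) auto
  have "(snd p \<in> (\<lambda>t. Y t (fst p)) ` C) \<longleftrightarrow> (\<forall>n::nat. \<exists>d\<in>D. dist (Y d (fst p)) (snd p) < 1 / (real n + 1))"
    if "p \<in> space (F \<Otimes>\<^sub>M borel)" for p
  proof
    let ?f = "\<lambda>t. Y t (fst p)"
    have cf: "continuous_on C ?f" using that by (intro cont) (auto simp: space_pair_measure)
    {
      assume "snd p \<in> ?f ` C"
      then obtain t where t: "t \<in> C" "snd p = ?f t" by auto
      show "\<forall>n::nat. \<exists>d\<in>D. dist (?f d) (snd p) < 1 / (real n + 1)"
      proof
        fix n :: nat
        obtain e where e: "e > 0" "\<And>s. s \<in> C \<Longrightarrow> dist s t < e \<Longrightarrow> dist (?f s) (?f t) < 1 / (real n + 1)"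
          using cf t(1) unfolding continuous_on_iff by (metis of_nat_0_le_iff add_nonneg_pos zero_less_one zero_less_divide_1_iff)
        obtain d where "d \<in> D" "dist d t < e"
          using D(3) t(1) e(1) closure_approachable by blast
        then show "\<exists>d\<in>D. dist (?f d) (snd p) < 1 / (real n + 1)"
          using e(2) D(2) t(2) by auto
      qed
    }
    {
      assume *: "\<forall>n::nat. \<exists>d\<in>D. dist (?f d) (snd p) < 1 / (real n + 1)"
      have "snd p \<in> closure (?f ` C)"
        unfolding closure_approachable
      proof (intro allI impI)
        fix e :: real assume "0 < e"
        then obtain n :: nat where n: "1 / (real n + 1) < e"
          using nat_approx_posE[of e] by (metis of_nat_Suc add.commute)
        obtain d where "d \<in> D" "dist (?f d) (snd p) < 1 / (real n + 1)" using * by blast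
        then show "\<exists>y\<in>?f ` C. dist y (snd p) < e" using n D(2) by (intro bexI[of _ "?f d"]) auto
      qed
      also have "closure (?f ` C) = ?f ` C"
        using compact_continuous_image[OF cf C] by (simp add: compact_imp_closed)
      finally show "snd p \<in> ?f ` C" .
    }
  qed
  then have "{p \<in> space (F \<Otimes>\<^sub>M borel). snd p \<in> (\<lambda>t. Y t (fst p)) ` C} =
    {p \<in> space (F \<Otimes>\<^sub>M borel). \<forall>n::nat. \<exists>d\<in>D. dist (Y d (fst p)) (snd p) < 1 / (real n + 1)}" by blast
  also have "\<dots> \<in> sets (F \<Otimes>\<^sub>M borel)"
    using D(1) by measurable
  finally show ?thesis .
qed

lemma measurable_count_preimage:
  fixes Y :: "'a::euclidean_space \<Rightarrow> 'w \<Rightarrow> 'b::euclidean_space"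
  assumes B: "fsigma B" and Y: "\<And>t. t \<in> B \<Longrightarrow> Y t \<in> borel_measurable F"
    and cont: "\<And>\<omega>. \<omega> \<in> space F \<Longrightarrow> continuous_on B (\<lambda>t. Y t \<omega>)"
  shows "(\<lambda>p. count_preimage (\<lambda>t. Y t (fst p)) B (snd p)) \<in> borel_measurable (F \<Otimes>\<^sub>M borel)"
proof -
  have ind: "(\<lambda>p. indicator ((\<lambda>t. Y t (fst p)) ` (B \<inter> mesh k j)) (snd p) :: ennreal) \<in> borel_measurable (F \<Otimes>\<^sub>M borel)" for k j
  proof -
    have "fsigma (B \<inter> mesh k j)" by (rule fsigma_Int[OF B fsigma_mesh])
    then obtain K where K: "\<And>n::nat. compact (K n)" "B \<inter> mesh k j = (\<Union>n. K n)"
      by (rule fsigma_compacts) (rule that)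
    have KB: "K n \<subseteq> B" for n using K(2) by auto
    have "{p \<in> space (F \<Otimes>\<^sub>M borel). snd p \<in> (\<lambda>t. Y t (fst p)) ` K n} \<in> sets (F \<Otimes>\<^sub>M borel)" for n
      by (rule measurable_indicator_image_compact[OF K(1)])
         (use Y KB in \<open>auto intro: continuous_on_subset[OF cont]\<close>)
    then have "(\<Union>n. {p \<in> space (F \<Otimes>\<^sub>M borel). snd p \<in> (\<lambda>t. Y t (fst p)) ` K n}) \<in> sets (F \<Otimes>\<^sub>M borel)"
      by (intro sets.countable_UN image_subsetI)
    also have "(\<Union>n. {p \<in> space (F \<Otimes>\<^sub>M borel). snd p \<in> (\<lambda>t. Y t (fst p)) ` K n}) =
      {p \<in> space (F \<Otimes>\<^sub>M borel). snd p \<in> (\<lambda>t. Y t (fst p)) ` (B \<inter> mesh k j)}"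
      unfolding K(2) by blast
    finally have "(indicator {p \<in> space (F \<Otimes>\<^sub>M borel). snd p \<in> (\<lambda>t. Y t (fst p)) ` (B \<inter> mesh k j)} :: _ \<Rightarrow> ennreal)
       \<in> borel_measurable (F \<Otimes>\<^sub>M borel)" by (rule borel_measurable_indicator)
    then show ?thesis
      by (rule measurable_cong[THEN iffD1, rotated]) (auto simp: indicator_def)
  qed
  show ?thesis
    unfolding count_preimage_eq_SUP
    by (intro borel_measurable_SUP borel_measurable_suminf_order ind) auto
qed

section \<open>Integration over an independent Gaussian vector\<close>

lemma measurable_vec_lambda_borel:
  assumes "\<And>i. (\<lambda>\<omega>. f \<omega> $ i) \<in> borel_measurable N"
  shows "(f :: 'a \<Rightarrow> real ^ 'd) \<in> borel_measurable N"
proof -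
  have "(\<lambda>\<omega>. f \<omega> \<bullet> b) \<in> borel_measurable N" if "b \<in> Basis" for b
    using that assms by (auto simp: Basis_cart inner_axis)
  then show ?thesis by (subst borel_measurable_euclidean_space) auto
qed

text \<open>Conditioning is on a whole field, thus on uncountably many variables. Keeping the sample
  space and coarsening its sigma-algebra avoids working with laws on a space of functions.\<close>

definition generated_sigma :: "'w set \<Rightarrow> ('w \<Rightarrow> real) set \<Rightarrow> 'w measure" where
  "generated_sigma S C = sigma S {X -` A \<inter> S | X A. X \<in> C \<and> A \<in> sets borel}"

lemma space_generated_sigma [simp]: "space (generated_sigma S C) = S"
  by (simp add: generated_sigma_def space_measure_of_conv)

lemma sets_generated_sigma:
  "sets (generated_sigma S C) = sigma_sets S {X -` A \<inter> S | X A. X \<in> C \<and> A \<in> sets borel}"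
  unfolding generated_sigma_def by (rule sets_measure_of) auto

lemma measurable_generated_sigma: "X \<in> C \<Longrightarrow> X \<in> borel_measurable (generated_sigma S C)"
  by (rule measurableI) (auto simp: sets_generated_sigma intro!: sigma_sets.Basic)

context gaussian_space
begin

text \<open>Finite-dimensional cylinders form intersection-stable generators of both sigma-algebras.
  On cylinders the product formula is \<open>prob_inter_uncorrelated\<close>, and a Dynkin argument
  extends it.\<close>

lemma indep_uncorrelated:
  fixes \<xi> :: "'w \<Rightarrow> real ^ 'd"
  assumes C: "C \<subseteq> H" and \<xi>: "\<And>j. (\<lambda>\<omega>. \<xi> \<omega> $ j) \<in> H"
    and cov: "\<And>X j. X \<in> C \<Longrightarrow> covariance M X (\<lambda>\<omega>. \<xi> \<omega> $ j) = 0"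
  shows "(\<lambda>\<omega>. \<omega>) \<in> measurable M (generated_sigma (space M) C)" (is ?thesis1)
    and "\<xi> \<in> borel_measurable M" (is ?thesis2)
    and "A \<in> sets (generated_sigma (space M) C) \<Longrightarrow> B \<in> sets borel \<Longrightarrow>
      prob (A \<inter> (\<xi> -` B \<inter> space M)) = prob A * prob (\<xi> -` B \<inter> space M)" (is "PROP ?thesis3")
proof -
  let ?F = "generated_sigma (space M) C"
  define G1 where "G1 = {{\<omega>\<in>space M. \<forall>X\<in>T. X \<omega> \<in> a X} | T a. finite T \<and> T \<subseteq> C \<and> (\<forall>X. a X \<in> sets (borel :: real measure))}"
  define G2 where "G2 = {{\<omega>\<in>space M. \<forall>j\<in>UNIV. \<xi> \<omega> $ j \<in> b j} | b. \<forall>j. b j \<in> sets (borel :: real measure)}"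
  have mC: "X \<in> borel_measurable M" if "X \<in> C" for X using that C measurable_mem by auto
  have m\<xi>j: "(\<lambda>\<omega>. \<xi> \<omega> $ j) \<in> borel_measurable M" for j by (rule measurable_mem[OF \<xi>])
  note m\<xi> = measurable_vec_lambda_borel[where f = \<xi>]
  have G1e: "G1 \<subseteq> events"
  proof
    fix S assume "S \<in> G1"
    then obtain T a where S: "S = {\<omega>\<in>space M. \<forall>X\<in>T. X \<omega> \<in> a X}" "finite T" "T \<subseteq> C" "\<And>X. a X \<in> sets borel"
      by (auto simp: G1_def)
    have "{\<omega>\<in>space M. X \<omega> \<in> a X} \<in> events" if "X \<in> T" for X
    proof -
      have [measurable]: "X \<in> borel_measurable M" "a X \<in> sets borel" using mC S that by auto
      show ?thesis by measurable
    qed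
    then show "S \<in> events" unfolding S(1) by (intro sets.sets_Collect_finite_All S) 
  qed
  have G2e: "G2 \<subseteq> events"
  proof
    fix S assume "S \<in> G2"
    then obtain b where S: "S = {\<omega>\<in>space M. \<forall>j\<in>UNIV. \<xi> \<omega> $ j \<in> b j}" "\<And>j. b j \<in> sets borel"
      by (auto simp: G2_def)
    note [measurable] = m\<xi>j S(2)
    show "S \<in> events" unfolding S(1) by measurable
  qed
  have i1: "Int_stable G1"
  proof (rule Int_stableI)
    fix S S' assume "S \<in> G1" "S' \<in> G1"
    then obtain T a T' a' where S: "S = {\<omega>\<in>space M. \<forall>X\<in>T. X \<omega> \<in> a X}" "finite T" "T \<subseteq> C" "\<And>X. a X \<in> sets borel"
      and S': "S' = {\<omega>\<in>space M. \<forall>X\<in>T'. X \<omega> \<in> a' X}" "finite T'" "T' \<subseteq> C" "\<And>X. a' X \<in> sets borel"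
      unfolding G1_def by blast
    \<comment> \<open>Factors are padded with \<open>UNIV\<close>, because the two cylinders may
      restrict different variables.\<close>
    let ?c = "\<lambda>X. (if X \<in> T then a X else UNIV) \<inter> (if X \<in> T' then a' X else UNIV)"
    have "S \<inter> S' = {\<omega>\<in>space M. \<forall>X\<in>T \<union> T'. X \<omega> \<in> ?c X}" unfolding S(1) S'(1) by auto
    moreover have "?c X \<in> sets borel" for X using S(4) S'(4) by auto
    ultimately show "S \<inter> S' \<in> G1" unfolding G1_def
      using S(2,3) S'(2,3) by (intro CollectI exI[of _ "T \<union> T'"] exI[of _ ?c]) auto
  qed
  have i2: "Int_stable G2"
  proof (rule Int_stableI)
    fix S S' assume "S \<in> G2" "S' \<in> G2"
    then obtain b b' where S: "S = {\<omega>\<in>space M. \<forall>j\<in>UNIV. \<xi> \<omega> $ j \<in> b j}" "\<And>j. b j \<in> sets borel"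
      and S': "S' = {\<omega>\<in>space M. \<forall>j\<in>UNIV. \<xi> \<omega> $ j \<in> b' j}" "\<And>j. b' j \<in> sets borel"
      unfolding G2_def by blast
    have "S \<inter> S' = {\<omega>\<in>space M. \<forall>j\<in>UNIV. \<xi> \<omega> $ j \<in> b j \<inter> b' j}" unfolding S(1) S'(1) by auto
    then show "S \<inter> S' \<in> G2" unfolding G2_def using S(2) S'(2) by (intro CollectI exI[of _ "\<lambda>j. b j \<inter> b' j"]) auto
  qed
  have "indep_set G1 G2"
  proof (rule indep_setI[OF G1e G2e])
    fix S S' assume "S \<in> G1" "S' \<in> G2"
    then obtain T a b where S: "S = {\<omega>\<in>space M. \<forall>X\<in>T. X \<omega> \<in> a X}" "finite T" "T \<subseteq> C" "\<And>X. a X \<in> sets borel"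
      and S': "S' = {\<omega>\<in>space M. \<forall>j\<in>UNIV. \<xi> \<omega> $ j \<in> b j}" "\<And>j. b j \<in> sets borel"
      unfolding G1_def G2_def by blast
    \<comment> \<open>\<open>T\<close> is a set of random variables and serves as its own index set,
      hence \<open>id\<close>.\<close>
    have "prob {\<omega>\<in>space M. (\<forall>X\<in>T. id X \<omega> \<in> a X) \<and> (\<forall>j\<in>UNIV. \<xi> \<omega> $ j \<in> b j)} =
      prob {\<omega>\<in>space M. \<forall>X\<in>T. id X \<omega> \<in> a X} * prob {\<omega>\<in>space M. \<forall>j\<in>UNIV. \<xi> \<omega> $ j \<in> b j}"
      by (rule prob_inter_uncorrelated) (use S S' C \<xi> cov in auto)
    moreover have "S \<inter> S' = {\<omega>\<in>space M. (\<forall>X\<in>T. id X \<omega> \<in> a X) \<and> (\<forall>j\<in>UNIV. \<xi> \<omega> $ j \<in> b j)}"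
      unfolding S(1) S'(1) by auto
    ultimately show "prob (S \<inter> S') = prob S * prob S'" unfolding S(1) S'(1) by simp
  qed
  from indep_set_sigma_sets[OF this i1 i2]
  have ind: "indep_set (sigma_sets (space M) G1) (sigma_sets (space M) G2)" .
  have gen1: "sets ?F \<subseteq> sigma_sets (space M) G1"
    unfolding sets_generated_sigma
  proof (rule sigma_sets_mono)
    show "{X -` A \<inter> space M | X A. X \<in> C \<and> A \<in> sets borel} \<subseteq> sigma_sets (space M) G1"
    proof safe
      fix X and A :: "real set" assume "X \<in> C" "A \<in> sets borel"
      then have "{\<omega>\<in>space M. \<forall>X'\<in>{X}. X' \<omega> \<in> (\<lambda>_. A) X'} \<in> G1"
        unfolding G1_def by (intro CollectI exI[of _ "{X}"] exI[of _ "\<lambda>_. A"]) auto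
      also have "{\<omega>\<in>space M. \<forall>X'\<in>{X}. X' \<omega> \<in> (\<lambda>_. A) X'} = X -` A \<inter> space M" by auto
      finally show "X -` A \<inter> space M \<in> sigma_sets (space M) G1" by (rule sigma_sets.Basic)
    qed
  qed
  let ?N2 = "sigma (space M) G2"
  have sN2: "sets ?N2 = sigma_sets (space M) G2" by (rule sets_measure_of) (auto simp: G2_def)
  have spN2: "space ?N2 = space M" by (simp add: space_measure_of_conv)
  have "(\<lambda>\<omega>. \<xi> \<omega> $ j) \<in> borel_measurable ?N2" for j
  proof (rule measurableI)
    fix A :: "real set" assume A: "A \<in> sets borel"
    have "{\<omega>\<in>space M. \<forall>i\<in>UNIV. \<xi> \<omega> $ i \<in> (if i = j then A else UNIV)} \<in> G2"
      unfolding G2_def using A by (intro CollectI exI[of _ "\<lambda>i. if i = j then A else UNIV"]) auto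
    also have "{\<omega>\<in>space M. \<forall>i\<in>UNIV. \<xi> \<omega> $ i \<in> (if i = j then A else UNIV)} = (\<lambda>\<omega>. \<xi> \<omega> $ j) -` A \<inter> space ?N2"
      by (auto simp: spN2 split: if_splits)
    finally show "(\<lambda>\<omega>. \<xi> \<omega> $ j) -` A \<inter> space ?N2 \<in> sets ?N2" unfolding sN2 by (rule sigma_sets.Basic)
  qed simp
  then have gen2: "\<xi> -` A \<inter> space M \<in> sigma_sets (space M) G2" if "A \<in> sets borel" for A
    using measurable_sets[OF m\<xi>[of ?N2] that] unfolding sN2 spN2 by simp
  have "sigma_sets (space M) G1 \<subseteq> events" by (rule sets.sigma_sets_subset[OF G1e])
  then show ?thesis1
    using gen1 sets.sets_into_space by (intro measurableI) (auto simp: Int_absorb2)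
  show ?thesis2 by (rule m\<xi>[OF m\<xi>j])
  show "prob (A \<inter> (\<xi> -` B \<inter> space M)) = prob A * prob (\<xi> -` B \<inter> space M)" if "A \<in> sets ?F" "B \<in> sets borel"
    by (rule indep_setD[OF ind]) (use gen1 gen2 that in auto)
qed

text \<open>By independence the pair formed by \<open>\<omega>\<close>, seen through the coarse
  sigma-algebra, and \<open>\<xi> \<omega>\<close> has a product law. Fubini then integrates the
  second argument against the density of \<open>\<xi>\<close> with \<open>\<omega>\<close> held
  fixed.\<close>

lemma nn_integral_uncorrelated:
  fixes \<xi> :: "'w \<Rightarrow> real ^ 'd" and p :: "real ^ 'd \<Rightarrow> ennreal"
  assumes C: "C \<subseteq> H" and \<xi>: "\<And>j. (\<lambda>\<omega>. \<xi> \<omega> $ j) \<in> H"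
    and cov: "\<And>X j. X \<in> C \<Longrightarrow> covariance M X (\<lambda>\<omega>. \<xi> \<omega> $ j) = 0"
    and p: "distributed M lborel \<xi> p"
    and G: "(\<lambda>z. G (fst z) (snd z)) \<in> borel_measurable (generated_sigma (space M) C \<Otimes>\<^sub>M borel)"
  shows "(\<integral>\<^sup>+\<omega>. G \<omega> (\<xi> \<omega>) \<partial>M) = (\<integral>\<^sup>+\<omega>. (\<integral>\<^sup>+x. G \<omega> x * p x \<partial>lborel) \<partial>M)"
proof -
  let ?F = "generated_sigma (space M) C"
  have mF: "(\<lambda>\<omega>. \<omega>) \<in> measurable M ?F"
    by (rule indep_uncorrelated(1)[OF C \<xi> cov])
  have m\<xi> [measurable]: "\<xi> \<in> borel_measurable M"
    by (rule indep_uncorrelated(2)[OF C \<xi> cov])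
  have ind: "prob (A \<inter> (\<xi> -` B \<inter> space M)) = prob A * prob (\<xi> -` B \<inter> space M)"
    if "A \<in> sets ?F" "B \<in> sets borel" for A B
    by (rule indep_uncorrelated(3)[OF C \<xi> cov that])
  have eq: "distr M ?F (\<lambda>\<omega>. \<omega>) \<Otimes>\<^sub>M distr M borel \<xi> = distr M (?F \<Otimes>\<^sub>M borel) (\<lambda>\<omega>. (\<omega>, \<xi> \<omega>))"
  proof (rule pair_measure_eqI)
    show "sigma_finite_measure (distr M ?F (\<lambda>\<omega>. \<omega>))" "sigma_finite_measure (distr M borel \<xi>)"
      using prob_space_distr[OF mF] prob_space_distr[OF m\<xi>] prob_space_imp_sigma_finite by auto
    show "sets (distr M ?F (\<lambda>\<omega>. \<omega>) \<Otimes>\<^sub>M distr M borel \<xi>) = sets (distr M (?F \<Otimes>\<^sub>M borel) (\<lambda>\<omega>. (\<omega>, \<xi> \<omega>)))"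
      by (simp cong: sets_pair_measure_cong)
    fix A B assume "A \<in> sets (distr M ?F (\<lambda>\<omega>. \<omega>))" "B \<in> sets (distr M borel \<xi>)"
    then have A: "A \<in> sets ?F" and B: "B \<in> sets borel" by auto
    have As: "A \<subseteq> space M" using sets.sets_into_space[OF A] by simp
    have "emeasure (distr M (?F \<Otimes>\<^sub>M borel) (\<lambda>\<omega>. (\<omega>, \<xi> \<omega>))) (A \<times> B) = emeasure M (A \<inter> (\<xi> -` B \<inter> space M))"
      using mF m\<xi> A B As by (subst emeasure_distr) (auto intro!: arg_cong2[where f=emeasure])
    also have "\<dots> = emeasure M A * emeasure M (\<xi> -` B \<inter> space M)"
      using ind[OF A B] by (simp add: emeasure_eq_measure ennreal_mult)
    also have "emeasure M A = emeasure (distr M ?F (\<lambda>\<omega>. \<omega>)) A"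
      using A As mF by (simp add: emeasure_distr Int_absorb2)
    also have "emeasure M (\<xi> -` B \<inter> space M) = emeasure (distr M borel \<xi>) B"
      using B m\<xi> by (simp add: emeasure_distr)
    finally show "emeasure (distr M ?F (\<lambda>\<omega>. \<omega>)) A * emeasure (distr M borel \<xi>) B =
        emeasure (distr M (?F \<Otimes>\<^sub>M borel) (\<lambda>\<omega>. (\<omega>, \<xi> \<omega>))) (A \<times> B)" by simp
  qed
  have mp [measurable]: "p \<in> borel_measurable borel" using p by (simp add: distributed_def)
  interpret D: prob_space "distr M borel \<xi>" by (rule prob_space_distr) simp
  have dens: "distr M borel \<xi> = density lborel p"
    using p by (simp add: distributed_def cong: distr_cong)
  have "(\<integral>\<^sup>+\<omega>. G \<omega> (\<xi> \<omega>) \<partial>M) = (\<integral>\<^sup>+z. G (fst z) (snd z) \<partial>distr M (?F \<Otimes>\<^sub>M borel) (\<lambda>\<omega>. (\<omega>, \<xi> \<omega>)))"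
    using G mF by (subst nn_integral_distr) auto
  also have "\<dots> = (\<integral>\<^sup>+z. G (fst z) (snd z) \<partial>(distr M ?F (\<lambda>\<omega>. \<omega>) \<Otimes>\<^sub>M distr M borel \<xi>))"
    by (simp only: eq)
  also have "\<dots> = (\<integral>\<^sup>+\<omega>. (\<integral>\<^sup>+x. G \<omega> x \<partial>distr M borel \<xi>) \<partial>distr M ?F (\<lambda>\<omega>. \<omega>))"
  proof (subst D.nn_integral_fst[symmetric])
    show "(\<lambda>z. G (fst z) (snd z)) \<in> borel_measurable (distr M ?F (\<lambda>\<omega>. \<omega>) \<Otimes>\<^sub>M distr M borel \<xi>)"
      using G by (subst measurable_cong_sets[OF sets_pair_measure_cong refl]) auto
  qed simp
  also have "\<dots> = (\<integral>\<^sup>+\<omega>. (\<integral>\<^sup>+x. G \<omega> x \<partial>distr M borel \<xi>) \<partial>M)"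
  proof (rule nn_integral_distr[OF mF])
    have "(\<lambda>\<omega>. \<integral>\<^sup>+x. (\<lambda>z. G (fst z) (snd z)) (\<omega>, x) \<partial>distr M borel \<xi>) \<in> borel_measurable ?F"
    proof (rule D.borel_measurable_nn_integral_fst)
      show "(\<lambda>z. G (fst z) (snd z)) \<in> borel_measurable (?F \<Otimes>\<^sub>M distr M borel \<xi>)"
        using G by (subst measurable_cong_sets[OF sets_pair_measure_cong refl]) auto
    qed
    then show "(\<lambda>\<omega>. \<integral>\<^sup>+x. G \<omega> x \<partial>distr M borel \<xi>) \<in> borel_measurable (distr M ?F (\<lambda>\<omega>. \<omega>))" by simp
  qed
  also have "\<dots> = (\<integral>\<^sup>+\<omega>. (\<integral>\<^sup>+x. G \<omega> x * p x \<partial>lborel) \<partial>M)"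
  proof (rule nn_integral_cong)
    fix \<omega> assume "\<omega> \<in> space M"
    then have "(\<lambda>x. (\<lambda>z. G (fst z) (snd z)) (\<omega>, x)) \<in> borel_measurable borel"
      by (intro measurable_compose[OF measurable_Pair1' G]) simp
    then show "(\<integral>\<^sup>+x. G \<omega> x \<partial>distr M borel \<xi>) = (\<integral>\<^sup>+x. G \<omega> x * p x \<partial>lborel)"
      unfolding dens by (subst nn_integral_density) (auto simp: mult.commute)
  qed
  finally show ?thesis .
qed

end

section \<open>The density of a nondegenerate Gaussian vector\<close>

lemma std_normal_density_le_1: "std_normal_density x \<le> 1"
proof -
  have "1 \<le> sqrt (2 * pi)" using pi_ge_two by (auto simp: real_le_rsqrt)
  then have "1 / sqrt (2 * pi) \<le> 1" by simp
  then have "1 / sqrt (2 * pi) * exp (- x\<^sup>2 / 2) \<le> 1 * 1" by (intro mult_mono) auto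
  then show ?thesis by (simp add: std_normal_density_def)
qed

lemma measure_eqI_box:
  fixes M N :: "'a::euclidean_space measure"
  assumes "finite_measure M" "sets M = sets borel" "sets N = sets borel"
    and eq: "\<And>l u. emeasure M (box l u) = emeasure N (box l u)"
  shows "M = N"
proof (rule measure_eqI_generator_eq)
  let ?E = "range (\<lambda>(a, b). box a b::'a set)"
  show "Int_stable ?E"
    by (auto simp: Int_stable_def box_Int_box)
  show "?E \<subseteq> Pow UNIV" "sets M = sigma_sets UNIV ?E" "sets N = sigma_sets UNIV ?E"
    by (simp_all add: borel_eq_box assms)
  let ?A = "\<lambda>n::nat. box (- (real n *\<^sub>R One)) (real n *\<^sub>R One) :: 'a set"
  show "range ?A \<subseteq> ?E" "(\<Union>i. ?A i) = UNIV"
    unfolding UN_box_eq_UNIV by auto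
  show "emeasure M (?A i) \<noteq> \<infinity>" for i using finite_measure.emeasure_finite[OF assms(1)] by simp
  show "emeasure M X = emeasure N X" if "X \<in> ?E" for X
    using that eq by auto
qed

lemma symmetric_dot:
  assumes "transpose V = (V :: real ^ 'd ^ 'd)"
  shows "x \<bullet> (V *v y) = y \<bullet> (V *v x)"
proof -
  have "x \<bullet> (V *v y) = (x v* transpose V) \<bullet> y"
    unfolding assms by (rule dot_lmul_matrix[symmetric])
  also have "\<dots> = y \<bullet> (V *v x)"
    by (simp add: vector_transpose_matrix inner_commute)
  finally show ?thesis .
qed

text \<open>Gram-Schmidt for the inner product defined by \<open>V\<close>, run on the standard
  axes. The support condition is the induction invariant: it gives the residual \<open>w\<close> the
  \<open>k\<close>-th coordinate 1, so that \<open>w\<close> is nonzero and can be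
  normalised.\<close>

lemma gram_schmidt_positive_definite:
  fixes V :: "real ^ 'd ^ 'd" and S :: "'d set"
  assumes V: "positive_definite V"
  shows "\<exists>v. (\<forall>i\<in>S. \<forall>j\<in>S. v i \<bullet> (V *v v j) = (if i = j then 1 else 0)) \<and> (\<forall>i\<in>S. \<forall>j. j \<notin> S \<longrightarrow> v i $ j = 0)"
proof -
  have sym: "x \<bullet> (V *v y) = y \<bullet> (V *v x)" for x y
    using V symmetric_dot unfolding positive_definite_def by blast
  have "finite S" by simp
  then show ?thesis
  proof (induction S rule: finite_induct)
    case (insert k S)
    then obtain v where v: "\<And>i j. i \<in> S \<Longrightarrow> j \<in> S \<Longrightarrow> v i \<bullet> (V *v v j) = (if i = j then 1 else 0)"
      and v0: "\<And>i j. i \<in> S \<Longrightarrow> j \<notin> S \<Longrightarrow> v i $ j = 0" by blast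
    define w where "w = axis k 1 - (\<Sum>i\<in>S. (v i \<bullet> (V *v axis k 1)) *\<^sub>R v i)"
    have wk: "w $ k = 1" using v0 insert.hyps by (simp add: w_def)
    then have "w \<noteq> 0" by (metis zero_index zero_neq_one)
    then have ww: "0 < w \<bullet> (V *v w)" using V unfolding positive_definite_def by blast
    have vw: "v j \<bullet> (V *v w) = 0" if "j \<in> S" for j
    proof -
      have "v j \<bullet> (V *v w) = v j \<bullet> (V *v axis k 1) - (\<Sum>i\<in>S. (v i \<bullet> (V *v axis k 1)) * (v j \<bullet> (V *v v i)))"
        unfolding w_def
        by (simp add: linear_diff[OF matrix_vector_mul_linear] linear_sum[OF matrix_vector_mul_linear]
            linear_cmul[OF matrix_vector_mul_linear] inner_diff_right inner_sum_right)
      also have "(\<Sum>i\<in>S. (v i \<bullet> (V *v axis k 1)) * (v j \<bullet> (V *v v i))) = (\<Sum>i\<in>S. if i = j then v j \<bullet> (V *v axis k 1) else 0)"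
        by (rule sum.cong) (use v that in auto)
      also have "\<dots> = v j \<bullet> (V *v axis k 1)" using that insert.hyps by simp
      finally show ?thesis by simp
    qed
    define c where "c = 1 / sqrt (w \<bullet> (V *v w))"
    have c: "c * c * (w \<bullet> (V *v w)) = 1" using ww by (simp add: c_def)
    have cw: "V *v (c *\<^sub>R x) = c *\<^sub>R (V *v x)" for c x
      by (rule linear_cmul[OF matrix_vector_mul_linear])
    have w0: "w $ j = 0" if "j \<notin> insert k S" for j
      using that v0 by (simp add: w_def axis_def)
    show ?case
    proof (intro exI[of _ "v(k := c *\<^sub>R w)"] conjI ballI allI impI)
      fix i j assume ij: "i \<in> insert k S" "j \<in> insert k S"
      show "(v(k := c *\<^sub>R w)) i \<bullet> (V *v (v(k := c *\<^sub>R w)) j) = (if i = j then 1 else 0)"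
      proof (cases "i = k")
        case True
        show ?thesis
        proof (cases "j = k")
          case True
          then show ?thesis using \<open>i = k\<close> c by (simp add: cw mult.assoc)
        next
          case False
          then have "j \<in> S" using ij by simp
          have "w \<bullet> (V *v v j) = 0"
            unfolding sym[of w "v j"] by (rule vw[OF \<open>j \<in> S\<close>])
          then show ?thesis using \<open>i = k\<close> False by simp
        qed
      next
        case False
        then have "i \<in> S" using ij by simp
        show ?thesis
        proof (cases "j = k")
          case True
          then show ?thesis using False vw[OF \<open>i \<in> S\<close>] by (simp add: cw)
        next
          case jk: False
          then have "j \<in> S" using ij by simp
          then show ?thesis using False jk v[OF \<open>i \<in> S\<close>] by simp
        qed
      qed
    next
      fix i j assume "i \<in> insert k S" "j \<notin> insert k S"
      then show "(v(k := c *\<^sub>R w)) i $ j = 0"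
        using w0 v0 insert.hyps by auto
    qed
  qed auto
qed

context gaussian_space
begin

lemma distr_standard_gaussian:
  assumes "X \<in> H" "expectation X = 0" "covariance M X X = 1"
  shows "distr M borel X = std_normal_distribution"
proof (rule Levy_uniqueness)
  have [measurable]: "X \<in> borel_measurable M" using assms measurable_mem by blast
  show "real_distribution (distr M borel X)" by (rule real_distribution_distr) simp
  show "real_distribution std_normal_distribution" by (rule real_dist_normal_dist)
  have "char (distr M borel X) s = (CLINT \<omega>|M. iexp (s * X \<omega>))" for s
    unfolding char_def by (subst integral_distr) auto
  also have "\<dots> s = char std_normal_distribution s" for s
    unfolding gaussian_rv_char[OF gaussian[OF assms(1)]] variance_eq_covariance unfolding assms(2,3)
    by (simp add: char_std_normal_distribution)
  finally show "char (distr M borel X) = char std_normal_distribution" by auto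
qed

lemma prob_independent_family:
  fixes X :: "'i \<Rightarrow> 'w \<Rightarrow> real"
  assumes "finite S" and X: "\<And>i. i \<in> S \<Longrightarrow> X i \<in> H"
    and cov: "\<And>i j. i \<in> S \<Longrightarrow> j \<in> S \<Longrightarrow> i \<noteq> j \<Longrightarrow> covariance M (X i) (X j) = 0"
    and A: "\<And>i. i \<in> S \<Longrightarrow> A i \<in> sets borel"
  shows "prob {\<omega>\<in>space M. \<forall>i\<in>S. X i \<omega> \<in> A i} = (\<Prod>i\<in>S. prob {\<omega>\<in>space M. X i \<omega> \<in> A i})"
  using assms
proof (induction S rule: finite_induct)
  case (insert k S)
  have "{\<omega>\<in>space M. \<forall>i\<in>insert k S. X i \<omega> \<in> A i} =
     {\<omega>\<in>space M. (\<forall>i\<in>{k}. X i \<omega> \<in> A i) \<and> (\<forall>i\<in>S. X i \<omega> \<in> A i)}" by auto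
  also have "prob \<dots> = prob {\<omega>\<in>space M. \<forall>i\<in>{k}. X i \<omega> \<in> A i} * prob {\<omega>\<in>space M. \<forall>i\<in>S. X i \<omega> \<in> A i}"
    by (rule prob_inter_uncorrelated) (use insert in auto)
  finally show ?case using insert by simp
qed (simp add: prob_space)

lemma distr_standard_gaussian_vector:
  fixes \<eta> :: "'w \<Rightarrow> real ^ 'd"
  assumes \<eta>: "\<And>i. (\<lambda>\<omega>. \<eta> \<omega> $ i) \<in> H" "\<And>i. expectation (\<lambda>\<omega>. \<eta> \<omega> $ i) = 0"
    and cov: "\<And>i j. covariance M (\<lambda>\<omega>. \<eta> \<omega> $ i) (\<lambda>\<omega>. \<eta> \<omega> $ j) = (if i = j then 1 else 0)"
  shows "distr M borel \<eta> = density lborel (\<lambda>y. ennreal (\<Prod>i\<in>UNIV. std_normal_density (y $ i)))"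
proof (rule measure_eqI_box)
  have m\<eta> [measurable]: "\<eta> \<in> borel_measurable M"
    by (rule measurable_vec_lambda_borel) (rule measurable_mem[OF \<eta>(1)])
  show "finite_measure (distr M borel \<eta>)"
    using prob_space_distr[OF m\<eta>] prob_space.finite_measure by blast
  fix l u :: "real ^ 'd"
  have "emeasure (distr M borel \<eta>) (box l u) = prob {\<omega>\<in>space M. \<forall>i\<in>UNIV. \<eta> \<omega> $ i \<in> {l $ i<..<u $ i}}"
    by (subst emeasure_distr) (auto simp: emeasure_eq_measure mem_box_cart intro!: arg_cong[where f=prob])
  also have "\<dots> = (\<Prod>i\<in>UNIV. prob {\<omega>\<in>space M. \<eta> \<omega> $ i \<in> {l $ i<..<u $ i}})"
    using \<eta> cov by (subst prob_independent_family) auto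
  also have "\<dots> = (\<Prod>i\<in>UNIV. emeasure std_normal_distribution {l $ i<..<u $ i})"
  proof (subst prod_ennreal[symmetric], simp, rule prod.cong[OF refl])
    fix i
    have "ennreal (prob {\<omega>\<in>space M. \<eta> \<omega> $ i \<in> {l $ i<..<u $ i}}) = emeasure (distr M borel (\<lambda>\<omega>. \<eta> \<omega> $ i)) {l $ i<..<u $ i}"
      using measurable_mem[OF \<eta>(1)[of i]]
      by (subst emeasure_distr) (auto simp: emeasure_eq_measure intro!: arg_cong[where f=prob])
    also have "distr M borel (\<lambda>\<omega>. \<eta> \<omega> $ i) = std_normal_distribution"
      by (rule distr_standard_gaussian) (use \<eta> cov in auto)
    finally show "ennreal (prob {\<omega>\<in>space M. \<eta> \<omega> $ i \<in> {l $ i<..<u $ i}}) = emeasure std_normal_distribution {l $ i<..<u $ i}" .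
  qed
  also have "\<dots> = (\<Prod>b\<in>(Basis :: (real^'d) set). \<integral>\<^sup>+x. ennreal (std_normal_density x) * indicator {l \<bullet> b<..<u \<bullet> b} x \<partial>lborel)"
    unfolding prod_Basis_cart by (simp add: emeasure_density inner_axis)
  also have "\<dots> = (\<integral>\<^sup>+y. (\<Prod>b\<in>(Basis :: (real^'d) set). ennreal (std_normal_density (y \<bullet> b)) * indicator {l \<bullet> b<..<u \<bullet> b} (y \<bullet> b)) \<partial>lborel)"
    by (rule nn_integral_lborel_prod[symmetric]) auto
  also have "\<dots> = (\<integral>\<^sup>+y. ennreal (\<Prod>i\<in>UNIV. std_normal_density (y $ i)) * indicator (box l u) y \<partial>lborel)"
  proof (rule nn_integral_cong)
    fix y :: "real ^ 'd"
    have "(\<Prod>b\<in>(Basis :: (real^'d) set). ennreal (std_normal_density (y \<bullet> b)) * indicator {l \<bullet> b<..<u \<bullet> b} (y \<bullet> b)) =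
      (\<Prod>i\<in>UNIV. ennreal (std_normal_density (y $ i))) * (\<Prod>i\<in>UNIV. indicator {l $ i<..<u $ i} (y $ i))"
      unfolding prod_Basis_cart by (simp add: inner_axis prod.distrib)
    also have "(\<Prod>i\<in>UNIV. indicator {l $ i<..<u $ i} (y $ i) :: ennreal) = indicator (box l u) y"
    proof (cases "y \<in> box l u")
      case False
      then obtain i where "y $ i \<notin> {l $ i<..<u $ i}" by (auto simp: mem_box_cart)
      then have "indicator {l $ i<..<u $ i} (y $ i) = (0::ennreal)" by simp
      then show ?thesis using False prod_zero[of UNIV "\<lambda>i. indicator {l $ i<..<u $ i} (y $ i) :: ennreal"] by fastforce
    qed (auto simp: mem_box_cart)
    also have "(\<Prod>i\<in>UNIV. ennreal (std_normal_density (y $ i))) = ennreal (\<Prod>i\<in>UNIV. std_normal_density (y $ i))"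
      by (rule prod_ennreal) simp
    finally show "(\<Prod>b\<in>(Basis :: (real^'d) set). ennreal (std_normal_density (y \<bullet> b)) * indicator {l \<bullet> b<..<u \<bullet> b} (y \<bullet> b)) =
      ennreal (\<Prod>i\<in>UNIV. std_normal_density (y $ i)) * indicator (box l u) y" .
  qed
  also have "\<dots> = emeasure (density lborel (\<lambda>y. ennreal (\<Prod>i\<in>UNIV. std_normal_density (y $ i)))) (box l u)"
    by (subst emeasure_density) auto
  finally show "emeasure (distr M borel \<eta>) (box l u) = emeasure (density lborel (\<lambda>y. ennreal (\<Prod>i\<in>UNIV. std_normal_density (y $ i)))) (box l u)" .
qed auto

lemma covariance_inner:
  fixes \<xi> :: "'w \<Rightarrow> real ^ 'n"
  assumes \<xi>: "\<And>j. (\<lambda>\<omega>. \<xi> \<omega> $ j) \<in> H"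
  shows "covariance M (\<lambda>\<omega>. a \<bullet> \<xi> \<omega>) (\<lambda>\<omega>. b \<bullet> \<xi> \<omega>) = a \<bullet> (var_matrix M \<xi> *v b)"
proof -
  have m: "(\<lambda>\<omega>. \<Sum>j\<in>UNIV. b $ j * \<xi> \<omega> $ j) \<in> H" for b by (intro H_intros \<xi>)
  have "covariance M (\<lambda>\<omega>. a \<bullet> \<xi> \<omega>) (\<lambda>\<omega>. b \<bullet> \<xi> \<omega>) =
     (\<Sum>i\<in>UNIV. a $ i * covariance M (\<lambda>\<omega>. \<xi> \<omega> $ i) (\<lambda>\<omega>. \<Sum>j\<in>UNIV. b $ j * \<xi> \<omega> $ j))"
    unfolding inner_vec_def inner_real_def
    by (subst covariance_sum) (auto intro!: H_intros \<xi> simp: covariance_scale[OF \<xi> m])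
  also have "\<dots> = (\<Sum>i\<in>UNIV. a $ i * (\<Sum>j\<in>UNIV. b $ j * covariance M (\<lambda>\<omega>. \<xi> \<omega> $ i) (\<lambda>\<omega>. \<xi> \<omega> $ j)))"
  proof (rule sum.cong[OF refl])
    fix i
    have "covariance M (\<lambda>\<omega>. \<xi> \<omega> $ i) (\<lambda>\<omega>. \<Sum>j\<in>UNIV. b $ j * \<xi> \<omega> $ j) = (\<Sum>j\<in>UNIV. b $ j * covariance M (\<lambda>\<omega>. \<xi> \<omega> $ j) (\<lambda>\<omega>. \<xi> \<omega> $ i))"
      by (subst covariance_commute, subst covariance_sum) (auto intro!: H_intros \<xi> simp: covariance_scale[OF \<xi> \<xi>])
    then show "a $ i * covariance M (\<lambda>\<omega>. \<xi> \<omega> $ i) (\<lambda>\<omega>. \<Sum>j\<in>UNIV. b $ j * \<xi> \<omega> $ j) =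
      a $ i * (\<Sum>j\<in>UNIV. b $ j * covariance M (\<lambda>\<omega>. \<xi> \<omega> $ i) (\<lambda>\<omega>. \<xi> \<omega> $ j))"
      by (simp add: covariance_commute)
  qed
  also have "\<dots> = a \<bullet> (var_matrix M \<xi> *v b)"
    by (simp add: inner_vec_def matrix_vector_mult_def var_matrix_def cov_matrix_nth mult.commute)
  finally show ?thesis .
qed

text \<open>The rows of \<open>L\<close> whiten the vector: \<open>T\<close> maps it to one with
  uncorrelated standard components, whose density \<open>\<Phi>\<close> is a product. Pulling
  \<open>\<Phi>\<close> back along the affine map \<open>T\<close> multiplies it by
  \<open>\<bar>det L\<bar>\<close>, which is also the bound \<open>K\<close> because
  \<open>\<Phi> \<le> 1\<close>.\<close>

lemma gaussian_vector_density:
  fixes \<xi> :: "'w \<Rightarrow> real ^ 'd"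
  assumes \<xi>: "\<And>j. (\<lambda>\<omega>. \<xi> \<omega> $ j) \<in> H" and V: "positive_definite (var_matrix M \<xi>)"
  shows "\<exists>p K. continuous_on UNIV p \<and> (\<forall>x. 0 \<le> p x \<and> p x \<le> K) \<and> integrable lborel p \<and>
    distributed M lborel \<xi> (\<lambda>x. ennreal (p x))"
proof -
  obtain v :: "'d \<Rightarrow> real ^ 'd" where v: "\<And>i j. v i \<bullet> (var_matrix M \<xi> *v v j) = (if i = j then 1 else 0)"
    using gram_schmidt_positive_definite[OF V, of UNIV] by auto
  define L where "L = (\<chi> i. v i)"
  define m where "m = (\<chi> i. expectation (\<lambda>\<omega>. \<xi> \<omega> $ i))"
  define T where "T x = L *v (x - m)" for x
  define \<Phi> where "\<Phi> y = (\<Prod>i\<in>UNIV. std_normal_density (y $ i))" for y :: "real ^ 'd"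
  have m\<xi> [measurable]: "\<xi> \<in> borel_measurable M"
    by (rule measurable_vec_lambda_borel) (rule measurable_mem[OF \<xi>])
  have Tn: "T x $ i = v i \<bullet> x - v i \<bullet> m" for x i
    by (simp add: T_def L_def matrix_vector_mul_component inner_diff_right)
  have vx: "(\<lambda>\<omega>. v i \<bullet> \<xi> \<omega>) \<in> H" for i
    unfolding inner_vec_def inner_real_def by (intro H_intros \<xi>)
  have TH: "(\<lambda>\<omega>. T (\<xi> \<omega>) $ i) \<in> H" for i unfolding Tn by (intro H_intros vx)
  have T0: "expectation (\<lambda>\<omega>. T (\<xi> \<omega>) $ i) = 0" for i
  proof -
    have "expectation (\<lambda>\<omega>. v i \<bullet> \<xi> \<omega>) = v i \<bullet> m"
      unfolding inner_vec_def inner_real_def m_def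
      by (subst Bochner_Integration.integral_sum) (auto intro!: integrable_mem H_intros \<xi>)
    then show ?thesis unfolding Tn using integrable_mem[OF vx] by (simp add: prob_space)
  qed
  have Tc: "covariance M (\<lambda>\<omega>. T (\<xi> \<omega>) $ i) (\<lambda>\<omega>. T (\<xi> \<omega>) $ j) = (if i = j then 1 else 0)" for i j
  proof -
    have d: "covariance M (\<lambda>\<omega>. X \<omega> - c) Y = covariance M X Y" if "X \<in> H" "Y \<in> H" for X Y c
      using that by (simp add: covariance_diff const_mem covariance_const)
    have "covariance M (\<lambda>\<omega>. T (\<xi> \<omega>) $ i) (\<lambda>\<omega>. T (\<xi> \<omega>) $ j) = covariance M (\<lambda>\<omega>. v i \<bullet> \<xi> \<omega>) (\<lambda>\<omega>. T (\<xi> \<omega>) $ j)"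
      unfolding Tn by (rule d[OF vx]) (intro H_intros vx)
    also have "\<dots> = covariance M (\<lambda>\<omega>. v j \<bullet> \<xi> \<omega>) (\<lambda>\<omega>. v i \<bullet> \<xi> \<omega>)"
      unfolding Tn by (subst covariance_commute) (rule d[OF vx vx])
    also have "\<dots> = (if i = j then 1 else 0)" unfolding covariance_inner[OF \<xi>] v by auto
    finally show ?thesis .
  qed
  have dT: "distr M borel (\<lambda>\<omega>. T (\<xi> \<omega>)) = density lborel (\<lambda>y. ennreal (\<Phi> y))"
    unfolding \<Phi>_def by (rule distr_standard_gaussian_vector[OF TH T0 Tc])
  \<comment> \<open>Orthonormality of the rows for the variance form, read as a matrix identity; it
    forces \<open>det L\<close> to be nonzero.\<close>
  have "L ** (var_matrix M \<xi> ** transpose L) = mat 1"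
  proof -
    have "(L ** (var_matrix M \<xi> ** transpose L)) $ i $ j = v i \<bullet> (var_matrix M \<xi> *v v j)" for i j
      by (simp add: matrix_matrix_mult_def inner_vec_def matrix_vector_mult_def L_def transpose_def)
    then show ?thesis by (simp add: vec_eq_iff mat_def v)
  qed
  then have "det L * det (var_matrix M \<xi> ** transpose L) = 1" by (metis det_I det_mul)
  then have detL: "det L \<noteq> 0" by auto
  then have injL: "inj ((*v) L)" by (simp add: inj_matrix_vector_mult invertible_det_nz)
  have injT: "inj T" unfolding T_def inj_on_def by (auto dest: injD[OF injL])
  have contT: "continuous_on S T" for S unfolding T_def
    by (intro continuous_intros matrix_vector_mult_linear_continuous_on[THEN continuous_on_compose2]) auto
  have derT: "(T has_derivative (\<lambda>h. L *v h)) (at x within S)" for x S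
  proof -
    have "((\<lambda>x. L *v (x - m)) has_derivative (\<lambda>h. L *v (h - 0))) (at x within S)"
      by (rule bounded_linear.has_derivative[OF matrix_vector_mul_bounded_linear]) (intro derivative_intros)
    then show ?thesis by (simp add: T_def[abs_def])
  qed
  have cn: "continuous_on A std_normal_density" for A
    unfolding normal_density_def by (intro continuous_intros) auto
  have cont\<Phi>: "continuous_on UNIV \<Phi>"
    unfolding \<Phi>_def[abs_def] by (intro continuous_intros continuous_on_compose2[OF cn]) auto
  have \<Phi>0: "0 \<le> \<Phi> y" and \<Phi>1: "\<Phi> y \<le> 1" for y
    unfolding \<Phi>_def by (auto intro!: prod_nonneg prod_le_1 std_normal_density_le_1)
  have [measurable]: "\<Phi> \<in> borel_measurable borel" "T \<in> borel_measurable borel"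
    using cont\<Phi> contT borel_measurable_continuous_onI by auto
  interpret DT: prob_space "density lborel (\<lambda>y. ennreal (\<Phi> y))"
    unfolding dT[symmetric] by (rule prob_space_distr) measurable
  have int1: "(\<integral>\<^sup>+y. ennreal (\<Phi> y) \<partial>lborel) = 1"
    using DT.emeasure_space_1 by (simp add: emeasure_density cong: nn_integral_cong)
  have int\<Phi>: "integrable lborel \<Phi>"
    by (rule integrableI_nonneg) (auto simp: \<Phi>0 int1)
  define p where "p x = \<bar>det L\<bar> * \<Phi> (T x)" for x
  have contp: "continuous_on UNIV p"
    unfolding p_def[abs_def] by (intro continuous_intros continuous_on_compose2[OF cont\<Phi> contT]) auto
  have p0: "0 \<le> p x" and pK: "p x \<le> \<bar>det L\<bar>" for x
    using \<Phi>0 \<Phi>1 by (auto simp: p_def mult_left_le)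
  have [measurable]: "p \<in> borel_measurable borel" by (rule borel_measurable_continuous_onI[OF contp])
  have dens: "distr M borel \<xi> = density lborel (\<lambda>x. ennreal (p x))"
  proof (rule measure_eqI_box)
    show "finite_measure (distr M borel \<xi>)"
      using prob_space_distr[OF m\<xi>] prob_space.finite_measure by blast
    fix l u :: "real ^ 'd"
    have fT: "fsigma (T ` box l u)" by (intro fsigma_continuous_image open_imp_fsigma contT open_box)
    note fTm [measurable] = fsigma_imp_borel[OF fT]
    have "emeasure (distr M borel \<xi>) (box l u) = emeasure M (\<xi> -` box l u \<inter> space M)"
      by (rule emeasure_distr) auto
    also have "\<xi> -` box l u \<inter> space M = (\<lambda>\<omega>. T (\<xi> \<omega>)) -` (T ` box l u) \<inter> space M"
      using injT by (auto dest: injD)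
    also have "emeasure M \<dots> = emeasure (distr M borel (\<lambda>\<omega>. T (\<xi> \<omega>))) (T ` box l u)"
      by (rule emeasure_distr[symmetric]) auto
    also have "\<dots> = (\<integral>\<^sup>+y\<in>T ` box l u. ennreal (\<Phi> y) \<partial>lborel)"
      unfolding dT by (rule emeasure_density) auto
    also have "\<dots> = (\<integral>\<^sup>+x\<in>box l u. ennreal (\<bar>det L\<bar> * \<Phi> (T x)) \<partial>lborel)"
      by (rule nn_integral_change_of_variables)
         (use derT injT int\<Phi> cont\<Phi> \<Phi>0 in \<open>auto intro: open_imp_fsigma inj_on_subset\<close>)
    also have "\<dots> = emeasure (density lborel (\<lambda>x. ennreal (p x))) (box l u)"
      by (subst emeasure_density) (auto simp: p_def)
    finally show "emeasure (distr M borel \<xi>) (box l u) = emeasure (density lborel (\<lambda>x. ennreal (p x))) (box l u)" .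
  qed auto
  have dist: "distributed M lborel \<xi> (\<lambda>x. ennreal (p x))"
    using dens unfolding distributed_def by (auto cong: distr_cong)
  interpret DX: prob_space "density lborel (\<lambda>x. ennreal (p x))"
    unfolding dens[symmetric] by (rule prob_space_distr) measurable
  have "(\<integral>\<^sup>+y. ennreal (p y) \<partial>lborel) = 1"
    using DX.emeasure_space_1 by (simp add: emeasure_density cong: nn_integral_cong)
  then have "integrable lborel p"
    by (intro integrableI_nonneg) (auto simp: p0)
  then show ?thesis using contp p0 pK dist by blast
qed

end

text \<open>Two continuous densities agree almost everywhere, so the set where they differ is open
  and null, hence empty.\<close>

lemma (in prob_space) density_at_eq:
  fixes X :: "'a \<Rightarrow> real ^ 'n"
  assumes p: "continuous_on UNIV p" "\<And>x. 0 \<le> p x" "distributed M lborel X (\<lambda>x. ennreal (p x))"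
  shows "density_at M X = p"
  unfolding density_at_def
proof (rule the_equality)
  fix q assume q: "continuous_on UNIV q \<and> (\<forall>x. 0 \<le> q x) \<and> distributed M lborel X (\<lambda>x. ennreal (q x))"
  have "AE x in lborel. ennreal (p x) = ennreal (q x)"
    by (rule distributed_unique) (use p q in auto)
  then have "AE x in lborel. p x = q x"
    by eventually_elim (use p(2) q in simp)
  then obtain N where N: "{x \<in> space lborel. p x \<noteq> q x} \<subseteq> N" "emeasure lborel N = 0" "N \<in> sets lborel"
    by (rule AE_E)
  then have "N \<in> null_sets lebesgue" by (auto intro: null_sets_completionI)
  then have "negligible {x. p x \<noteq> q x}"
    using N(1) negligible_subset[of N] by (simp add: negligible_iff_null_sets)
  moreover have "open {x. p x \<noteq> q x}"
    using p(1) q by (intro open_Collect_neq) auto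
  ultimately have "{x. p x \<noteq> q x} = {}" using open_not_negligible by blast
  then show "q = p" by auto
qed (use p in auto)

section \<open>Smooth Gaussian fields\<close>

lemma matrix_inv_mult:
  fixes A :: "real ^ 'd ^ 'd"
  assumes "inj ((*v) A)"
  shows "A ** matrix_inv A = mat 1" "matrix_inv A ** A = mat 1"
proof -
  obtain B where "B ** A = mat 1" using assms matrix_left_invertible_injective by blast
  moreover then have "A ** B = mat 1" by (simp add: matrix_left_right_inverse)
  ultimately have "\<exists>B. A ** B = mat 1 \<and> B ** A = mat 1" by blast
  then have "A ** matrix_inv A = mat 1 \<and> matrix_inv A ** A = mat 1"
    unfolding matrix_inv_def by (rule someI_ex)
  then show "A ** matrix_inv A = mat 1" "matrix_inv A ** A = mat 1" by auto
qed

lemma inj_positive_definite: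
  fixes V :: "real ^ 'd ^ 'd"
  assumes "positive_definite V"
  shows "inj ((*v) V)"
proof (rule injI)
  fix x y assume "V *v x = V *v y"
  then have "V *v (x - y) = 0" by (simp add: matrix_vector_mult_diff_distrib)
  then have "(x - y) \<bullet> (V *v (x - y)) = 0" by simp
  then show "x = y" using assms unfolding positive_definite_def by (metis eq_iff_diff_eq_0 less_irrefl)
qed

lemma inj_of_norm_le:
  fixes A :: "real ^ 'd ^ 'd"
  assumes "\<And>x. norm x \<le> c * norm (A *v x)"
  shows "inj ((*v) A)"
proof (rule injI)
  fix x y assume "A *v x = A *v y"
  then have "A *v (x - y) = 0" by (simp add: matrix_vector_mult_diff_distrib)
  then show "x = y" using assms[of "x - y"] by simp
qed

lemma continuous_on_of_local_Lipschitz: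
  fixes f :: "'a::metric_space \<Rightarrow> 'b::metric_space"
  assumes "\<And>t. t \<in> S \<Longrightarrow> \<exists>e>0. \<exists>C. \<forall>s\<in>S. dist s t < e \<longrightarrow> dist (f s) (f t) \<le> C * dist s t"
  shows "continuous_on S f"
  unfolding continuous_on_iff
proof (intro ballI allI impI)
  fix t and r :: real assume t: "t \<in> S" and r: "0 < r"
  obtain e C where e: "e > 0" "\<And>s. s \<in> S \<Longrightarrow> dist s t < e \<Longrightarrow> dist (f s) (f t) \<le> C * dist s t"
    using assms[OF t] by blast
  \<comment> \<open>\<open>C\<close> may be zero or negative; \<open>\<bar>C\<bar> + 1\<close> is a
    safe positive substitute.\<close>
  have "dist (f s) (f t) < r" if "s \<in> S" "dist s t < min e (r / (\<bar>C\<bar> + 1))" for s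
  proof -
    have "dist (f s) (f t) \<le> C * dist s t" using e that by auto
    also have "\<dots> \<le> (\<bar>C\<bar> + 1) * dist s t" by (intro mult_right_mono) auto
    also have "\<dots> < r" using that(2) by (simp add: pos_less_divide_eq mult.commute)
    finally show ?thesis .
  qed
  then show "\<exists>d>0. \<forall>x'\<in>S. dist x' t < d \<longrightarrow> dist (f x') (f t) < r"
    using e(1) r by (intro exI[of _ "min e (r / (\<bar>C\<bar> + 1))"]) auto
qed

section \<open>Uniform moment bounds and linear regression\<close>

context gaussian_space
begin

text \<open>The bound may depend on the sample point and the index set may be uncountable: unbounded
  second moments would already be visible along a sequence, against
  \<open>gaussian_seq_bounded\<close>.\<close>

lemma second_moment_bounded:
  assumes W: "\<And>t. t \<in> S \<Longrightarrow> W t \<in> H"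
    and bdd: "\<And>\<omega>. \<omega> \<in> space M \<Longrightarrow> \<exists>C. \<forall>t\<in>S. \<bar>W t \<omega>\<bar> \<le> C"
  shows "\<exists>C. \<forall>t\<in>S. expectation (\<lambda>\<omega>. (W t \<omega>)\<^sup>2) \<le> C"
proof (rule ccontr)
  assume "\<not> ?thesis"
  then have "\<forall>n::nat. \<exists>t\<in>S. real n < expectation (\<lambda>\<omega>. (W t \<omega>)\<^sup>2)" by (meson not_le)
  then obtain t where t: "\<And>n. t n \<in> S" "\<And>n::nat. real n < expectation (\<lambda>\<omega>. (W (t n) \<omega>)\<^sup>2)" by metis
  have "\<exists>C. \<forall>n. expectation (\<lambda>\<omega>. (W (t n) \<omega>)\<^sup>2) \<le> C"
  proof (rule gaussian_seq_bounded)
    show "gaussian_rv M (W (t n))" for n using W t gaussian by blast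
    show "AE \<omega> in M. \<exists>B. \<forall>n. \<bar>W (t n) \<omega>\<bar> \<le> B"
      by (rule AE_I2) (use bdd t(1) in blast)
  qed
  then obtain C where "\<And>n. expectation (\<lambda>\<omega>. (W (t n) \<omega>)\<^sup>2) \<le> C" by blast
  moreover obtain n :: nat where "C < n" using reals_Archimedean2 by blast
  ultimately show False using t(2)[of n] by (meson less_le_trans not_less_iff_gr_or_eq order.strict_trans)
qed

lemma covariance_bounded:
  assumes W: "\<And>t. t \<in> S \<Longrightarrow> W t \<in> H" and X: "X \<in> H"
    and bdd: "\<And>\<omega>. \<omega> \<in> space M \<Longrightarrow> \<exists>C. \<forall>t\<in>S. \<bar>W t \<omega>\<bar> \<le> C"
  shows "\<exists>C. \<forall>t\<in>S. \<bar>covariance M (W t) X\<bar> \<le> C"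
proof -
  obtain C where C: "\<And>t. t \<in> S \<Longrightarrow> expectation (\<lambda>\<omega>. (W t \<omega>)\<^sup>2) \<le> C"
    using second_moment_bounded[OF W bdd] by blast
  have "\<bar>covariance M (W t) X\<bar> \<le> C + covariance M X X" if "t \<in> S" for t
    using covariance_le[OF W[OF that] X, of 1] covariance_self_le[OF W[OF that]] C[OF that] by simp
  then show ?thesis by blast
qed

text \<open>A regression matrix applied to a vector is a covariance with one fixed variable.
  Regularity of regression coefficients in a parameter thus reduces to regularity of
  covariances.\<close>

lemma regression_coeff_mult:
  fixes X :: "'w \<Rightarrow> real ^ 'm" and Y :: "'w \<Rightarrow> real ^ 'd"
  assumes "(\<lambda>\<omega>. X \<omega> $ i) \<in> H" and Y: "\<And>j. (\<lambda>\<omega>. Y \<omega> $ j) \<in> H"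
  shows "(regression_coeff M X Y *v x) $ i =
    covariance M (\<lambda>\<omega>. X \<omega> $ i) (\<lambda>\<omega>. (matrix_inv (var_matrix M Y) *v x) \<bullet> Y \<omega>)"
proof -
  let ?y = "matrix_inv (var_matrix M Y) *v x"
  have "covariance M (\<lambda>\<omega>. X \<omega> $ i) (\<lambda>\<omega>. ?y \<bullet> Y \<omega>) = covariance M (\<lambda>\<omega>. \<Sum>j\<in>UNIV. ?y $ j * Y \<omega> $ j) (\<lambda>\<omega>. X \<omega> $ i)"
    by (simp add: covariance_commute inner_vec_def)
  also have "\<dots> = (\<Sum>j\<in>UNIV. ?y $ j * covariance M (\<lambda>\<omega>. Y \<omega> $ j) (\<lambda>\<omega>. X \<omega> $ i))"
    using assms by (subst covariance_sum) (auto intro!: H_intros simp: covariance_scale)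
  also have "\<dots> = (cov_matrix M X Y *v ?y) $ i"
    by (simp add: matrix_vector_mult_def[of "cov_matrix M X Y"] cov_matrix_nth mult.commute covariance_commute)
  finally show ?thesis by (simp add: regression_coeff_def matrix_vector_mul_assoc)
qed

lemma inner_mem:
  fixes Y :: "'w \<Rightarrow> real ^ 'd"
  assumes "\<And>j. (\<lambda>\<omega>. Y \<omega> $ j) \<in> H"
  shows "(\<lambda>\<omega>. y \<bullet> Y \<omega>) \<in> H"
  unfolding inner_vec_def inner_real_def by (intro H_intros assms)

lemma matrix_vector_mem:
  fixes Y :: "'w \<Rightarrow> real ^ 'd"
  assumes "\<And>j. (\<lambda>\<omega>. Y \<omega> $ j) \<in> H"
  shows "(\<lambda>\<omega>. (A *v Y \<omega>) $ i) \<in> H"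
  unfolding matrix_vector_mult_def by (simp, intro H_intros assms)

text \<open>These are the normal equations of linear regression,
  \<open>R ** Var Y = Cov(X, Y)\<close>.\<close>

lemma regression_residual_uncorrelated:
  fixes X :: "'w \<Rightarrow> real ^ 'm" and Y :: "'w \<Rightarrow> real ^ 'd"
  assumes X: "(\<lambda>\<omega>. X \<omega> $ i) \<in> H" and Y: "\<And>j. (\<lambda>\<omega>. Y \<omega> $ j) \<in> H"
    and V: "positive_definite (var_matrix M Y)"
  shows "covariance M (\<lambda>\<omega>. (X \<omega> - regression_coeff M X Y *v Y \<omega>) $ i) (\<lambda>\<omega>. Y \<omega> $ j) = 0"
proof -
  let ?R = "regression_coeff M X Y" and ?V = "var_matrix M Y"
  have "covariance M (\<lambda>\<omega>. (?R *v Y \<omega>) $ i) (\<lambda>\<omega>. Y \<omega> $ j) =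
      (\<Sum>l\<in>UNIV. ?R $ i $ l * covariance M (\<lambda>\<omega>. Y \<omega> $ l) (\<lambda>\<omega>. Y \<omega> $ j))"
    unfolding matrix_vector_mult_def using Y
    by (simp, subst covariance_sum) (auto intro!: H_intros simp: covariance_scale)
  also have "\<dots> = (?R ** ?V) $ i $ j"
    by (simp add: matrix_matrix_mult_def[of ?R] var_matrix_def cov_matrix_nth)
  also have "?R ** ?V = cov_matrix M X Y"
    unfolding regression_coeff_def
    by (simp add: matrix_mul_assoc[symmetric] matrix_inv_mult(2)[OF inj_positive_definite[OF V]])
  finally have "covariance M (\<lambda>\<omega>. (?R *v Y \<omega>) $ i) (\<lambda>\<omega>. Y \<omega> $ j) = covariance M (\<lambda>\<omega>. X \<omega> $ i) (\<lambda>\<omega>. Y \<omega> $ j)"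
    by (simp add: cov_matrix_nth)
  then show ?thesis
    using covariance_diff[OF X matrix_vector_mem[OF Y, where A = ?R and i = i] Y[of j]] by simp
qed

end

text \<open>Path properties are required at every sample point; a null set of bad paths is removed
  beforehand. \<open>D\<close> is constrained in the interior only, since on the frontier a relative
  derivative may be ambiguous. There a local Lipschitz bound takes its place.\<close>

locale c1_field = gaussian_space M H for M :: "'w measure" and H +
  fixes I :: "(real ^ 'd) set" and Z :: "real ^ 'd \<Rightarrow> 'w \<Rightarrow> real ^ 'd"
    and D :: "real ^ 'd \<Rightarrow> 'w \<Rightarrow> real ^ 'd ^ 'd"
  assumes compact_I: "compact I"
    and Z_mem: "t \<in> I \<Longrightarrow> (\<lambda>\<omega>. Z t \<omega> $ i) \<in> H"
    and D_mem: "t \<in> interior I \<Longrightarrow> (\<lambda>\<omega>. D t \<omega> $ i $ k) \<in> H"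
    and Z_deriv: "\<omega> \<in> space M \<Longrightarrow> t \<in> interior I \<Longrightarrow> ((\<lambda>s. Z s \<omega>) has_derivative (\<lambda>h. D t \<omega> *v h)) (at t)"
    and D_cont: "\<omega> \<in> space M \<Longrightarrow> continuous_on (interior I) (\<lambda>t. D t \<omega>)"
    and D_bdd: "\<omega> \<in> space M \<Longrightarrow> \<exists>C. \<forall>t\<in>interior I. norm (D t \<omega>) \<le> C"
    and Z_lips: "\<omega> \<in> space M \<Longrightarrow> t \<in> I \<Longrightarrow>
      \<exists>e>0. \<exists>C. \<forall>s\<in>I. dist s t < e \<longrightarrow> dist (Z s \<omega>) (Z t \<omega>) \<le> C * dist s t"
    and posdef: "t \<in> I \<Longrightarrow> positive_definite (var_matrix M (Z t))"
    and frontier_null: "emeasure lborel (frontier I) = 0"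
begin

section \<open>Regularity of the covariances of a smooth Gaussian field\<close>

lemma interior_I: "t \<in> interior I \<Longrightarrow> t \<in> I"
  using interior_subset by blast

lemma Z_cont: "\<omega> \<in> space M \<Longrightarrow> continuous_on I (\<lambda>t. Z t \<omega>)"
  by (rule continuous_on_of_local_Lipschitz) (rule Z_lips)

lemma Z_bdd:
  assumes "\<omega> \<in> space M"
  shows "\<exists>C. \<forall>t\<in>I. norm (Z t \<omega>) \<le> C"
  using compact_imp_bounded[OF compact_continuous_image[OF Z_cont[OF assms] compact_I]]
  unfolding bounded_iff by auto

lemma Z_measurable: "t \<in> I \<Longrightarrow> Z t \<in> borel_measurable M"
  by (rule measurable_vec_lambda_borel) (rule measurable_mem[OF Z_mem])

text \<open>If it failed, there would be difference quotients \<open>W n\<close> with unbounded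
  covariances with \<open>X\<close>. Each path, however, keeps them bounded by its own Lipschitz
  constant, against \<open>covariance_bounded\<close>.\<close>

lemma covariance_Z_Lipschitz:
  assumes t: "t \<in> I" and X: "X \<in> H"
  shows "\<exists>e>0. \<exists>C. \<forall>s\<in>I. dist s t < e \<longrightarrow>
    \<bar>covariance M (\<lambda>\<omega>. Z s \<omega> $ i) X - covariance M (\<lambda>\<omega>. Z t \<omega> $ i) X\<bar> \<le> C * dist s t"
proof (rule ccontr)
  let ?c = "\<lambda>s. covariance M (\<lambda>\<omega>. Z s \<omega> $ i) X"
  assume neg: "\<not> ?thesis"
  have "\<exists>s\<in>I. dist s t < 1 / (real n + 1) \<and> real n * dist s t < \<bar>?c s - ?c t\<bar>" for n
  proof (rule ccontr)
    assume "\<not> ?thesis"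
    then have "\<forall>s\<in>I. dist s t < 1 / (real n + 1) \<longrightarrow> \<bar>?c s - ?c t\<bar> \<le> real n * dist s t" by (auto simp: not_less)
    moreover have "0 < 1 / (real n + 1)" by simp
    ultimately show False using neg by blast
  qed
  then obtain s where s: "\<And>n. s n \<in> I" "\<And>n. dist (s n) t < 1 / (real n + 1)"
    "\<And>n. real n * dist (s n) t < \<bar>?c (s n) - ?c t\<bar>" by metis
  have pos: "0 < dist (s n) t" for n
  proof (rule ccontr)
    assume "\<not> 0 < dist (s n) t"
    then have "s n = t" by simp
    then show False using s(3)[of n] by simp
  qed
  define W where "W n \<omega> = (1 / dist (s n) t) * (Z (s n) \<omega> $ i - Z t \<omega> $ i)" for n \<omega>
  have W: "W n \<in> H" for n
    unfolding W_def[abs_def] by (intro H_intros Z_mem s t)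
  have "\<exists>C. \<forall>n\<in>UNIV. \<bar>covariance M (W n) X\<bar> \<le> C"
  proof (rule covariance_bounded[OF W X])
    fix \<omega> assume \<omega>: "\<omega> \<in> space M"
    obtain e C where e: "e > 0" "\<And>s. s \<in> I \<Longrightarrow> dist s t < e \<Longrightarrow> dist (Z s \<omega>) (Z t \<omega>) \<le> C * dist s t"
      using Z_lips[OF \<omega> t] by blast
    obtain N :: nat where N: "1 / (real N + 1) < e"
      using nat_approx_posE[OF e(1)] by (metis of_nat_Suc add.commute)
    have W1: "\<bar>W n \<omega>\<bar> \<le> C" if "N \<le> n" for n
    proof -
      have "1 / (real n + 1) \<le> 1 / (real N + 1)" using that by (intro divide_left_mono) auto
      then have "dist (s n) t < e" using s(2)[of n] N by linarith
      then have "dist (Z (s n) \<omega>) (Z t \<omega>) \<le> C * dist (s n) t" using e s by auto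
      moreover have "\<bar>Z (s n) \<omega> $ i - Z t \<omega> $ i\<bar> \<le> dist (Z (s n) \<omega>) (Z t \<omega>)"
        unfolding dist_norm using component_le_norm_cart[of "Z (s n) \<omega> - Z t \<omega>" i] by simp
      ultimately show ?thesis using pos[of n] by (simp add: W_def abs_mult field_simps)
    qed
    \<comment> \<open>The Lipschitz estimate starts at \<open>N\<close>; the finitely many earlier
      quotients are covered by their sum.\<close>
    have "\<bar>W n \<omega>\<bar> \<le> \<bar>C\<bar> + (\<Sum>k<N. \<bar>W k \<omega>\<bar>)" for n
    proof (cases "N \<le> n")
      case True
      have "0 \<le> (\<Sum>k<N. \<bar>W k \<omega>\<bar>)" by (rule sum_nonneg) simp
      then show ?thesis using W1[OF True] by linarith
    next
      case False
      then have "\<bar>W n \<omega>\<bar> \<le> (\<Sum>k<N. \<bar>W k \<omega>\<bar>)" by (intro member_le_sum) auto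
      then show ?thesis by linarith
    qed
    then show "\<exists>C. \<forall>n\<in>UNIV. \<bar>W n \<omega>\<bar> \<le> C" by blast
  qed
  then obtain C where C: "\<And>n. \<bar>covariance M (W n) X\<bar> \<le> C" by blast
  have "real n < C" for n
  proof -
    have "covariance M (W n) X = (?c (s n) - ?c t) / dist (s n) t"
      unfolding W_def[abs_def] using Z_mem s t X
      by (subst covariance_scale) (auto intro!: H_intros simp: covariance_diff)
    then have "\<bar>covariance M (W n) X\<bar> = \<bar>?c (s n) - ?c t\<bar> / dist (s n) t" using pos[of n] by (simp add: abs_divide)
    moreover have "real n < \<bar>?c (s n) - ?c t\<bar> / dist (s n) t" using s(3)[of n] pos[of n] by (simp add: pos_less_divide_eq)
    ultimately show ?thesis using C[of n] by linarith
  qed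
  then show False using reals_Archimedean2[of C] by (meson less_asym)
qed

text \<open>The normalised first-order remainder of a path is a Gaussian variable that tends to zero
  at every sample point, so its covariance with \<open>X\<close> tends to zero. This differentiates
  under the expectation without a majorant.\<close>

lemma covariance_Z_deriv:
  assumes t: "t \<in> interior I" and X: "X \<in> H"
  shows "((\<lambda>s. covariance M (\<lambda>\<omega>. Z s \<omega> $ i) X) has_derivative
    (\<lambda>h. \<Sum>k\<in>UNIV. h $ k * covariance M (\<lambda>\<omega>. D t \<omega> $ i $ k) X)) (at t)"
proof -
  let ?c = "\<lambda>s. covariance M (\<lambda>\<omega>. Z s \<omega> $ i) X"
  let ?d = "\<lambda>h. \<Sum>k\<in>UNIV. h $ k * covariance M (\<lambda>\<omega>. D t \<omega> $ i $ k) X"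
  have "(?c has_derivative ?d) (at t within interior I)"
    unfolding has_derivative_iff_norm
  proof
    show "bounded_linear ?d"
      by (intro bounded_linear_sum bounded_linear_mult_const bounded_linear_vec_nth)
    have "(\<lambda>n. norm (?c (y n) - ?c t - ?d (y n - t)) / norm (y n - t)) \<longlonglongrightarrow> 0"
      if y: "\<And>n. y n \<in> interior I - {t}" "y \<longlonglongrightarrow> t" for y
    proof -
      define W where "W n \<omega> = (1 / norm (y n - t)) * (Z (y n) \<omega> $ i - Z t \<omega> $ i - (\<Sum>k\<in>UNIV. (y n - t) $ k * D t \<omega> $ i $ k))" for n \<omega>
      have yI: "y n \<in> I" "y n \<noteq> t" for n using y(1)[of n] interior_I by auto
      have W: "W n \<in> H" for n
        unfolding W_def[abs_def] by (intro H_intros Z_mem D_mem t interior_I[OF t] yI)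
      have "(\<lambda>n. covariance M (W n) X) \<longlonglongrightarrow> 0"
      proof (rule covariance_tendsto_0[OF W X], rule AE_I2)
        fix \<omega> assume \<omega>: "\<omega> \<in> space M"
        have "((\<lambda>s. (1 / norm (s - t)) *\<^sub>R (Z s \<omega> - (Z t \<omega> + D t \<omega> *v (s - t)))) \<longlongrightarrow> 0) (at t within interior I)"
          using has_derivative_at_withinI[OF Z_deriv[OF \<omega> t]] unfolding has_derivative_within by blast
        then have "(\<lambda>n. (1 / norm (y n - t)) *\<^sub>R (Z (y n) \<omega> - (Z t \<omega> + D t \<omega> *v (y n - t)))) \<longlonglongrightarrow> 0"
          using y unfolding tendsto_at_iff_sequentially o_def by blast
        from tendsto_vec_nth[OF this, of i]
        show "(\<lambda>n. W n \<omega>) \<longlonglongrightarrow> 0"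
          by (simp add: W_def matrix_vector_mult_def diff_diff_eq mult.commute)
      qed
      then have "(\<lambda>n. \<bar>covariance M (W n) X\<bar>) \<longlonglongrightarrow> 0" by (rule tendsto_rabs_zero)
      moreover have "\<bar>covariance M (W n) X\<bar> = norm (?c (y n) - ?c t - ?d (y n - t)) / norm (y n - t)" for n
      proof -
        have "covariance M (W n) X = (1 / norm (y n - t)) * (?c (y n) - ?c t - ?d (y n - t))"
        proof -
          have 1: "(\<lambda>\<omega>. \<Sum>k\<in>UNIV. (y n - t) $ k * D t \<omega> $ i $ k) \<in> H" by (intro H_intros D_mem t)
          have 2: "(\<lambda>\<omega>. Z (y n) \<omega> $ i - Z t \<omega> $ i) \<in> H" by (intro H_intros Z_mem yI interior_I[OF t])
          have 3: "covariance M (\<lambda>\<omega>. \<Sum>k\<in>UNIV. (y n - t) $ k * D t \<omega> $ i $ k) X = ?d (y n - t)"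
            using D_mem[OF t] X by (subst covariance_sum) (auto simp: covariance_scale intro!: H_intros)
          show ?thesis
            unfolding W_def[abs_def]
            by (simp only: covariance_scale[OF diff_mem[OF 2 1] X] covariance_diff[OF 2 1 X] 3
                covariance_diff[OF Z_mem[OF yI(1)] Z_mem[OF interior_I[OF t]] X])
        qed
        then show ?thesis by (simp add: abs_mult)
      qed
      ultimately show ?thesis by simp
    qed
    then show "((\<lambda>y. norm (?c y - ?c t - ?d (y - t)) / norm (y - t)) \<longlongrightarrow> 0) (at t within interior I)"
      unfolding tendsto_at_iff_sequentially o_def by blast
  qed
  then show ?thesis using at_within_open[OF t open_interior] by simp
qed

lemma covariance_D_cont:
  assumes X: "X \<in> H"
  shows "continuous_on (interior I) (\<lambda>t. covariance M (\<lambda>\<omega>. D t \<omega> $ i $ k) X)"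
  unfolding continuous_on_sequentially o_def
proof (intro allI ballI impI, elim conjE)
  fix y t assume t: "t \<in> interior I" and y: "\<forall>n. y n \<in> interior I" "y \<longlonglongrightarrow> t"
  have "(\<lambda>n. covariance M (\<lambda>\<omega>. D (y n) \<omega> $ i $ k - D t \<omega> $ i $ k) X) \<longlonglongrightarrow> 0"
  proof (rule covariance_tendsto_0[OF _ X])
    show "(\<lambda>\<omega>. D (y n) \<omega> $ i $ k - D t \<omega> $ i $ k) \<in> H" for n using y t by (intro H_intros D_mem) auto
    show "AE \<omega> in M. (\<lambda>n. D (y n) \<omega> $ i $ k - D t \<omega> $ i $ k) \<longlonglongrightarrow> 0"
    proof (rule AE_I2)
      fix \<omega> assume "\<omega> \<in> space M"
      then have "(\<lambda>n. D (y n) \<omega>) \<longlonglongrightarrow> D t \<omega>"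
        using D_cont t y unfolding continuous_on_sequentially o_def by blast
      then have "(\<lambda>n. D (y n) \<omega> $ i $ k) \<longlonglongrightarrow> D t \<omega> $ i $ k" by (intro tendsto_vec_nth)
      then show "(\<lambda>n. D (y n) \<omega> $ i $ k - D t \<omega> $ i $ k) \<longlonglongrightarrow> 0" by (simp add: LIM_zero_iff)
    qed
  qed
  moreover have "covariance M (\<lambda>\<omega>. D (y n) \<omega> $ i $ k - D t \<omega> $ i $ k) X =
      covariance M (\<lambda>\<omega>. D (y n) \<omega> $ i $ k) X - covariance M (\<lambda>\<omega>. D t \<omega> $ i $ k) X" for n
    using y t X by (intro covariance_diff D_mem) auto
  ultimately show "(\<lambda>n. covariance M (\<lambda>\<omega>. D (y n) \<omega> $ i $ k) X) \<longlonglongrightarrow> covariance M (\<lambda>\<omega>. D t \<omega> $ i $ k) X"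
    by (simp add: LIM_zero_iff)
qed

lemma covariance_D_bdd:
  assumes X: "X \<in> H"
  shows "\<exists>C. \<forall>t\<in>interior I. \<bar>covariance M (\<lambda>\<omega>. D t \<omega> $ i $ k) X\<bar> \<le> C"
proof (rule covariance_bounded[OF D_mem X])
  fix \<omega> assume "\<omega> \<in> space M"
  then obtain C where C: "\<forall>t\<in>interior I. norm (D t \<omega>) \<le> C" using D_bdd by blast
  have "\<bar>A $ i $ k\<bar> \<le> norm A" for A :: "real ^ 'd ^ 'd"
    using order.trans[OF component_le_norm_cart[of "A $ i" k] Finite_Cartesian_Product.norm_nth_le[of A i]] by simp
  then show "\<exists>C. \<forall>t\<in>interior I. \<bar>D t \<omega> $ i $ k\<bar> \<le> C" using C by (meson order.trans)
qed

lemma covariance_Z_cont: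
  assumes X: "X \<in> H"
  shows "continuous_on I (\<lambda>t. covariance M (\<lambda>\<omega>. Z t \<omega> $ i) X)"
  by (rule continuous_on_of_local_Lipschitz)
     (use covariance_Z_Lipschitz[OF _ X] in \<open>simp add: dist_real_def\<close>)

end

section \<open>Analytic tools for the local density\<close>

lemma det_square_le:
  fixes A :: "real ^ 'd ^ 'd"
  shows "(det A)\<^sup>2 \<le> (fact CARD('d))\<^sup>2 * (\<Sum>i\<in>UNIV. \<Sum>j\<in>UNIV. (A $ i $ j) ^ (2 * CARD('d)))"
proof -
  \<comment> \<open>The Leibniz sum has \<open>n!\<close> terms, each at most the
    \<open>n\<close>-th power of the largest entry \<open>m\<close> (\<open>n\<close> being the
    dimension). Replacing \<open>m ^ (2 * n)\<close> by the sum over all entries gives a polynomial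
    whose Gaussian moments are under control.\<close>
  define m where "m = Max (range (\<lambda>z. \<bar>A $ fst z $ snd z\<bar>))"
  have m: "\<bar>A $ i $ j\<bar> \<le> m" for i j
  proof -
    have "\<bar>A $ fst (i, j) $ snd (i, j)\<bar> \<le> m" unfolding m_def by (intro Max_ge rangeI) auto
    then show ?thesis by simp
  qed
  then have m0: "0 \<le> m" by (meson abs_ge_zero order.trans)
  have "m \<in> range (\<lambda>z. \<bar>A $ fst z $ snd z\<bar>)" unfolding m_def by (rule Max_in) auto
  then obtain i0 j0 where ij: "m = \<bar>A $ i0 $ j0\<bar>" by auto
  have "\<bar>det A\<bar> \<le> (\<Sum>p | p permutes (UNIV :: 'd set). m ^ CARD('d))"
    unfolding det_def
  proof (rule order.trans[OF sum_abs], rule sum_mono)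
    fix p :: "'d \<Rightarrow> 'd"
    have "\<bar>\<Prod>i\<in>UNIV. A $ i $ p i\<bar> \<le> (\<Prod>i\<in>(UNIV :: 'd set). m)"
      unfolding abs_prod by (rule prod_mono) (use m in auto)
    then show "\<bar>of_int (sign p) * (\<Prod>i\<in>UNIV. A $ i $ p i)\<bar> \<le> m ^ CARD('d)"
      by (simp add: abs_mult sign_def)
  qed
  also have "\<dots> = fact CARD('d) * m ^ CARD('d)"
    by (simp add: card_permutations)
  finally have "\<bar>det A\<bar>\<^sup>2 \<le> (fact CARD('d) * m ^ CARD('d))\<^sup>2" by (intro power_mono) auto
  then have "(det A)\<^sup>2 \<le> (fact CARD('d))\<^sup>2 * m ^ (2 * CARD('d))"
    by (simp add: power_mult_distrib power_mult[symmetric] mult.commute)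
  also have "m ^ (2 * CARD('d)) = (A $ i0 $ j0) ^ (2 * CARD('d))"
    unfolding ij power_mult by simp
  also have "\<dots> \<le> (\<Sum>j\<in>UNIV. (A $ i0 $ j) ^ (2 * CARD('d)))"
    by (rule member_le_sum) (auto simp: power_mult)
  also have "\<dots> \<le> (\<Sum>i\<in>UNIV. \<Sum>j\<in>UNIV. (A $ i $ j) ^ (2 * CARD('d)))"
    by (rule member_le_sum[where f="\<lambda>i. \<Sum>j\<in>UNIV. (A $ i $ j) ^ (2 * CARD('d))"]) (auto simp: power_mult intro!: sum_nonneg)
  finally show ?thesis by (simp add: mult_left_mono)
qed

lemma norm_matrix_vector_mult_le:
  fixes A :: "real ^ 'n ^ 'm"
  shows "norm (A *v x) \<le> (\<Sum>i\<in>UNIV. \<Sum>j\<in>UNIV. \<bar>A $ i $ j\<bar>) * norm x"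
proof -
  have "norm (A *v x) \<le> onorm ((*v) A) * norm x" by (rule onorm) simp
  also have "\<dots> \<le> (\<Sum>i\<in>UNIV. \<Sum>j\<in>UNIV. \<bar>A $ i $ j\<bar>) * norm x"
    by (intro mult_right_mono onorm_le_matrix_component_sum) simp
  finally show ?thesis .
qed

text \<open>\<open>y\<close> is differentiated without differentiating an inverse matrix. Applied to
  the remainder \<open>y s - y t - L (s - t)\<close>, the matrix \<open>A s\<close> yields the
  remainder of \<open>\<phi>\<close> plus \<open>(A t - A s) *v L (s - t)\<close>, both small
  compared with \<open>s - t\<close>; the uniform lower bound carries the estimate back.\<close>

lemma has_derivative_solve:
  fixes A :: "real ^ 'd \<Rightarrow> real ^ 'd ^ 'd" and y \<phi> :: "real ^ 'd \<Rightarrow> real ^ 'd"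
  assumes S: "open S" "t \<in> S"
    and solve: "\<And>s. s \<in> S \<Longrightarrow> A s *v (y s - y t) = \<phi> s"
    and lower: "\<And>s x. s \<in> S \<Longrightarrow> norm x \<le> 2 * norm (A s *v x)"
    and A: "continuous_on S A"
    and \<phi>: "(\<phi> has_derivative \<phi>') (at t)" "\<phi> t = 0"
    and L: "bounded_linear L" "\<And>h. A t *v L h = \<phi>' h"
  shows "(y has_derivative L) (at t)"
  unfolding has_derivative_iff_norm
proof
  obtain K where K: "\<And>h. norm (L h) \<le> norm h * K" using bounded_linear.bounded[OF L(1)] by blast
  let ?n = "\<lambda>s. \<Sum>i\<in>UNIV. \<Sum>j\<in>UNIV. \<bar>(A t - A s) $ i $ j\<bar>"
  show "((\<lambda>s. norm (y s - y t - L (s - t)) / norm (s - t)) \<longlongrightarrow> 0) (at t)"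
  proof (rule Lim_null_comparison)
    have "(A \<longlongrightarrow> A t) (at t)"
      using A S by (simp add: continuous_on_eq_continuous_at isCont_def)
    then have "(?n \<longlongrightarrow> (\<Sum>i\<in>(UNIV :: 'd set). \<Sum>j\<in>(UNIV :: 'd set). \<bar>(A t - A t) $ i $ j\<bar>)) (at t)"
      by (intro tendsto_intros)
    then have "(?n \<longlongrightarrow> 0) (at t)" by simp
    moreover have "((\<lambda>s. norm (\<phi> s - \<phi> t - \<phi>' (s - t)) / norm (s - t)) \<longlongrightarrow> 0) (at t)"
      using \<phi> by (simp add: has_derivative_iff_norm)
    ultimately have "((\<lambda>s. 2 * (norm (\<phi> s - \<phi> t - \<phi>' (s - t)) / norm (s - t)) + 2 * (?n s * K)) \<longlongrightarrow> 2 * 0 + 2 * (0 * K)) (at t)"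
      by (intro tendsto_intros)
    then show "((\<lambda>s. 2 * (norm (\<phi> s - \<phi> t - \<phi>' (s - t)) / norm (s - t)) + 2 * (?n s * K)) \<longlongrightarrow> 0) (at t)" by simp
    have "\<forall>\<^sub>F s in at t. s \<in> S \<and> s \<noteq> t"
      using S by (auto simp: eventually_at_topological)
    then show "\<forall>\<^sub>F s in at t. norm (norm (y s - y t - L (s - t)) / norm (s - t)) \<le>
       2 * (norm (\<phi> s - \<phi> t - \<phi>' (s - t)) / norm (s - t)) + 2 * (?n s * K)"
    proof eventually_elim
      case (elim s)
      let ?h = "s - t"
      have h: "0 < norm ?h" using elim by simp
      have "A s *v (y s - y t - L ?h) = \<phi> s - A s *v L ?h"
        using solve[of s] elim by (simp add: matrix_vector_mult_diff_distrib)
      also have "\<dots> = (\<phi> s - \<phi> t - \<phi>' ?h) + (A t - A s) *v L ?h"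
        using L(2)[of ?h] \<phi>(2) by (simp add: matrix_vector_mult_diff_rdistrib)
      finally have "norm (y s - y t - L ?h) \<le> 2 * norm ((\<phi> s - \<phi> t - \<phi>' ?h) + (A t - A s) *v L ?h)"
        using lower[of s "y s - y t - L ?h"] elim by simp
      also have "\<dots> \<le> 2 * (norm (\<phi> s - \<phi> t - \<phi>' ?h) + ?n s * (norm ?h * K))"
      proof -
        have "norm ((A t - A s) *v L ?h) \<le> ?n s * norm (L ?h)" by (rule norm_matrix_vector_mult_le)
        also have "\<dots> \<le> ?n s * (norm ?h * K)" by (intro mult_left_mono K sum_nonneg) auto
        finally have *: "norm ((A t - A s) *v L ?h) \<le> ?n s * (norm ?h * K)" .
        have "2 * c \<le> 2 * (d + b)" if "a \<le> b" "c \<le> d + a" for a b c d :: real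
          by (rule mult_left_mono[OF order.trans[OF that(2) add_left_mono[OF that(1)]]]) simp
        from this[OF * norm_triangle_ineq] show ?thesis .
      qed
      finally have "norm (y s - y t - L ?h) / norm ?h \<le> 2 * (norm (\<phi> s - \<phi> t - \<phi>' ?h) + ?n s * (norm ?h * K)) / norm ?h"
        using h by (intro divide_right_mono) auto
      also have "\<dots> = 2 * (norm (\<phi> s - \<phi> t - \<phi>' ?h) / norm ?h) + 2 * (?n s * K)"
        using h by (simp add: field_simps)
      finally show ?case by simp
    qed
  qed
qed (rule L(1))

text \<open>Bounded second moments give uniform integrability: truncation at height \<open>K\<close>
  changes each expectation by at most \<open>C / K\<close>, and the truncated variables converge by
  dominated convergence.\<close>

lemma (in prob_space) expectation_tendsto_of_square_bounded:
  fixes X :: "nat \<Rightarrow> 'a \<Rightarrow> real"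
  assumes [measurable]: "\<And>n. X n \<in> borel_measurable M" "Y \<in> borel_measurable M"
    and nn: "\<And>n \<omega>. 0 \<le> X n \<omega>" "\<And>\<omega>. 0 \<le> Y \<omega>"
    and lim: "AE \<omega> in M. (\<lambda>n. X n \<omega>) \<longlonglongrightarrow> Y \<omega>"
    and sq: "\<And>n. integrable M (\<lambda>\<omega>. (X n \<omega>)\<^sup>2)" "integrable M (\<lambda>\<omega>. (Y \<omega>)\<^sup>2)"
    and C: "\<And>n. expectation (\<lambda>\<omega>. (X n \<omega>)\<^sup>2) \<le> C" "expectation (\<lambda>\<omega>. (Y \<omega>)\<^sup>2) \<le> C"
  shows "(\<lambda>n. expectation (X n)) \<longlonglongrightarrow> expectation Y"
proof (rule LIMSEQ_I)
  fix r :: real assume "0 < r"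
  have "0 \<le> expectation (\<lambda>\<omega>. (Y \<omega>)\<^sup>2)" by (rule integral_nonneg_AE) simp
  then have "0 \<le> C" using C(2) by (rule order.trans)
  \<comment> \<open>Large enough for \<open>C / K < r / 3\<close>, as the error splits into two
    truncations and one limit.\<close>
  define K where "K = 4 * (C + 1) / r"
  have K0: "0 < K" using \<open>0 < r\<close> \<open>0 \<le> C\<close> by (simp add: K_def)
  have "C * 3 < r * K" using \<open>0 < r\<close> \<open>0 \<le> C\<close> by (simp add: K_def)
  then have "C / K < r / 3" using K0 by (simp add: field_simps)
  with K0 have K: "0 < K" "C / K < r / 3" by auto
  have trunc: "0 \<le> expectation X - expectation (\<lambda>\<omega>. min (X \<omega>) K) \<and> expectation X - expectation (\<lambda>\<omega>. min (X \<omega>) K) \<le> C / K"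
    if [measurable]: "X \<in> borel_measurable M" and X: "\<And>\<omega>. 0 \<le> X \<omega>" "integrable M (\<lambda>\<omega>. (X \<omega>)\<^sup>2)" "expectation (\<lambda>\<omega>. (X \<omega>)\<^sup>2) \<le> C" for X
  proof -
    have iX: "integrable M X"
    proof (rule Bochner_Integration.integrable_bound)
      show "integrable M (\<lambda>\<omega>. 1 + (X \<omega>)\<^sup>2)" using X(2) by simp
      have "\<bar>x\<bar> \<le> 1 + x\<^sup>2" for x :: real
      proof -
        have "0 \<le> (\<bar>x\<bar> - 1)\<^sup>2" by simp
        then have "2 * \<bar>x\<bar> \<le> 1 + x\<^sup>2" by (simp add: power2_diff)
        then show ?thesis using abs_ge_zero[of x] by linarith
      qed
      then show "AE \<omega> in M. norm (X \<omega>) \<le> norm (1 + (X \<omega>)\<^sup>2)" by (intro AE_I2) (simp add: abs_of_nonneg)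
    qed simp
    have im: "integrable M (\<lambda>\<omega>. min (X \<omega>) K)"
      by (rule Bochner_Integration.integrable_bound[OF iX]) (use X(1) K(1) in \<open>auto simp: min_def\<close>)
    have eq: "expectation X - expectation (\<lambda>\<omega>. min (X \<omega>) K) = expectation (\<lambda>\<omega>. X \<omega> - min (X \<omega>) K)"
      using iX im by simp
    have "0 \<le> expectation (\<lambda>\<omega>. X \<omega> - min (X \<omega>) K)"
      by (rule integral_nonneg_AE) auto
    moreover have "expectation (\<lambda>\<omega>. X \<omega> - min (X \<omega>) K) \<le> expectation (\<lambda>\<omega>. (X \<omega>)\<^sup>2 / K)"
    proof (rule integral_mono)
      fix \<omega>
      show "X \<omega> - min (X \<omega>) K \<le> (X \<omega>)\<^sup>2 / K"
      proof (cases "X \<omega> \<le> K")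
        case False
        then have "X \<omega> * K \<le> X \<omega> * X \<omega>" using X(1)[of \<omega>] by (intro mult_left_mono) auto
        then have "X \<omega> \<le> (X \<omega>)\<^sup>2 / K" using K(1) by (simp add: field_simps power2_eq_square)
        then show ?thesis using K(1) False by simp
      qed (use K(1) in auto)
    qed (use iX im X(2) in auto)
    moreover have "expectation (\<lambda>\<omega>. (X \<omega>)\<^sup>2 / K) \<le> C / K"
      using X(3) K(1) by (simp add: divide_right_mono)
    ultimately show ?thesis using eq by linarith
  qed
  have "(\<lambda>n. expectation (\<lambda>\<omega>. min (X n \<omega>) K)) \<longlonglongrightarrow> expectation (\<lambda>\<omega>. min (Y \<omega>) K)"
  proof (rule integral_dominated_convergence[where w="\<lambda>_. K"])
    show "AE \<omega> in M. (\<lambda>n. min (X n \<omega>) K) \<longlonglongrightarrow> min (Y \<omega>) K"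
      using lim by eventually_elim (intro tendsto_intros)
    show "AE \<omega> in M. norm (min (X n \<omega>) K) \<le> K" for n
      using nn(1)[of n] K(1) by (intro AE_I2) (auto simp: min_def)
  qed auto
  from LIMSEQ_D[OF this, of "r / 3"] \<open>0 < r\<close>
  obtain N where N: "\<And>n. n \<ge> N \<Longrightarrow> norm (expectation (\<lambda>\<omega>. min (X n \<omega>) K) - expectation (\<lambda>\<omega>. min (Y \<omega>) K)) < r / 3"
    by auto
  have "norm (expectation (X n) - expectation Y) < r" if "n \<ge> N" for n
  proof -
    note 1 = trunc[OF assms(1) nn(1) sq(1) C(1), of n] and 2 = trunc[OF assms(2) nn(2) sq(2) C(2)]
    show ?thesis using N[OF that] 1 2 K(2) unfolding real_norm_def abs_less_iff by linarith
  qed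
  then show "\<exists>N. \<forall>n\<ge>N. norm (expectation (X n) - expectation Y) < r" by blast
qed

text \<open>On each cell \<open>Q\<close> is frozen at a representative of the cell, which gives a
  countable sum of measurable products. As the mesh shrinks, continuity in \<open>t\<close> gives
  pointwise convergence.\<close>

lemma measurable_caratheodory:
  fixes Q :: "'a::euclidean_space \<Rightarrow> 'w \<Rightarrow> real"
  assumes W: "open W" and meas: "\<And>t. t \<in> W \<Longrightarrow> Q t \<in> borel_measurable M"
    and cont: "\<And>\<omega>. \<omega> \<in> space M \<Longrightarrow> continuous_on W (\<lambda>t. Q t \<omega>)"
  shows "(\<lambda>z. ennreal (Q (snd z) (fst z)) * indicator W (snd z)) \<in> borel_measurable (M \<Otimes>\<^sub>M borel)"
proof -
  \<comment> \<open>For an empty cell the representative is arbitrary; the conditional in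
    \<open>q\<close> masks this case.\<close>
  define c where "c k j = (SOME t. t \<in> W \<inter> mesh k j)" for k j
  have c: "c k j \<in> W \<inter> mesh k j" if "t \<in> W \<inter> mesh k j" for t k j
    unfolding c_def by (rule someI[of _ t]) (rule that)
  define q where "q k z = (\<Sum>j. (if W \<inter> mesh k j = {} then 0 else ennreal (Q (c k j) (fst z))) * indicator (W \<inter> mesh k j) (snd z))"
    for k and z :: "'w \<times> 'a"
  have mW: "W \<inter> mesh k j \<in> sets borel" for k j
    using fsigma_imp_borel[OF fsigma_mesh, of k j] W by auto
  have mq: "q k \<in> borel_measurable (M \<Otimes>\<^sub>M borel)" for k
  proof -
    have "(\<lambda>z. (if W \<inter> mesh k j = {} then 0 else ennreal (Q (c k j) (fst z))) * indicator (W \<inter> mesh k j) (snd z))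
        \<in> borel_measurable (M \<Otimes>\<^sub>M borel)" for j
    proof (cases "W \<inter> mesh k j = {}")
      case False
      then have "c k j \<in> W" using c by blast
      then have "(\<lambda>z. ennreal (Q (c k j) (fst z))) \<in> borel_measurable (M \<Otimes>\<^sub>M borel)"
        using measurable_compose[OF measurable_fst meas] by measurable
      moreover have "(\<lambda>z. indicator (W \<inter> mesh k j) (snd z) :: ennreal) \<in> borel_measurable (M \<Otimes>\<^sub>M borel)"
        by (rule measurable_compose[OF measurable_snd]) (use mW in simp)
      ultimately have "(\<lambda>z. ennreal (Q (c k j) (fst z)) * indicator (W \<inter> mesh k j) (snd z)) \<in> borel_measurable (M \<Otimes>\<^sub>M borel)"
        by (rule borel_measurable_times_ennreal)
      then show ?thesis using False by simp
    qed simp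
    then show ?thesis unfolding q_def[abs_def] by (rule borel_measurable_suminf_order)
  qed
  have "(\<lambda>k. q k z) \<longlonglongrightarrow> ennreal (Q (snd z) (fst z)) * indicator W (snd z)"
    if z: "z \<in> space (M \<Otimes>\<^sub>M borel)" for z
  proof (cases "snd z \<in> W")
    case False
    then have "q k z = 0" for k unfolding q_def by (simp add: indicator_def)
    then show ?thesis using False by simp
  next
    case True
    have "\<exists>j. snd z \<in> mesh k j" for k using UN_mesh[of k] by blast
    then obtain J where J: "\<And>k. snd z \<in> mesh k (J k)" by metis
    have qk: "q k z = ennreal (Q (c k (J k)) (fst z))" for k
    proof -
      have "q k z = (\<Sum>j\<in>{J k}. (if W \<inter> mesh k j = {} then 0 else ennreal (Q (c k j) (fst z))) * indicator (W \<inter> mesh k j) (snd z))"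
        unfolding q_def
      proof (rule suminf_finite)
        fix j assume "j \<notin> {J k}"
        then have "snd z \<notin> mesh k j" using disjoint_mesh[of k] J[of k] by (auto simp: disjoint_family_on_def)
        then show "(if W \<inter> mesh k j = {} then 0 else ennreal (Q (c k j) (fst z))) * indicator (W \<inter> mesh k j) (snd z) = 0" by simp
      qed simp
      moreover have "(\<Sum>j\<in>{J k}. F j) = F (J k)" for F :: "nat \<Rightarrow> ennreal" by simp
      ultimately have "q k z = (if W \<inter> mesh k (J k) = {} then 0 else ennreal (Q (c k (J k)) (fst z))) * indicator (W \<inter> mesh k (J k)) (snd z)"
        by (simp only:)
      then show ?thesis using True J[of k] by auto
    qed
    have cJ: "c k (J k) \<in> W \<inter> mesh k (J k)" for k by (rule c[of "snd z"]) (use True J in simp)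
    have "(\<lambda>k. c k (J k)) \<longlonglongrightarrow> snd z"
    proof (rule metric_LIMSEQ_I)
      fix r :: real assume "0 < r"
      then obtain N :: nat where N: "2 / r < N" using reals_Archimedean2 by blast
      have "dist (c k (J k)) (snd z) < r" if "k \<ge> N" for k
      proof -
        have "dist (c k (J k)) (snd z) < 2 / (real k + 1)" using cJ J by (intro dist_mesh) auto
        also have "2 / (real k + 1) \<le> r" using N that \<open>0 < r\<close>
        proof -
          have "2 < real N * r" using N \<open>0 < r\<close> by (simp add: pos_divide_less_eq)
          also have "\<dots> \<le> (real k + 1) * r" using that \<open>0 < r\<close> by (intro mult_right_mono) auto
          finally show ?thesis by (simp add: pos_divide_le_eq mult.commute)
        qed
        finally show ?thesis .
      qed
      then show "\<exists>N. \<forall>k\<ge>N. dist (c k (J k)) (snd z) < r" by blast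
    qed
    moreover have "fst z \<in> space M" using z by (auto simp: space_pair_measure)
    ultimately have "(\<lambda>k. Q (c k (J k)) (fst z)) \<longlonglongrightarrow> Q (snd z) (fst z)"
      using continuous_on_tendsto_compose[OF cont, of "fst z" "\<lambda>k. c k (J k)" "snd z" sequentially] True cJ by auto
    then have "(\<lambda>k. ennreal (Q (c k (J k)) (fst z))) \<longlonglongrightarrow> ennreal (Q (snd z) (fst z))" by (rule tendsto_ennrealI)
    then show ?thesis using True by (simp add: qk)
  qed
  then show ?thesis by (rule borel_measurable_LIMSEQ_order[OF _ mq])
qed

text \<open>Only distances to the fixed point \<open>t\<close> are compared. This is what a
  derivative relative to \<open>S\<close> at \<open>t\<close> provides, and it suffices for null
  sets to have null images.\<close>

definition local_Lipschitz_at :: "'a::metric_space set \<Rightarrow> ('a \<Rightarrow> 'b::metric_space) \<Rightarrow> 'a \<Rightarrow> bool" where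
  "local_Lipschitz_at S f t \<longleftrightarrow> (\<exists>e>0. \<exists>C. \<forall>s\<in>S. dist s t < e \<longrightarrow> dist (f s) (f t) \<le> C * dist s t)"

lemma local_Lipschitz_at_cart:
  fixes f :: "'a::metric_space \<Rightarrow> real ^ 'n"
  assumes "\<And>i. local_Lipschitz_at S (\<lambda>s. f s $ i) t"
  shows "local_Lipschitz_at S f t"
proof -
  have "\<forall>i. \<exists>e. e > 0 \<and> (\<exists>C. \<forall>s\<in>S. dist s t < e \<longrightarrow> dist (f s $ i) (f t $ i) \<le> C * dist s t)"
    using assms unfolding local_Lipschitz_at_def by meson
  then obtain e where e0: "\<And>i. e i > 0"
    and e': "\<forall>i. \<exists>C. \<forall>s\<in>S. dist s t < e i \<longrightarrow> dist (f s $ i) (f t $ i) \<le> C * dist s t"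
    by (metis (no_types))
  from e' obtain C where C: "\<And>i s. s \<in> S \<Longrightarrow> dist s t < e i \<Longrightarrow> dist (f s $ i) (f t $ i) \<le> C i * dist s t"
    by (metis (no_types))
  define d where "d = Min (range e)"
  have d: "d > 0" "\<And>i. d \<le> e i" unfolding d_def using e0 by (auto simp: Min_gr_iff)
  have "dist (f s) (f t) \<le> (\<Sum>i\<in>UNIV. C i) * dist s t" if "s \<in> S" "dist s t < d" for s
  proof -
    have "dist (f s) (f t) \<le> (\<Sum>i\<in>UNIV. dist (f s $ i) (f t $ i))"
      unfolding dist_norm using norm_le_l1_cart[of "f s - f t"] by simp
    also have "\<dots> \<le> (\<Sum>i\<in>UNIV. C i * dist s t)"
      using that d(2) by (intro sum_mono C) (auto intro: less_le_trans)
    finally show ?thesis by (simp add: sum_distrib_right)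
  qed
  then show ?thesis unfolding local_Lipschitz_at_def using d(1) by blast
qed

lemma nth_eq_mult_axis: "B $ i $ j = (B *v axis j 1) $ i" for B :: "real ^ 'n ^ 'm"
  by (simp add: matrix_vector_mult_basis column_def)

lemma minus_matrix_vector_mult: "(- B) *v x = - (B *v x)" for B :: "real ^ 'n ^ 'm"
  by (simp add: matrix_vector_mult_def vec_eq_iff sum_negf)

section \<open>Regression on the value at a base point\<close>

text \<open>
  The factor 2 means that \<open>A t\<close> is close to the identity on \<open>U\<close>. In the definitions below \<open>Zp t\<close>
  is the part of \<open>Z t\<close> that is independent of \<open>Z s\<close>, \<open>Bc t i\<close> regresses the \<open>i\<close>-th row of the
  derivative, and \<open>E t\<close> is the Jacobian matrix of \<open>Y\<close>.
\<close>

locale base_point = c1_field M H I Z D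
  for M :: "'w measure" and H and I :: "(real ^ 'd) set" and Z D +
  fixes s :: "real ^ 'd" and U :: "(real ^ 'd) set" and u :: "real ^ 'd"
    and p :: "real ^ 'd \<Rightarrow> real" and K :: real
  assumes s: "s \<in> I" and U: "open U"
    and lower: "t \<in> I \<Longrightarrow> t \<in> U \<Longrightarrow> norm x \<le> 2 * norm (regression_coeff M (Z t) (Z s) *v x)"
    and p_cont: "continuous_on UNIV p" and p_nonneg: "0 \<le> p x" and p_le: "p x \<le> K"
    and p_int: "integrable lborel p"
    and p_dist: "distributed M lborel (Z s) (\<lambda>x. ennreal (p x))"
begin

definition "A t = regression_coeff M (Z t) (Z s)"
definition "Ai t = matrix_inv (A t)"
definition "Bc t i = regression_coeff M (\<lambda>\<omega>. D t \<omega> $ i) (Z s)"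
definition "Zp t \<omega> = Z t \<omega> - A t *v Z s \<omega>"
definition "Y t \<omega> = Ai t *v (u - Zp t \<omega>)"
text \<open>Differentiating \<open>A t *v Y t = u - Z t + A t *v Z s\<close> gives
  \<open>A t *v Y' = - R t\<close>, the second term being the derivative of \<open>A t\<close>
  applied to \<open>Z s - Y t\<close>. Probabilistically it is the derivative regressed on
  \<open>Z s\<close> and evaluated at the level \<open>Y t\<close>.\<close>

definition "R t \<omega> = (\<chi> i. D t \<omega> $ i - Bc t i *v (Z s \<omega> - Y t \<omega>))"
definition "E t \<omega> = - (Ai t ** R t \<omega>)"
text \<open>The variable of \<open>regression_coeff_mult\<close>: taking covariances with
  \<open>Xs x\<close> amounts to applying the regression matrix to \<open>x\<close>.\<close>

definition "Xs x \<omega> = (matrix_inv (var_matrix M (Z s)) *v x) \<bullet> Z s \<omega>"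
definition "q t \<omega> = \<bar>det (E t \<omega>)\<bar> * p (Y t \<omega>)"

lemma Xs_mem: "Xs x \<in> H"
  unfolding Xs_def[abs_def] by (rule inner_mem[OF Z_mem[OF s]])

lemma A_mult: "t \<in> I \<Longrightarrow> (A t *v x) $ i = covariance M (\<lambda>\<omega>. Z t \<omega> $ i) (Xs x)"
  unfolding A_def Xs_def[abs_def] by (rule regression_coeff_mult[OF Z_mem Z_mem[OF s]])

lemma Bc_mult: "t \<in> interior I \<Longrightarrow> (Bc t i *v x) $ k = covariance M (\<lambda>\<omega>. D t \<omega> $ i $ k) (Xs x)"
  unfolding Bc_def Xs_def[abs_def] by (rule regression_coeff_mult[OF D_mem Z_mem[OF s]])

lemma A_inj:
  assumes "t \<in> I \<inter> U"
  shows "inj ((*v) (A t))"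
  by (rule inj_of_norm_le[of 2]) (use lower assms in \<open>simp add: A_def\<close>)

lemma A_Ai: "t \<in> I \<inter> U \<Longrightarrow> A t *v (Ai t *v x) = x"
  and Ai_A: "t \<in> I \<inter> U \<Longrightarrow> Ai t *v (A t *v x) = x"
  using matrix_inv_mult[OF A_inj, of t] by (simp_all add: Ai_def matrix_vector_mul_assoc)

lemma norm_Ai: "t \<in> I \<inter> U \<Longrightarrow> norm (Ai t *v x) \<le> 2 * norm x"
  using lower[of t "Ai t *v x"] A_Ai[of t x] by (simp add: A_def)

lemma A_s: "A s = mat 1"
  unfolding A_def regression_coeff_def var_matrix_def[symmetric]
  by (rule matrix_inv_mult(1)[OF inj_positive_definite[OF posdef[OF s]]])

lemma A_Lipschitz:
  assumes "t \<in> I"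
  shows "local_Lipschitz_at I (\<lambda>t. A t *v x) t"
proof (rule local_Lipschitz_at_cart)
  fix i
  show "local_Lipschitz_at I (\<lambda>t. (A t *v x) $ i) t"
    using covariance_Z_Lipschitz[OF assms Xs_mem[of x], of i] assms
    unfolding local_Lipschitz_at_def dist_real_def by (simp add: A_mult cong: ball_cong)
qed

lemma A_cont: "continuous_on I A"
proof -
  have "continuous_on I (\<lambda>t. \<chi> i j. covariance M (\<lambda>\<omega>. Z t \<omega> $ i) (Xs (axis j 1)))"
    by (intro continuous_on_vec_lambda covariance_Z_cont Xs_mem)
  then show ?thesis
  proof (rule continuous_on_cong[THEN iffD1, rotated 2])
    fix t assume "t \<in> I"
    then show "(\<chi> i j. covariance M (\<lambda>\<omega>. Z t \<omega> $ i) (Xs (axis j 1))) = A t"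
      by (simp add: vec_eq_iff nth_eq_mult_axis[of "A t"] A_mult)
  qed simp
qed

text \<open>Covariance with a fixed variable commutes with differentiating the field, so the
  regression coefficients of the derivative are the derivatives of the regression
  coefficients.\<close>

lemma A_mult_deriv:
  assumes t: "t \<in> interior I"
  shows "((\<lambda>t'. A t' *v x) has_derivative (\<lambda>h. \<chi> i. h \<bullet> (Bc t i *v x))) (at t)"
proof -
  have "((\<lambda>t'. (A t' *v x) $ i) has_derivative (\<lambda>h. h \<bullet> (Bc t i *v x))) (at t)" for i
  proof (rule has_derivative_transform_within_open)
    show "((\<lambda>t'. covariance M (\<lambda>\<omega>. Z t' \<omega> $ i) (Xs x)) has_derivative (\<lambda>h. h \<bullet> (Bc t i *v x))) (at t)"
      using covariance_Z_deriv[OF t Xs_mem[of x], of i] by (simp add: inner_vec_def Bc_mult[OF t])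
  qed (use t interior_I A_mult in auto)
  then show ?thesis
    unfolding has_derivative_componentwise_within[of "\<lambda>t'. A t' *v x"]
    by (auto simp: Basis_cart inner_axis)
qed

lemma Z_eq_iff:
  assumes "t \<in> I \<inter> U"
  shows "Z t \<omega> = u \<longleftrightarrow> Y t \<omega> = Z s \<omega>"
proof -
  have "Y t \<omega> = Z s \<omega> \<longleftrightarrow> A t *v Y t \<omega> = A t *v Z s \<omega>"
    by (rule inj_eq[OF A_inj[OF assms], symmetric])
  also have "A t *v Y t \<omega> = (u - Z t \<omega>) + A t *v Z s \<omega>"
    unfolding Y_def A_Ai[OF assms] Zp_def by (rule diff_diff_eq2[THEN trans]) (rule diff_add_eq[symmetric])
  also have "\<dots> = A t *v Z s \<omega> \<longleftrightarrow> u = Z t \<omega>" by simp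
  finally show ?thesis by (simp only: eq_commute[of u])
qed

text \<open>Inverse matrices disappear from the increment of \<open>Y\<close>, and the matrices
  \<open>A t'\<close> and \<open>A t\<close> act on one fixed vector. The right side vanishes for
  \<open>t' = t\<close> and inherits Lipschitz bounds and derivatives from \<open>Z\<close> and
  \<open>A\<close>.\<close>

lemma A_Y_diff:
  assumes "t \<in> I \<inter> U" "t' \<in> I \<inter> U"
  shows "A t' *v (Y t' \<omega> - Y t \<omega>) = (Z t \<omega> - Z t' \<omega>) + (A t' *v (Z s \<omega> - Y t \<omega>) - A t *v (Z s \<omega> - Y t \<omega>))"
proof -
  have 1: "A t' *v Y t' \<omega> = u - Zp t' \<omega>" "A t *v Y t \<omega> = u - Zp t \<omega>"
    by (simp_all only: Y_def A_Ai[OF assms(1)] A_Ai[OF assms(2)])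
  have 2: "(u - (z' - a')) - y = (z - z') + ((a' - y) - (a - (u - (z - a))))" for z z' a a' y :: "real ^ 'd"
    by simp
  show ?thesis
    unfolding matrix_vector_mult_diff_distrib 1 Zp_def by (rule 2)
qed

text \<open>This holds up to the frontier of \<open>I\<close>, where no derivative of
  \<open>Y\<close> is available, and shows that frontier points have null image.\<close>

lemma Y_Lipschitz:
  assumes \<omega>: "\<omega> \<in> space M" and t: "t \<in> I \<inter> U"
  shows "local_Lipschitz_at (I \<inter> U) (\<lambda>t. Y t \<omega>) t"
proof -
  let ?x = "Z s \<omega> - Y t \<omega>"
  obtain e1 C1 where 1: "e1 > 0" "\<And>t'. t' \<in> I \<Longrightarrow> dist t' t < e1 \<Longrightarrow> dist (Z t' \<omega>) (Z t \<omega>) \<le> C1 * dist t' t"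
    using Z_lips[OF \<omega>] t by (metis IntD1)
  obtain e2 C2 where 2: "e2 > 0" "\<And>t'. t' \<in> I \<Longrightarrow> dist t' t < e2 \<Longrightarrow> dist (A t' *v ?x) (A t *v ?x) \<le> C2 * dist t' t"
    using A_Lipschitz[of t ?x] t unfolding local_Lipschitz_at_def by (metis IntD1)
  have "dist (Y t' \<omega>) (Y t \<omega>) \<le> (2 * (C1 + C2)) * dist t' t" if t': "t' \<in> I \<inter> U" "dist t' t < min e1 e2" for t'
  proof -
    have "dist (Y t' \<omega>) (Y t \<omega>) \<le> 2 * norm (A t' *v (Y t' \<omega> - Y t \<omega>))"
      unfolding dist_norm A_def using lower t' by blast
    also have "norm (A t' *v (Y t' \<omega> - Y t \<omega>)) \<le> dist (Z t' \<omega>) (Z t \<omega>) + dist (A t' *v ?x) (A t *v ?x)"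
      unfolding A_Y_diff[OF t t'(1)] dist_norm norm_minus_commute[of "Z t' \<omega>"] by (rule norm_triangle_ineq)
    also have "\<dots> \<le> C1 * dist t' t + C2 * dist t' t"
      using 1 2 t' by (intro add_mono) auto
    finally show ?thesis by (simp add: algebra_simps)
  qed
  then show ?thesis unfolding local_Lipschitz_at_def
    using 1(1) 2(1) by (intro exI[of _ "min e1 e2"]) auto
qed

lemma Y_cont: "\<omega> \<in> space M \<Longrightarrow> continuous_on (I \<inter> U) (\<lambda>t. Y t \<omega>)"
  by (rule continuous_on_of_local_Lipschitz)
     (use Y_Lipschitz in \<open>auto simp: local_Lipschitz_at_def\<close>)

lemma open_W: "open (interior I \<inter> U)"
  using U by auto

lemma W_sub: "t \<in> interior I \<inter> U \<Longrightarrow> t \<in> I \<inter> U"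
  using interior_I by auto

lemma Y_deriv:
  assumes \<omega>: "\<omega> \<in> space M" and t: "t \<in> interior I \<inter> U"
  shows "((\<lambda>t. Y t \<omega>) has_derivative (\<lambda>h. E t \<omega> *v h)) (at t)"
proof (rule has_derivative_solve[OF open_W t])
  let ?x = "Z s \<omega> - Y t \<omega>"
  let ?\<phi> = "\<lambda>t'. (Z t \<omega> - Z t' \<omega>) + (A t' *v ?x - A t *v ?x)"
  have tI: "t \<in> interior I" using t by auto
  show "A t' *v (Y t' \<omega> - Y t \<omega>) = ?\<phi> t'" if "t' \<in> interior I \<inter> U" for t'
    by (rule A_Y_diff[OF W_sub[OF t] W_sub[OF that]])
  show "norm x \<le> 2 * norm (A t' *v x)" if "t' \<in> interior I \<inter> U" for t' x
    unfolding A_def using lower W_sub[OF that] by blast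
  show "continuous_on (interior I \<inter> U) A"
    by (rule continuous_on_subset[OF A_cont]) (use W_sub in auto)
  have "(?\<phi> has_derivative (\<lambda>h. (0 - D t \<omega> *v h) + ((\<chi> i. h \<bullet> (Bc t i *v ?x)) - 0))) (at t)"
    by (intro has_derivative_add has_derivative_diff has_derivative_const Z_deriv[OF \<omega> tI] A_mult_deriv[OF tI])
  also have "(\<lambda>h. (0 - D t \<omega> *v h) + ((\<chi> i. h \<bullet> (Bc t i *v ?x)) - 0)) = (\<lambda>h. - (R t \<omega> *v h))"
  proof
    fix h
    have "(R t \<omega> *v h) $ i = (D t \<omega> *v h) $ i - h \<bullet> (Bc t i *v ?x)" for i
      by (simp add: matrix_vector_mul_component R_def inner_diff_left inner_diff_right inner_commute)
    then show "(0 - D t \<omega> *v h) + ((\<chi> i. h \<bullet> (Bc t i *v ?x)) - 0) = - (R t \<omega> *v h)"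
      by (simp add: vec_eq_iff)
  qed
  finally show "(?\<phi> has_derivative (\<lambda>h. - (R t \<omega> *v h))) (at t)" .
  show "?\<phi> t = 0" by simp
  show "bounded_linear ((*v) (E t \<omega>))" by (rule matrix_vector_mul_bounded_linear)
  show "A t *v (E t \<omega> *v h) = - (R t \<omega> *v h)" for h
  proof -
    have "E t \<omega> *v h = - (Ai t *v (R t \<omega> *v h))"
      by (simp add: E_def minus_matrix_vector_mult matrix_vector_mul_assoc)
    then show ?thesis
      using A_Ai[OF W_sub[OF t], of "- (R t \<omega> *v h)"] linear_neg[OF matrix_vector_mul_linear, of "Ai t" "R t \<omega> *v h"] by simp
  qed
qed

lemma Ai_cont: "continuous_on (I \<inter> U) Ai"
proof -
  have "continuous_on (I \<inter> U) (\<lambda>t. Ai t *v y)" for y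
    unfolding continuous_on_def
  proof
    fix t assume t: "t \<in> I \<inter> U"
    let ?x = "Ai t *v y"
    have "((\<lambda>t'. Ai t' *v y - Ai t *v y) \<longlongrightarrow> 0) (at t within I \<inter> U)"
    proof (rule Lim_null_comparison)
      show "\<forall>\<^sub>F t' in at t within I \<inter> U. norm (Ai t' *v y - Ai t *v y) \<le> 2 * dist (A t *v ?x) (A t' *v ?x)"
        unfolding eventually_at_topological
      proof (intro exI[of _ UNIV] conjI ballI impI)
        fix t' assume t': "t' \<in> I \<inter> U"
        \<comment> \<open>The resolvent identity; the outer factor \<open>Ai t'\<close> is bounded
          uniformly in \<open>t'\<close> by \<open>norm_Ai\<close>.\<close>
        have "Ai t' *v y - Ai t *v y = Ai t' *v (A t *v ?x - A t' *v ?x)"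
          using A_Ai[OF t] Ai_A[OF t'] by (simp add: matrix_vector_mult_diff_distrib)
        then show "norm (Ai t' *v y - Ai t *v y) \<le> 2 * dist (A t *v ?x) (A t' *v ?x)"
          using norm_Ai[OF t'] by (simp add: dist_norm)
      qed auto
      have c: "continuous_on (I \<inter> U) (\<lambda>t. A t *v ?x)"
        by (rule continuous_on_of_local_Lipschitz)
           (use A_Lipschitz[of _ ?x] in \<open>auto simp: local_Lipschitz_at_def; meson IntD1\<close>)
      then have "((\<lambda>t'. A t' *v ?x) \<longlongrightarrow> A t *v ?x) (at t within I \<inter> U)" using t by (auto simp: continuous_on_def)
      then have "((\<lambda>t'. 2 * dist (A t *v ?x) (A t' *v ?x)) \<longlongrightarrow> 2 * dist (A t *v ?x) (A t *v ?x)) (at t within I \<inter> U)"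
        by (intro tendsto_intros)
      then show "((\<lambda>t'. 2 * dist (A t *v ?x) (A t' *v ?x)) \<longlongrightarrow> 0) (at t within I \<inter> U)" by simp
    qed
    then show "((\<lambda>t'. Ai t' *v y) \<longlongrightarrow> Ai t *v y) (at t within I \<inter> U)" by (simp add: LIM_zero_iff)
  qed
  then have "continuous_on (I \<inter> U) (\<lambda>t. \<chi> i j. (Ai t *v axis j 1) $ i)"
    by (intro continuous_on_vec_lambda continuous_on_component)
  then show ?thesis by (simp add: nth_eq_mult_axis[symmetric])
qed

lemma Bc_cont: "continuous_on (interior I) (\<lambda>t. Bc t i)"
proof -
  have "continuous_on (interior I) (\<lambda>t. \<chi> k j. covariance M (\<lambda>\<omega>. D t \<omega> $ i $ k) (Xs (axis j 1)))"
    by (intro continuous_on_vec_lambda covariance_D_cont Xs_mem)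
  then show ?thesis
  proof (rule continuous_on_cong[THEN iffD1, rotated 2])
    fix t assume "t \<in> interior I"
    then show "(\<chi> k j. covariance M (\<lambda>\<omega>. D t \<omega> $ i $ k) (Xs (axis j 1))) = Bc t i"
      by (simp add: vec_eq_iff nth_eq_mult_axis[of "Bc t i"] Bc_mult)
  qed simp
qed

lemma E_cont:
  assumes \<omega>: "\<omega> \<in> space M"
  shows "continuous_on (interior I \<inter> U) (\<lambda>t. E t \<omega>)"
proof -
  let ?W = "interior I \<inter> U"
  have 1: "continuous_on ?W Ai" by (rule continuous_on_subset[OF Ai_cont]) (use W_sub in auto)
  have 2: "continuous_on ?W (\<lambda>t. Y t \<omega>)" by (rule continuous_on_subset[OF Y_cont[OF \<omega>]]) (use W_sub in auto)
  have 3: "continuous_on ?W (\<lambda>t. D t \<omega>)" by (rule continuous_on_subset[OF D_cont[OF \<omega>]]) auto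
  have 4: "continuous_on ?W (\<lambda>t. Bc t i)" for i by (rule continuous_on_subset[OF Bc_cont]) auto
  show ?thesis
    unfolding E_def R_def matrix_matrix_mult_def matrix_vector_mult_def
    by (intro continuous_intros continuous_on_vec_lambda continuous_on_component) (use 1 2 3 4 in auto)
qed

lemma q_cont:
  assumes \<omega>: "\<omega> \<in> space M"
  shows "continuous_on (interior I \<inter> U) (\<lambda>t. q t \<omega>)"
proof -
  have 2: "continuous_on (interior I \<inter> U) (\<lambda>t. Y t \<omega>)" by (rule continuous_on_subset[OF Y_cont[OF \<omega>]]) (use W_sub in auto)
  show ?thesis
    unfolding q_def det_def
    by (intro continuous_intros continuous_on_compose2[OF p_cont 2] continuous_on_component E_cont[OF \<omega>]) auto
qed

lemma Zp_mem: "t \<in> I \<Longrightarrow> (\<lambda>\<omega>. Zp t \<omega> $ i) \<in> H"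
  unfolding Zp_def by (simp, intro H_intros matrix_vector_mem Z_mem s)

lemma Y_mem: "t \<in> I \<Longrightarrow> (\<lambda>\<omega>. Y t \<omega> $ i) \<in> H"
  unfolding Y_def by (rule matrix_vector_mem) (simp, intro H_intros Zp_mem)

text \<open>\<open>Ai t\<close> and \<open>Bc t l\<close> are deterministic and \<open>Y\<close> is
  affine in the field, so each entry is an affine combination of members of \<open>H\<close>. Hence
  it is Gaussian and has moments of all orders.\<close>

lemma E_mem:
  assumes "t \<in> interior I"
  shows "(\<lambda>\<omega>. E t \<omega> $ i $ j) \<in> H"
proof -
  have 1: "(\<lambda>\<omega>. (Bc t l *v (Z s \<omega> - Y t \<omega>)) $ j) \<in> H" for l
    by (rule matrix_vector_mem) (simp, intro H_intros Z_mem Y_mem s interior_I assms)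
  have "(\<lambda>\<omega>. - (\<Sum>l\<in>UNIV. Ai t $ i $ l * (D t \<omega> $ l $ j - (Bc t l *v (Z s \<omega> - Y t \<omega>)) $ j))) \<in> H"
    by (intro H_intros D_mem assms 1)
  then show ?thesis by (simp add: E_def R_def matrix_matrix_mult_def)
qed

text \<open>The bound depends on the sample point; that is all \<open>second_moment_bounded\<close>
  asks for to give second moments uniform in \<open>t\<close>.\<close>

lemma E_bdd:
  assumes \<omega>: "\<omega> \<in> space M"
  shows "\<exists>C. \<forall>t\<in>interior I \<inter> U. \<bar>E t \<omega> $ i $ j\<bar> \<le> C"
proof -
  obtain CD where CD: "\<And>t. t \<in> interior I \<Longrightarrow> norm (D t \<omega>) \<le> CD" using D_bdd[OF \<omega>] by blast
  obtain CZ where CZ: "\<And>t. t \<in> I \<Longrightarrow> norm (Z t \<omega>) \<le> CZ" using Z_bdd[OF \<omega>] by blast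
  have "compact ((\<lambda>t. A t *v Z s \<omega>) ` I)"
    by (intro compact_continuous_image compact_I continuous_on_of_local_Lipschitz)
       (use A_Lipschitz[of _ "Z s \<omega>"] in \<open>auto simp: local_Lipschitz_at_def\<close>)
  from compact_imp_bounded[OF this]
  obtain CA where CA: "\<And>t. t \<in> I \<Longrightarrow> norm (A t *v Z s \<omega>) \<le> CA"
    unfolding bounded_iff by auto
  have Y: "norm (Y t \<omega>) \<le> 2 * (norm u + (CZ + CA))" if t: "t \<in> I \<inter> U" for t
  proof -
    have "norm (Y t \<omega>) \<le> 2 * norm (u - Zp t \<omega>)" unfolding Y_def by (rule norm_Ai[OF t])
    also have "norm (u - Zp t \<omega>) \<le> norm u + norm (Zp t \<omega>)" by (rule norm_triangle_ineq4)
    also have "norm (Zp t \<omega>) \<le> norm (Z t \<omega>) + norm (A t *v Z s \<omega>)"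
      unfolding Zp_def by (rule norm_triangle_ineq4)
    also have "\<dots> \<le> CZ + CA" using t by (intro add_mono CZ CA) auto
    finally show ?thesis by simp
  qed
  define CB where "CB l m = (SOME C. \<forall>t\<in>interior I. \<bar>covariance M (\<lambda>\<omega>. D t \<omega> $ l $ j) (Xs (axis m 1))\<bar> \<le> C)" for l m
  have CB: "\<bar>covariance M (\<lambda>\<omega>. D t \<omega> $ l $ j) (Xs (axis m 1))\<bar> \<le> CB l m" if "t \<in> interior I" for l m t
    using someI_ex[OF covariance_D_bdd[OF Xs_mem, where i=l and k=j], of "axis m 1"] that unfolding CB_def by blast
  let ?X = "norm (Z s \<omega>) + 2 * (norm u + (CZ + CA))"
  have R: "\<bar>R t \<omega> $ l $ j\<bar> \<le> CD + (\<Sum>m\<in>UNIV. CB l m * ?X)" if t: "t \<in> interior I \<inter> U" for t l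
  proof -
    have tI: "t \<in> interior I" using t by auto
    have "\<bar>D t \<omega> $ l $ j\<bar> \<le> CD"
      using order.trans[OF component_le_norm_cart[of "D t \<omega> $ l" j] Finite_Cartesian_Product.norm_nth_le[of "D t \<omega>" l]] CD[OF tI] by simp
    moreover have "\<bar>(Bc t l *v (Z s \<omega> - Y t \<omega>)) $ j\<bar> \<le> (\<Sum>m\<in>UNIV. CB l m * ?X)"
    proof -
      have "\<bar>(Bc t l *v (Z s \<omega> - Y t \<omega>)) $ j\<bar> \<le> (\<Sum>m\<in>UNIV. \<bar>Bc t l $ j $ m * (Z s \<omega> - Y t \<omega>) $ m\<bar>)"
        unfolding matrix_vector_mult_def by (simp add: sum_abs)
      also have "\<dots> \<le> (\<Sum>m\<in>UNIV. CB l m * ?X)"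
      proof (rule sum_mono)
        fix m
        have "\<bar>Bc t l $ j $ m\<bar> \<le> CB l m"
          unfolding nth_eq_mult_axis[of "Bc t l"] Bc_mult[OF tI] by (rule CB[OF tI])
        moreover have "\<bar>(Z s \<omega> - Y t \<omega>) $ m\<bar> \<le> ?X"
          using component_le_norm_cart[of "Z s \<omega> - Y t \<omega>" m] norm_triangle_ineq4[of "Z s \<omega>" "Y t \<omega>"] Y[OF W_sub[OF t]]
          by linarith
        ultimately show "\<bar>Bc t l $ j $ m * (Z s \<omega> - Y t \<omega>) $ m\<bar> \<le> CB l m * ?X"
          unfolding abs_mult by (intro mult_mono) auto
      qed
      finally show ?thesis .
    qed
    ultimately show ?thesis by (simp add: R_def)
  qed
  have "\<bar>E t \<omega> $ i $ j\<bar> \<le> 2 * (\<Sum>l\<in>UNIV. CD + (\<Sum>m\<in>UNIV. CB l m * ?X))" if t: "t \<in> interior I \<inter> U" for t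
  proof -
    have "E t \<omega> $ i $ j = - (Ai t *v (R t \<omega> *v axis j 1)) $ i"
      by (simp add: E_def matrix_vector_mul_assoc nth_eq_mult_axis[symmetric])
    then have "\<bar>E t \<omega> $ i $ j\<bar> \<le> norm (Ai t *v (R t \<omega> *v axis j 1))"
      using component_le_norm_cart[of "Ai t *v (R t \<omega> *v axis j 1)" i] by simp
    also have "\<dots> \<le> 2 * norm (R t \<omega> *v axis j 1)" by (rule norm_Ai[OF W_sub[OF t]])
    also have "norm (R t \<omega> *v axis j 1) \<le> (\<Sum>l\<in>UNIV. \<bar>R t \<omega> $ l $ j\<bar>)"
      using norm_le_l1_cart[of "R t \<omega> *v axis j 1"] by (simp add: nth_eq_mult_axis[symmetric])
    also have "\<dots> \<le> (\<Sum>l\<in>UNIV. CD + (\<Sum>m\<in>UNIV. CB l m * ?X))" by (intro sum_mono R t)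
    finally show ?thesis by simp
  qed
  then show ?thesis by blast
qed

lemma q_nonneg: "0 \<le> q t \<omega>"
  by (simp add: q_def p_nonneg)

lemma q_measurable:
  assumes "t \<in> interior I"
  shows "q t \<in> borel_measurable M"
proof -
  have [measurable]: "(\<lambda>\<omega>. E t \<omega> $ i $ j) \<in> borel_measurable M" for i j
    by (rule measurable_mem[OF E_mem[OF assms]])
  have [measurable]: "Y t \<in> borel_measurable M"
    by (rule measurable_vec_lambda_borel) (rule measurable_mem[OF Y_mem[OF interior_I[OF assms]]])
  have [measurable]: "p \<in> borel_measurable borel" by (rule borel_measurable_continuous_onI[OF p_cont])
  show ?thesis unfolding q_def[abs_def] det_def by measurable
qed

text \<open>\<open>p\<close> is bounded by \<open>K\<close>, the squared determinant by powers of
  the entries of \<open>E\<close>, and the Gaussian moment bound leads from these powers back to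
  second moments, which are uniform in \<open>t\<close>.\<close>

lemma q_square:
  shows "\<exists>C. \<forall>t\<in>interior I \<inter> U. integrable M (\<lambda>\<omega>. (q t \<omega>)\<^sup>2) \<and> expectation (\<lambda>\<omega>. (q t \<omega>)\<^sup>2) \<le> C"
proof -
  let ?n = "CARD('d)"
  have "\<forall>i j. \<exists>C. \<forall>t\<in>interior I \<inter> U. expectation (\<lambda>\<omega>. (E t \<omega> $ i $ j)\<^sup>2) \<le> C"
    using second_moment_bounded[of "interior I \<inter> U" "\<lambda>t \<omega>. E t \<omega> $ _ $ _", OF E_mem E_bdd] by blast
  then obtain C where C: "\<And>i j t. t \<in> interior I \<inter> U \<Longrightarrow> expectation (\<lambda>\<omega>. (E t \<omega> $ i $ j)\<^sup>2) \<le> C i j" by metis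
  let ?f = "\<lambda>t \<omega>. K\<^sup>2 * ((fact ?n)\<^sup>2 * (\<Sum>i\<in>UNIV. \<Sum>j\<in>UNIV. (E t \<omega> $ i $ j) ^ (2 * ?n)))"
  let ?C = "K\<^sup>2 * ((fact ?n)\<^sup>2 * (\<Sum>i\<in>UNIV. \<Sum>j\<in>UNIV. gauss_const ?n * (C i j) ^ ?n))"
  have "integrable M (\<lambda>\<omega>. (q t \<omega>)\<^sup>2) \<and> expectation (\<lambda>\<omega>. (q t \<omega>)\<^sup>2) \<le> ?C" if t: "t \<in> interior I \<inter> U" for t
  proof -
    have tI: "t \<in> interior I" using t by auto
    have ii: "integrable M (\<lambda>\<omega>. (E t \<omega> $ i $ j) ^ (2 * ?n))" for i j
      by (rule gaussian_rv_integrable_power[OF gaussian[OF E_mem[OF tI]]])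
    have if': "integrable M (?f t)"
      by (intro integrable_mult_right Bochner_Integration.integrable_sum ii)
    have le: "(q t \<omega>)\<^sup>2 \<le> ?f t \<omega>" for \<omega>
    proof -
      have "(q t \<omega>)\<^sup>2 = (p (Y t \<omega>))\<^sup>2 * (det (E t \<omega>))\<^sup>2" by (simp add: q_def power_mult_distrib mult.commute)
      also have "\<dots> \<le> K\<^sup>2 * ((fact ?n)\<^sup>2 * (\<Sum>i\<in>UNIV. \<Sum>j\<in>UNIV. (E t \<omega> $ i $ j) ^ (2 * ?n)))"
        using p_nonneg p_le by (intro mult_mono det_square_le power_mono) auto
      finally show ?thesis .
    qed
    have iq: "integrable M (\<lambda>\<omega>. (q t \<omega>)\<^sup>2)"
    proof (rule Bochner_Integration.integrable_bound[OF if'])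
      show "(\<lambda>\<omega>. (q t \<omega>)\<^sup>2) \<in> borel_measurable M" using q_measurable[OF tI] by measurable
      show "AE \<omega> in M. norm ((q t \<omega>)\<^sup>2) \<le> norm (?f t \<omega>)"
        by (rule AE_I2) (use le in \<open>auto intro: order.trans[OF _ abs_ge_self]\<close>)
    qed
    have "expectation (\<lambda>\<omega>. (q t \<omega>)\<^sup>2) \<le> expectation (?f t)"
      by (rule integral_mono[OF iq if' le])
    also have "\<dots> = K\<^sup>2 * ((fact ?n)\<^sup>2 * (\<Sum>i\<in>UNIV. \<Sum>j\<in>UNIV. expectation (\<lambda>\<omega>. (E t \<omega> $ i $ j) ^ (2 * ?n))))"
      using ii by (simp add: Bochner_Integration.integral_sum Bochner_Integration.integrable_sum)
    also have "\<dots> \<le> ?C"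
    proof (intro mult_left_mono sum_mono)
      fix i j
      have "expectation (\<lambda>\<omega>. (E t \<omega> $ i $ j) ^ (2 * ?n)) \<le> gauss_const ?n * (expectation (\<lambda>\<omega>. (E t \<omega> $ i $ j)\<^sup>2)) ^ ?n"
        by (rule gaussian_rv_moment_le[OF gaussian[OF E_mem[OF tI]]])
      also have "\<dots> \<le> gauss_const ?n * (C i j) ^ ?n"
        using gauss_const_ge_1[of ?n] C[OF t]
        by (intro mult_left_mono power_mono) (auto intro!: integral_nonneg_AE)
      finally show "expectation (\<lambda>\<omega>. (E t \<omega> $ i $ j) ^ (2 * ?n)) \<le> gauss_const ?n * (C i j) ^ ?n" .
    qed auto
    finally show ?thesis using iq by blast
  qed
  then show ?thesis by blast
qed

end

lemma abs_det_minus: "\<bar>det (- B)\<bar> = \<bar>det B\<bar>" for B :: "real ^ 'n ^ 'n"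
proof -
  have "det (- B) = det (\<chi> i. (-1) *s (B $ i))"
    by (rule arg_cong[where f=det]) (simp add: vec_eq_iff)
  also have "\<dots> = (\<Prod>i\<in>(UNIV :: 'n set). -1) * det (\<chi> i. B $ i)"
    by (rule det_rows_mul)
  finally show ?thesis by (simp add: abs_mult power_abs)
qed

section \<open>The local density and its value at the base point\<close>

context base_point
begin

definition "g t = expectation (q t)"

lemma q_integrable:
  assumes "t \<in> interior I \<inter> U"
  shows "integrable M (q t)" "g t \<le> 1 + expectation (\<lambda>\<omega>. (q t \<omega>)\<^sup>2)"
proof -
  have sq: "integrable M (\<lambda>\<omega>. (q t \<omega>)\<^sup>2)" using q_square assms by blast
  have le: "q t \<omega> \<le> 1 + (q t \<omega>)\<^sup>2" for \<omega>
  proof -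
    have "0 \<le> (q t \<omega> - 1)\<^sup>2" by simp
    then have "2 * q t \<omega> \<le> 1 + (q t \<omega>)\<^sup>2" by (simp add: power2_diff)
    then show ?thesis using q_nonneg[of t \<omega>] by linarith
  qed
  show i: "integrable M (q t)"
  proof (rule Bochner_Integration.integrable_bound)
    show "integrable M (\<lambda>\<omega>. 1 + (q t \<omega>)\<^sup>2)" using sq by simp
    show "q t \<in> borel_measurable M" using assms q_measurable by auto
    show "AE \<omega> in M. norm (q t \<omega>) \<le> norm (1 + (q t \<omega>)\<^sup>2)"
      using le q_nonneg by (intro AE_I2) (simp add: abs_of_nonneg)
  qed
  have "g t \<le> expectation (\<lambda>\<omega>. 1 + (q t \<omega>)\<^sup>2)"
    unfolding g_def by (rule integral_mono[OF i]) (use sq le in auto)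
  then show "g t \<le> 1 + expectation (\<lambda>\<omega>. (q t \<omega>)\<^sup>2)" using sq by (simp add: prob_space)
qed

lemma g_nonneg: "0 \<le> g t"
  unfolding g_def by (rule integral_nonneg_AE) (simp add: q_nonneg)

lemma g_bdd: "\<exists>C. \<forall>t\<in>interior I \<inter> U. g t \<le> C"
proof -
  obtain C where "\<And>t. t \<in> interior I \<inter> U \<Longrightarrow> expectation (\<lambda>\<omega>. (q t \<omega>)\<^sup>2) \<le> C" using q_square by blast
  then have "\<forall>t\<in>interior I \<inter> U. g t \<le> 1 + C" using q_integrable(2) by fastforce
  then show ?thesis by blast
qed

lemma nn_integral_q: "t \<in> interior I \<inter> U \<Longrightarrow> (\<integral>\<^sup>+\<omega>. ennreal (q t \<omega>) \<partial>M) = ennreal (g t)"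
  unfolding g_def by (rule nn_integral_eq_integral[OF q_integrable(1)]) (auto simp: q_nonneg)

lemma g_cont: "continuous_on (interior I \<inter> U) g"
  unfolding continuous_on_sequentially o_def
proof (intro allI ballI impI, elim conjE)
  fix y t assume t: "t \<in> interior I \<inter> U" and y: "\<forall>n. y n \<in> interior I \<inter> U" "y \<longlonglongrightarrow> t"
  obtain C where C: "\<And>t. t \<in> interior I \<inter> U \<Longrightarrow> integrable M (\<lambda>\<omega>. (q t \<omega>)\<^sup>2) \<and> expectation (\<lambda>\<omega>. (q t \<omega>)\<^sup>2) \<le> C"
    using q_square by blast
  show "(\<lambda>n. g (y n)) \<longlonglongrightarrow> g t"
    unfolding g_def
  proof (rule expectation_tendsto_of_square_bounded)
    show "AE \<omega> in M. (\<lambda>n. q (y n) \<omega>) \<longlonglongrightarrow> q t \<omega>"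
      using q_cont t y unfolding continuous_on_sequentially o_def by (intro AE_I2) blast
  qed (use y t C q_measurable q_nonneg in auto)
qed

text \<open>Since \<open>A s\<close> is the identity, \<open>Zp s\<close> is zero and
  \<open>Y s\<close> is the constant \<open>u\<close>. The factor \<open>p u\<close> therefore
  leaves the expectation, and \<open>R s\<close> becomes the Gaussian regression of the derivative
  at level \<open>u\<close>.\<close>

lemma g_s:
  assumes sI: "s \<in> interior I" and sU: "s \<in> U"
  shows "ennreal (g s) = (\<integral>\<^sup>+\<omega>. ennreal \<bar>det (\<chi> i. D s \<omega> $ i - Bc s i *v Z s \<omega> + Bc s i *v u)\<bar> \<partial>M) * ennreal (p u)"
proof -
  have AiA: "Ai s = mat 1"
    using matrix_inv_mult(2)[of "A s"] A_s by (simp add: Ai_def inj_on_def)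
  have Ys: "Y s \<omega> = u" for \<omega> by (simp add: Y_def AiA Zp_def A_s)
  have Es: "E s \<omega> = - (\<chi> i. D s \<omega> $ i - Bc s i *v Z s \<omega> + Bc s i *v u)" for \<omega>
    by (simp add: E_def AiA R_def Ys matrix_vector_mult_diff_distrib diff_diff_eq2 diff_add_eq)
  have qs: "q s \<omega> = \<bar>det (\<chi> i. D s \<omega> $ i - Bc s i *v Z s \<omega> + Bc s i *v u)\<bar> * p u" for \<omega>
    by (simp add: q_def Ys Es abs_det_minus)
  have [measurable]: "(\<lambda>\<omega>. E s \<omega> $ i $ j) \<in> borel_measurable M" for i j
    by (rule measurable_mem[OF E_mem[OF sI]])
  have m: "(\<lambda>\<omega>. \<bar>det (E s \<omega>)\<bar>) \<in> borel_measurable M" unfolding det_def by measurable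
  have m': "(\<lambda>\<omega>. ennreal \<bar>det (\<chi> i. D s \<omega> $ i - Bc s i *v Z s \<omega> + Bc s i *v u)\<bar>) \<in> borel_measurable M"
    using m unfolding Es abs_det_minus by simp
  have "ennreal (g s) = (\<integral>\<^sup>+\<omega>. ennreal (q s \<omega>) \<partial>M)" using nn_integral_q sI sU by auto
  also have "\<dots> = (\<integral>\<^sup>+\<omega>. ennreal \<bar>det (\<chi> i. D s \<omega> $ i - Bc s i *v Z s \<omega> + Bc s i *v u)\<bar> * ennreal (p u) \<partial>M)"
    by (rule nn_integral_cong) (simp add: qs ennreal_mult p_nonneg)
  also have "\<dots> = (\<integral>\<^sup>+\<omega>. ennreal \<bar>det (\<chi> i. D s \<omega> $ i - Bc s i *v Z s \<omega> + Bc s i *v u)\<bar> \<partial>M) * ennreal (p u)"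
    by (rule nn_integral_multc[OF m'])
  finally show ?thesis .
qed

lemma local_formula:
  assumes B: "fsigma B" "B \<subseteq> I \<inter> U"
  shows "(\<integral>\<^sup>+\<omega>. count_preimage (\<lambda>t. Z t \<omega>) B u \<partial>M) = (\<integral>\<^sup>+t\<in>B \<inter> interior I. ennreal (g t) \<partial>lborel)"
proof -
  \<comment> \<open>\<open>Y\<close> is built from \<open>Zp\<close> alone, hence measurable for the
    sigma-algebra generated by \<open>C\<close>, whose members are uncorrelated with
    \<open>Z s\<close>.\<close>
  define C where "C = {(\<lambda>\<omega>. Zp t \<omega> $ i) | t i. t \<in> I}"
  let ?F = "generated_sigma (space M) C"
  have mZp [measurable]: "(\<lambda>\<omega>. Zp t \<omega> $ i) \<in> borel_measurable ?F" if "t \<in> I" for t i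
    by (rule measurable_generated_sigma) (use that in \<open>auto simp: C_def\<close>)
  have mY: "Y t \<in> borel_measurable ?F" if t: "t \<in> B" for t
  proof (rule measurable_vec_lambda_borel)
    fix i
    have "t \<in> I" using t B by auto
    note [measurable] = mZp[OF this]
    show "(\<lambda>\<omega>. Y t \<omega> $ i) \<in> borel_measurable ?F"
      unfolding Y_def matrix_vector_mult_def by simp
  qed
  have cY: "continuous_on B (\<lambda>t. Y t \<omega>)" if "\<omega> \<in> space ?F" for \<omega>
    using that by (intro continuous_on_subset[OF Y_cont B(2)]) simp
  have mG: "(\<lambda>z. count_preimage (\<lambda>t. Y t (fst z)) B (snd z)) \<in> borel_measurable (?F \<Otimes>\<^sub>M borel)"
    by (rule measurable_count_preimage[OF B(1) mY cY])
  have "(\<integral>\<^sup>+\<omega>. count_preimage (\<lambda>t. Z t \<omega>) B u \<partial>M) = (\<integral>\<^sup>+\<omega>. count_preimage (\<lambda>t. Y t \<omega>) B (Z s \<omega>) \<partial>M)"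
  proof (rule nn_integral_cong)
    fix \<omega>
    have "{t \<in> B. Z t \<omega> = u} = {t \<in> B. Y t \<omega> = Z s \<omega>}" using Z_eq_iff B(2) by blast
    then show "count_preimage (\<lambda>t. Z t \<omega>) B u = count_preimage (\<lambda>t. Y t \<omega>) B (Z s \<omega>)"
      by (simp only: count_preimage_def)
  qed
  also have "\<dots> = (\<integral>\<^sup>+\<omega>. (\<integral>\<^sup>+x. count_preimage (\<lambda>t. Y t \<omega>) B x * ennreal (p x) \<partial>lborel) \<partial>M)"
  proof (rule nn_integral_uncorrelated[where C=C and G="\<lambda>\<omega>. count_preimage (\<lambda>t. Y t \<omega>) B"])
    show "C \<subseteq> H" unfolding C_def using Zp_mem by blast
    show "(\<lambda>\<omega>. Z s \<omega> $ j) \<in> H" for j by (rule Z_mem[OF s])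
    show "covariance M X (\<lambda>\<omega>. Z s \<omega> $ j) = 0" if "X \<in> C" for X j
    proof -
      obtain t i where "t \<in> I" "X = (\<lambda>\<omega>. Zp t \<omega> $ i)" using \<open>X \<in> C\<close> unfolding C_def by blast
      then show ?thesis
        using regression_residual_uncorrelated[OF Z_mem[of t i] Z_mem[OF s] posdef[OF s]]
        by (simp add: Zp_def A_def)
    qed
  qed (fact p_dist mG)+
  also have "\<dots> = (\<integral>\<^sup>+\<omega>. (\<integral>\<^sup>+t\<in>B \<inter> interior I. ennreal (q t \<omega>) \<partial>lborel) \<partial>M)"
  proof (rule nn_integral_cong)
    fix \<omega> assume \<omega>: "\<omega> \<in> space M"
    let ?N = "(\<lambda>t. Y t \<omega>) ` (B - interior I)"
    have BI: "fsigma (B \<inter> interior I)" by (intro fsigma_Int B open_imp_fsigma open_interior)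
    have "negligible (frontier I)"
      unfolding negligible_iff_null_sets using frontier_null
      by (intro null_sets_completionI null_setsI) auto
    moreover have "B - interior I \<subseteq> frontier I"
      using B(2) compact_I by (auto simp: frontier_def compact_imp_closed)
    ultimately have neg: "negligible (B - interior I)" by (rule negligible_subset)
    have "negligible ?N"
    proof (rule negligible_locally_Lipschitz_image[OF _ neg])
      fix t assume t: "t \<in> B - interior I"
      then obtain e C where e: "e > 0" "\<And>t'. t' \<in> I \<inter> U \<Longrightarrow> dist t' t < e \<Longrightarrow> dist (Y t' \<omega>) (Y t \<omega>) \<le> C * dist t' t"
        using Y_Lipschitz[OF \<omega>, of t] B(2) unfolding local_Lipschitz_at_def by blast
      show "\<exists>T C. open T \<and> t \<in> T \<and> (\<forall>y\<in>(B - interior I) \<inter> T. norm (Y y \<omega> - Y t \<omega>) \<le> C * norm (y - t))"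
      proof (intro exI[of _ "ball t e"] exI[of _ C] conjI ballI)
        fix y assume y: "y \<in> (B - interior I) \<inter> ball t e"
        then have "y \<in> I \<inter> U" "dist y t < e" using B(2) by (auto simp: dist_commute)
        then show "norm (Y y \<omega> - Y t \<omega>) \<le> C * norm (y - t)" using e(2) by (simp only: dist_norm)
      qed (use e(1) in auto)
    qed simp
    then have "AE x in lebesgue. x \<notin> ?N"
      unfolding negligible_iff_null_sets by (rule AE_not_in)
    then have AEN: "AE x in lborel. x \<notin> ?N"
      by (simp only: AE_completion_iff)
    have "(\<integral>\<^sup>+x. count_preimage (\<lambda>t. Y t \<omega>) B x * ennreal (p x) \<partial>lborel) =
       (\<integral>\<^sup>+x. count_preimage (\<lambda>t. Y t \<omega>) (B \<inter> interior I) x * ennreal (p x) \<partial>lborel)"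
    proof (rule nn_integral_cong_AE)
      show "AE x in lborel. count_preimage (\<lambda>t. Y t \<omega>) B x * ennreal (p x) =
        count_preimage (\<lambda>t. Y t \<omega>) (B \<inter> interior I) x * ennreal (p x)"
        using AEN
      proof eventually_elim
        case (elim x)
        then have "{t \<in> B. Y t \<omega> = x} = {t \<in> B \<inter> interior I. Y t \<omega> = x}" by blast
        then show ?case by (simp only: count_preimage_def)
      qed
    qed
    also have "\<dots> = (\<integral>\<^sup>+t\<in>B \<inter> interior I. ennreal (\<bar>det (E t \<omega>)\<bar> * p (Y t \<omega>)) \<partial>lborel)"
      by (rule area_formula[OF open_W BI _ Y_deriv[OF \<omega>] E_cont[OF \<omega>] p_int p_cont p_nonneg]) (use B(2) in auto)
    finally show "(\<integral>\<^sup>+x. count_preimage (\<lambda>t. Y t \<omega>) B x * ennreal (p x) \<partial>lborel) = (\<integral>\<^sup>+t\<in>B \<inter> interior I. ennreal (q t \<omega>) \<partial>lborel)"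
      by (simp add: q_def)
  qed
  also have "\<dots> = (\<integral>\<^sup>+t. (\<integral>\<^sup>+\<omega>. ennreal (q t \<omega>) * indicator (B \<inter> interior I) t \<partial>M) \<partial>lborel)"
  proof -
    interpret P: pair_sigma_finite M "lborel :: (real ^ 'd) measure"
      by (intro pair_sigma_finite.intro sigma_finite_lborel) (rule sigma_finite_measure_axioms)
    have Bb: "B \<in> sets borel" by (rule fsigma_imp_borel[OF B(1)])
    \<comment> \<open>Joint measurability for Fubini comes from continuity in \<open>t\<close> on an
      open set; \<open>indicator B\<close> is multiplied in afterwards, as \<open>B\<close> need not
      be open.\<close>
    have "(\<lambda>z. ennreal (q (snd z) (fst z)) * indicator (interior I \<inter> U) (snd z)) \<in> borel_measurable (M \<Otimes>\<^sub>M borel)"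
      by (rule measurable_caratheodory[OF open_W]) (use q_measurable q_cont in auto)
    moreover have "(\<lambda>z. indicator B (snd z) :: ennreal) \<in> borel_measurable (M \<Otimes>\<^sub>M borel)"
      by (rule measurable_compose[OF measurable_snd]) (use Bb in simp)
    ultimately have "(\<lambda>z. (ennreal (q (snd z) (fst z)) * indicator (interior I \<inter> U) (snd z)) * indicator B (snd z)) \<in> borel_measurable (M \<Otimes>\<^sub>M borel)"
      by (rule borel_measurable_times_ennreal)
    also have "(\<lambda>z. (ennreal (q (snd z) (fst z)) * indicator (interior I \<inter> U) (snd z)) * indicator B (snd z)) =
      (\<lambda>z. ennreal (q (snd z) (fst z)) * indicator (B \<inter> interior I) (snd z))"
      using B(2) by (auto simp: fun_eq_iff indicator_def)
    also have "(\<dots> \<in> borel_measurable (M \<Otimes>\<^sub>M borel)) = (\<dots> \<in> borel_measurable (M \<Otimes>\<^sub>M lborel))"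
      by (rule arg_cong2[where f="(\<in>)", OF refl]) (intro measurable_cong_sets sets_pair_measure_cong, auto)
    finally have "(\<lambda>z. ennreal (q (snd z) (fst z)) * indicator (B \<inter> interior I) (snd z)) \<in> borel_measurable (M \<Otimes>\<^sub>M lborel)" .
    from P.Fubini[OF this] show ?thesis by simp
  qed
  also have "\<dots> = (\<integral>\<^sup>+t\<in>B \<inter> interior I. ennreal (g t) \<partial>lborel)"
  proof (rule nn_integral_cong)
    fix t
    show "(\<integral>\<^sup>+\<omega>. ennreal (q t \<omega>) * indicator (B \<inter> interior I) t \<partial>M) = ennreal (g t) * indicator (B \<inter> interior I) t"
    proof (cases "t \<in> B \<inter> interior I")
      case True
      then have "t \<in> interior I \<inter> U" using B(2) by auto
      then show ?thesis using True nn_integral_q by simp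
    qed simp
  qed
  finally show ?thesis .
qed

end

section \<open>The Kac--Rice formula\<close>

text \<open>If \<open>h t < g t\<close>, the values at one and two thirds between them separate the
  functions on a small ball, whose volume is positive and finite; the integrals over it would
  differ. Equality follows by exchanging the roles of \<open>g\<close> and \<open>h\<close>.\<close>

lemma continuous_density_eq:
  fixes g h :: "'a::euclidean_space \<Rightarrow> real"
  assumes W: "open W" "t \<in> W" and g: "continuous_on W g" and h: "continuous_on W h"
    and nn: "\<And>x. x \<in> W \<Longrightarrow> 0 \<le> g x" "\<And>x. x \<in> W \<Longrightarrow> 0 \<le> h x"
    and eq: "\<And>r. 0 < r \<Longrightarrow> ball t r \<subseteq> W \<Longrightarrow>
      (\<integral>\<^sup>+x\<in>ball t r. ennreal (g x) \<partial>lborel) = (\<integral>\<^sup>+x\<in>ball t r. ennreal (h x) \<partial>lborel)"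
  shows "g t \<le> h t"
proof (rule ccontr)
  assume "\<not> g t \<le> h t"
  then have gt: "h t < g t" by simp
  define c where "c = (2 * h t + g t) / 3"
  define d where "d = (h t + 2 * g t) / 3"
  have cd: "h t < c" "c < d" "d < g t" using gt by (auto simp: c_def d_def)
  have c0: "0 \<le> c" using nn(2)[OF W(2)] cd by linarith
  have "((\<lambda>x. g x) \<longlongrightarrow> g t) (at t)" "((\<lambda>x. h x) \<longlongrightarrow> h t) (at t)"
    using g h W by (auto simp: continuous_on_eq_continuous_at isCont_def)
  then have "\<forall>\<^sub>F x in at t. d < g x" "\<forall>\<^sub>F x in at t. h x < c"
    using cd by (auto intro: order_tendstoD)
  moreover have "\<forall>\<^sub>F x in at t. x \<in> W" using W by (auto simp: eventually_at_topological)
  ultimately have "\<forall>\<^sub>F x in at t. d < g x \<and> h x < c \<and> x \<in> W" by eventually_elim auto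
  then obtain r where r: "r > 0" "\<And>x. dist x t < r \<Longrightarrow> x \<noteq> t \<Longrightarrow> d < g x \<and> h x < c \<and> x \<in> W"
    unfolding eventually_at by blast
  have b: "d < g x \<and> h x < c \<and> x \<in> W" if "x \<in> ball t r" for x
    using r(2)[of x] that cd W(2) by (cases "x = t") (auto simp: dist_commute)
  have b': "ennreal d \<le> ennreal (g x)" "ennreal (h x) \<le> ennreal c" if "x \<in> ball t r" for x
    using b[OF that] by (auto intro!: ennreal_leI)
  let ?v = "emeasure lborel (ball t r)"
  have "ennreal d * ?v = (\<integral>\<^sup>+x\<in>ball t r. ennreal d \<partial>lborel)" by (simp add: nn_integral_cmult_indicator)
  also have "\<dots> \<le> (\<integral>\<^sup>+x\<in>ball t r. ennreal (g x) \<partial>lborel)"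
    by (rule nn_integral_mono) (use b' in \<open>auto simp: indicator_def\<close>)
  also have "\<dots> = (\<integral>\<^sup>+x\<in>ball t r. ennreal (h x) \<partial>lborel)" by (rule eq) (use r(1) b in auto)
  also have "\<dots> \<le> (\<integral>\<^sup>+x\<in>ball t r. ennreal c \<partial>lborel)"
    by (rule nn_integral_mono) (use b' in \<open>auto simp: indicator_def\<close>)
  also have "\<dots> = ennreal c * ?v" by (simp add: nn_integral_cmult_indicator)
  finally have le: "ennreal d * ?v \<le> ennreal c * ?v" .
  have fin: "?v < top" using emeasure_bounded_finite[of "ball t r"] by simp
  have "?v \<noteq> 0"
  proof
    assume "?v = 0"
    then have "negligible (ball t r)"
      unfolding negligible_iff_null_sets by (intro null_sets_completionI null_setsI) auto
    then show False using open_not_negligible[of "ball t r"] r(1) by auto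
  qed
  then obtain v where v: "?v = ennreal v" "0 < v"
    using fin by (cases ?v rule: ennreal_cases) (auto simp: less_le)
  have "d * v \<le> c * v"
    using le c0 cd v by (simp add: v ennreal_mult[symmetric] ennreal_le_iff)
  then show False using cd v(2) by simp
qed

context c1_field
begin

text \<open>The Kac-Rice integrand formed with \<open>D\<close> and with \<open>M\<close> itself
  instead of its completion, as \<open>D t\<close> is measurable for interior \<open>t\<close>.
  Agreement with \<open>rice_integrand\<close> there is shown later.\<close>

definition "rice u t = (\<integral>\<^sup>+\<omega>. ennreal \<bar>det (\<chi> i. D t \<omega> $ i - regression_coeff M (\<lambda>\<omega>. D t \<omega> $ i) (Z t) *v Z t \<omega>
    + regression_coeff M (\<lambda>\<omega>. D t \<omega> $ i) (Z t) *v u)\<bar> \<partial>M) * ennreal (density_at M (Z t) u)"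

text \<open>The radius keeps \<open>A t\<close> within operator norm 1/2 of the identity, whence the
  constant 2 in \<open>lower\<close>. The neighbourhood does not depend on the level.\<close>

lemma ex_base_point:
  assumes s: "s \<in> I"
  shows "\<exists>r>0. \<exists>p K. base_point M H I Z D s (ball s r) p K"
proof -
  obtain p K where p: "continuous_on UNIV p" "\<And>x. 0 \<le> p x \<and> p x \<le> K" "integrable lborel p"
    "distributed M lborel (Z s) (\<lambda>x. ennreal (p x))"
    using gaussian_vector_density[OF Z_mem[OF s] posdef[OF s]] by blast
  \<comment> \<open>A provisional instance with empty neighbourhood and level 0, for which
    \<open>lower\<close> is vacuous. It gives access to \<open>A\<close> and its continuity before
    the radius is chosen.\<close>
  interpret B0: base_point M H I Z D s "{}" 0 p K
    by unfold_locales (use s p in auto)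
  let ?n = "\<lambda>t. \<Sum>i\<in>UNIV. \<Sum>j\<in>UNIV. \<bar>(B0.A s - B0.A t) $ i $ j\<bar>"
  have "continuous_on I ?n"
    by (intro continuous_intros continuous_on_component B0.A_cont)
  moreover have "?n s = 0" by simp
  ultimately obtain r where r: "r > 0" "\<And>t. t \<in> I \<Longrightarrow> dist t s < r \<Longrightarrow> dist (?n t) 0 < 1 / 2"
    using s unfolding continuous_on_iff by (metis half_gt_zero zero_less_one)
  have "norm x \<le> 2 * norm (regression_coeff M (Z t) (Z s) *v x)" if t: "t \<in> I" "t \<in> ball s r" for t x
  proof -
    have n: "?n t \<le> 1 / 2" using r(2)[of t] t by (simp add: dist_commute)
    have "norm ((B0.A s - B0.A t) *v x) \<le> ?n t * norm x" by (rule norm_matrix_vector_mult_le)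
    also have "\<dots> \<le> 1 / 2 * norm x" by (intro mult_right_mono n) simp
    finally have "norm (x - B0.A t *v x) \<le> 1 / 2 * norm x"
      by (simp add: B0.A_s matrix_vector_mult_diff_rdistrib)
    moreover have "norm x \<le> norm (x - B0.A t *v x) + norm (B0.A t *v x)"
      using norm_triangle_ineq[of "x - B0.A t *v x" "B0.A t *v x"] by simp
    ultimately show ?thesis by (simp add: B0.A_def)
  qed
  then have "base_point M H I Z D s (ball s r) p K"
    by unfold_locales (use s p in auto)
  then show ?thesis using r(1) by blast
qed

text \<open>The locale's auxiliary data are hidden behind existential quantifiers, so that densities
  belonging to two different base points can be compared.\<close>

lemma ex_local_density:
  assumes s: "s \<in> I"
  shows "\<exists>r>0. \<exists>g C. (\<forall>B. fsigma B \<longrightarrow> B \<subseteq> I \<inter> ball s r \<longrightarrow>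
      (\<integral>\<^sup>+\<omega>. count_preimage (\<lambda>t. Z t \<omega>) B u \<partial>M) = (\<integral>\<^sup>+t\<in>B \<inter> interior I. ennreal (g t) \<partial>lborel)) \<and>
    continuous_on (interior I \<inter> ball s r) g \<and> (\<forall>t. 0 \<le> g t) \<and> (\<forall>t\<in>interior I \<inter> ball s r. g t \<le> C) \<and>
    (s \<in> interior I \<longrightarrow> ennreal (g s) = rice u s)"
proof -
  obtain r p K where r: "r > 0" and b: "base_point M H I Z D s (ball s r) p K"
    using ex_base_point[OF s] by blast
  interpret B: base_point M H I Z D s "ball s r" u p K by (rule b)
  obtain C where C: "\<forall>t\<in>interior I \<inter> ball s r. B.g t \<le> C" using B.g_bdd by blast
  have "density_at M (Z s) = p"
    by (rule density_at_eq[OF B.p_cont B.p_nonneg B.p_dist])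
  then have "s \<in> interior I \<longrightarrow> ennreal (B.g s) = rice u s"
    using B.g_s r by (auto simp: rice_def B.Bc_def)
  then show ?thesis
    using r B.local_formula B.g_cont B.g_nonneg C
    by (intro exI[of _ r] conjI exI[of _ B.g] exI[of _ C]) auto
qed

lemma local_rice:
  assumes s: "s \<in> I"
  shows "\<exists>r>0. \<exists>g C. (\<forall>B. fsigma B \<longrightarrow> B \<subseteq> I \<inter> ball s r \<longrightarrow>
      (\<integral>\<^sup>+\<omega>. count_preimage (\<lambda>t. Z t \<omega>) B u \<partial>M) = (\<integral>\<^sup>+t\<in>B \<inter> interior I. rice u t \<partial>lborel)) \<and>
    continuous_on (interior I \<inter> ball s r) g \<and>
    (\<forall>t\<in>interior I \<inter> ball s r. rice u t = ennreal (g t) \<and> g t \<le> C)"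
proof -
  obtain r g C where r: "r > 0"
    and formula: "\<And>B. fsigma B \<Longrightarrow> B \<subseteq> I \<inter> ball s r \<Longrightarrow>
      (\<integral>\<^sup>+\<omega>. count_preimage (\<lambda>t. Z t \<omega>) B u \<partial>M) = (\<integral>\<^sup>+t\<in>B \<inter> interior I. ennreal (g t) \<partial>lborel)"
    and g: "continuous_on (interior I \<inter> ball s r) g" "\<And>t. 0 \<le> g t" "\<And>t. t \<in> interior I \<inter> ball s r \<Longrightarrow> g t \<le> C"
    using ex_local_density[OF s, of u] by blast
  have eq: "rice u t = ennreal (g t)" if t: "t \<in> interior I \<inter> ball s r" for t
  proof -
    have tI: "t \<in> I" "t \<in> interior I" using t interior_I by auto
    obtain r' g' where r': "r' > 0"
      and formula': "\<And>B. fsigma B \<Longrightarrow> B \<subseteq> I \<inter> ball t r' \<Longrightarrow>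
        (\<integral>\<^sup>+\<omega>. count_preimage (\<lambda>t. Z t \<omega>) B u \<partial>M) = (\<integral>\<^sup>+t\<in>B \<inter> interior I. ennreal (g' t) \<partial>lborel)"
      and g': "continuous_on (interior I \<inter> ball t r') g'" "\<And>t. 0 \<le> g' t" "ennreal (g' t) = rice u t"
      using ex_local_density[OF tI(1), of u] tI(2) by blast
    let ?W = "interior I \<inter> ball s r \<inter> ball t r'"
    have W: "open ?W" "t \<in> ?W" using t r' by auto
    have c: "continuous_on ?W g" "continuous_on ?W g'"
      by (rule continuous_on_subset[OF g(1)], blast, rule continuous_on_subset[OF g'(1)], blast)
    have e: "(\<integral>\<^sup>+x\<in>ball t d. ennreal (g x) \<partial>lborel) = (\<integral>\<^sup>+x\<in>ball t d. ennreal (g' x) \<partial>lborel)" if "ball t d \<subseteq> ?W" for d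
    proof -
      have f: "fsigma (ball t d)" by (rule open_imp_fsigma) simp
      have i: "ball t d \<inter> interior I = ball t d" using that by blast
      have "(\<integral>\<^sup>+\<omega>. count_preimage (\<lambda>t. Z t \<omega>) (ball t d) u \<partial>M) = (\<integral>\<^sup>+x\<in>ball t d. ennreal (g x) \<partial>lborel)"
        using formula[OF f] that interior_I unfolding i by blast
      moreover have "(\<integral>\<^sup>+\<omega>. count_preimage (\<lambda>t. Z t \<omega>) (ball t d) u \<partial>M) = (\<integral>\<^sup>+x\<in>ball t d. ennreal (g' x) \<partial>lborel)"
        using formula'[OF f] that interior_I unfolding i by blast
      ultimately show ?thesis by simp
    qed
    have "g t \<le> g' t"
      by (rule continuous_density_eq[OF W c g(2) g'(2)]) (rule e)
    moreover have "g' t \<le> g t"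
      by (rule continuous_density_eq[OF W c(2,1) g'(2) g(2)]) (rule e[symmetric])
    ultimately show ?thesis using g'(3) by simp
  qed
  have "(\<integral>\<^sup>+\<omega>. count_preimage (\<lambda>t. Z t \<omega>) B u \<partial>M) = (\<integral>\<^sup>+t\<in>B \<inter> interior I. rice u t \<partial>lborel)"
    if B: "fsigma B" "B \<subseteq> I \<inter> ball s r" for B
    unfolding formula[OF B]
    by (rule nn_integral_cong) (use eq B(2) in \<open>auto simp: indicator_def\<close>)
  then show ?thesis
    using r g eq by (intro exI[of _ r] conjI exI[of _ g] exI[of _ C]) auto
qed

lemma count_measurable: "(\<lambda>\<omega>. count_preimage (\<lambda>t. Z t \<omega>) B u) \<in> borel_measurable M"
  if B: "fsigma B" "B \<subseteq> I"
proof -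
  have "(\<lambda>z. count_preimage (\<lambda>t. Z t (fst z)) B (snd z)) \<in> borel_measurable (M \<Otimes>\<^sub>M borel)"
    by (rule measurable_count_preimage[OF B(1)])
       (use B(2) Z_measurable in \<open>auto intro: continuous_on_subset[OF Z_cont]\<close>)
  then have "(\<lambda>\<omega>. (\<lambda>z. count_preimage (\<lambda>t. Z t (fst z)) B (snd z)) (\<omega>, u)) \<in> borel_measurable M"
    by (rule measurable_compose[rotated]) simp
  then show ?thesis by simp
qed

theorem rice_formula:
  shows "(\<lambda>t. rice u t * indicator (interior I) t) \<in> borel_measurable borel"
    and "(\<integral>\<^sup>+\<omega>. count_preimage (\<lambda>t. Z t \<omega>) I u \<partial>M) = (\<integral>\<^sup>+t\<in>interior I. rice u t \<partial>lborel)"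
    and "(\<integral>\<^sup>+t\<in>interior I. rice u t \<partial>lborel) < \<infinity>"
proof -
  \<comment> \<open>Radius, density and bound are packed into a triple so that
    \<open>bchoice\<close> selects all three at once.\<close>
  define P where "P s z \<longleftrightarrow> (case z of (r, g, C) \<Rightarrow> r > 0 \<and> (\<forall>B. fsigma B \<longrightarrow> B \<subseteq> I \<inter> ball s r \<longrightarrow>
      (\<integral>\<^sup>+\<omega>. count_preimage (\<lambda>t. Z t \<omega>) B u \<partial>M) = (\<integral>\<^sup>+t\<in>B \<inter> interior I. rice u t \<partial>lborel)) \<and>
    continuous_on (interior I \<inter> ball s r) g \<and>
    (\<forall>t\<in>interior I \<inter> ball s r. rice u t = ennreal (g t) \<and> g t \<le> C))"
    for s and z :: "real \<times> (real ^ 'd \<Rightarrow> real) \<times> real"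
  have "\<forall>s\<in>I. \<exists>z. P s z"
    unfolding P_def split_paired_Ex prod.case using local_rice[of _ u] by blast
  from bchoice[OF this] obtain z where z: "\<forall>s\<in>I. P s (z s)" by blast
  define r where "r s = fst (z s)" for s
  define g where "g s = fst (snd (z s))" for s
  define C where "C s = snd (snd (z s))" for s
  have Pz: "P s (r s, g s, C s)" if "s \<in> I" for s
    using z that by (simp add: r_def g_def C_def)
  have r: "\<And>s. s \<in> I \<Longrightarrow> r s > 0"
    and formula: "\<And>s B. s \<in> I \<Longrightarrow> fsigma B \<Longrightarrow> B \<subseteq> I \<inter> ball s (r s) \<Longrightarrow>
      (\<integral>\<^sup>+\<omega>. count_preimage (\<lambda>t. Z t \<omega>) B u \<partial>M) = (\<integral>\<^sup>+t\<in>B \<inter> interior I. rice u t \<partial>lborel)"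
    and g: "\<And>s. s \<in> I \<Longrightarrow> continuous_on (interior I \<inter> ball s (r s)) (g s)"
    and rice: "\<And>s t. s \<in> I \<Longrightarrow> t \<in> interior I \<inter> ball s (r s) \<Longrightarrow> rice u t = ennreal (g s t) \<and> g s t \<le> C s"
    using Pz unfolding P_def prod.case by blast+
  have "continuous_on (interior I) (\<lambda>t. enn2real (rice u t))"
  proof (rule continuous_at_imp_continuous_on, rule ballI)
    fix t assume t: "t \<in> interior I"
    then have tI: "t \<in> I" by (rule interior_I)
    let ?W = "interior I \<inter> ball t (r t)"
    \<comment> \<open>\<open>local_rice\<close> does not record the sign of \<open>g\<close>;
      \<open>max 0\<close> reproduces the truncation performed by \<open>ennreal\<close>.\<close>
    have "continuous_on ?W (\<lambda>x. max 0 (g t x))" by (intro continuous_intros g[OF tI])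
    also have "?this \<longleftrightarrow> continuous_on ?W (\<lambda>t. enn2real (rice u t))"
    proof (rule continuous_on_cong[OF refl])
      fix x assume "x \<in> ?W"
      then have "rice u x = ennreal (g t x)" using rice[OF tI] by blast
      moreover have "max 0 y = enn2real (ennreal y)" for y :: real
        by (cases "0 \<le> y") (auto simp: ennreal_neg)
      ultimately show "max 0 (g t x) = enn2real (rice u x)" by simp
    qed
    finally show "isCont (\<lambda>t. enn2real (rice u t)) t"
      using t r[OF tI] by (subst (asm) continuous_on_eq_continuous_at) auto
  qed
  then have "(\<lambda>t. indicator (interior I) t *\<^sub>R enn2real (rice u t)) \<in> borel_measurable borel"
    by (rule borel_measurable_continuous_on_indicator[rotated]) simp
  then have "(\<lambda>t. ennreal (indicator (interior I) t *\<^sub>R enn2real (rice u t))) \<in> borel_measurable borel"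
    by measurable
  also have "(\<lambda>t. ennreal (indicator (interior I) t *\<^sub>R enn2real (rice u t))) = (\<lambda>t. rice u t * indicator (interior I) t)"
  proof
    fix t
    show "ennreal (indicator (interior I) t *\<^sub>R enn2real (rice u t)) = rice u t * indicator (interior I) t"
    proof (cases "t \<in> interior I")
      case True
      then have "rice u t = ennreal (g t t)" using rice[of t t] r interior_I by auto
      then have "rice u t < top" by simp
      then show ?thesis using True by simp
    qed simp
  qed
  finally show meas: "(\<lambda>t. rice u t * indicator (interior I) t) \<in> borel_measurable borel" .
  have cover: "I \<subseteq> (\<Union>s\<in>I. ball s (r s))"
  proof
    fix t assume t: "t \<in> I"
    then have "t \<in> ball t (r t)" using r[OF t] by simp
    then show "t \<in> (\<Union>s\<in>I. ball s (r s))" by (rule UN_I[OF t])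
  qed
  obtain S where S: "S \<subseteq> I" "finite S" "I \<subseteq> (\<Union>s\<in>S. ball s (r s))"
    by (rule compactE_image[OF compact_I open_ball cover]) (rule that)
  have "(\<integral>\<^sup>+\<omega>. count_preimage (\<lambda>t. Z t \<omega>) I u \<partial>M) = (\<integral>\<^sup>+t\<in>interior I. rice u t \<partial>lborel) \<and>
    (\<integral>\<^sup>+t\<in>interior I. rice u t \<partial>lborel) < \<infinity>"
  proof (cases "S = {}")
    case True
    then have "I = {}" using S by auto
    then show ?thesis by (simp add: count_preimage_def)
  next
    case False
    \<comment> \<open>The finite cover is enumerated by all natural numbers, with repetitions;
      making the balls disjoint turns every repeated one into the empty set.\<close>
    define e where "e = from_nat_into S"
    have eS: "e k \<in> S" for k unfolding e_def by (rule from_nat_into[OF False])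
    then have eI: "e k \<in> I" for k using S by auto
    have re: "range e = S" unfolding e_def using S(2) False by (simp add: range_from_nat_into countable_finite)
    let ?b = "\<lambda>k. ball (e k) (r (e k))"
    define T where "T k = I \<inter> disjointed ?b k" for k
    have Tf: "fsigma (T k)" for k
    proof -
      have "T k = (I \<inter> ?b k) \<inter> - (\<Union>i\<in>{0..<k}. ?b i)" by (auto simp: T_def disjointed_def)
      moreover have "closed (- (\<Union>i\<in>{0..<k}. ?b i))" by (intro closed_Compl open_UN) auto
      ultimately show ?thesis
        using fsigma_Int[OF fsigma_Int[OF closed_imp_fsigma[OF compact_imp_closed[OF compact_I]] open_imp_fsigma[OF open_ball]] closed_imp_fsigma]
        by simp
    qed
    have Tb: "T k \<subseteq> I \<inter> ?b k" for k using disjointed_subset[of ?b k] by (auto simp: T_def)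
    have dT: "disjoint_family T"
      using disjoint_family_disjointed[of ?b] by (auto simp: T_def disjoint_family_on_def)
    have UT: "(\<Union>k. T k) = I"
    proof -
      have "(\<Union>k. T k) = I \<inter> (\<Union>k. ?b k)" using UN_disjointed_eq[of ?b] by (auto simp: T_def)
      also have "(\<Union>k. ?b k) = (\<Union>s\<in>S. ball s (r s))" unfolding re[symmetric] by simp
      finally show ?thesis using S(3) by auto
    qed
    have "(\<integral>\<^sup>+\<omega>. count_preimage (\<lambda>t. Z t \<omega>) I u \<partial>M) = (\<integral>\<^sup>+\<omega>. (\<Sum>k. count_preimage (\<lambda>t. Z t \<omega>) (T k) u) \<partial>M)"
      by (simp only: count_preimage_UN[OF dT, symmetric] UT)
    also have "\<dots> = (\<Sum>k. \<integral>\<^sup>+\<omega>. count_preimage (\<lambda>t. Z t \<omega>) (T k) u \<partial>M)"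
      by (rule nn_integral_suminf) (rule count_measurable[OF Tf], use Tb in auto)
    also have "\<dots> = (\<Sum>k. \<integral>\<^sup>+t\<in>T k \<inter> interior I. rice u t \<partial>lborel)"
      by (intro suminf_cong formula[OF eI Tf Tb])
    also have "\<dots> = (\<Sum>k. \<integral>\<^sup>+t\<in>T k. (rice u t * indicator (interior I) t) \<partial>lborel)"
      by (intro suminf_cong nn_integral_cong) (auto simp: indicator_def)
    also have "\<dots> = (\<integral>\<^sup>+t\<in>(\<Union>k. T k). (rice u t * indicator (interior I) t) \<partial>lborel)"
      by (rule nn_integral_disjoint_family[symmetric]) (use meas Tf dT fsigma_imp_borel in auto)
    also have "\<dots> = (\<integral>\<^sup>+t\<in>interior I. rice u t \<partial>lborel)"
      unfolding UT by (rule nn_integral_cong) (use interior_I in \<open>auto simp: indicator_def\<close>)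
    finally have eq: "(\<integral>\<^sup>+\<omega>. count_preimage (\<lambda>t. Z t \<omega>) I u \<partial>M) = (\<integral>\<^sup>+t\<in>interior I. rice u t \<partial>lborel)" .
    define K where "K = Max (C ` S)"
    have "rice u t \<le> ennreal K" if t: "t \<in> interior I" for t
    proof -
      obtain s where s: "s \<in> S" "t \<in> ball s (r s)" using S(3) t interior_I by blast
      then have "rice u t = ennreal (g s t)" "g s t \<le> C s" using rice[of s t] S(1) t by auto
      moreover have "C s \<le> K" unfolding K_def using S(2) s(1) by auto
      ultimately show ?thesis by (simp add: ennreal_leI)
    qed
    then have "(\<integral>\<^sup>+t\<in>interior I. rice u t \<partial>lborel) \<le> (\<integral>\<^sup>+t. ennreal K * indicator (interior I) t \<partial>lborel)"
      by (intro nn_integral_mono) (auto simp: indicator_def)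
    also have "\<dots> = ennreal K * emeasure lborel (interior I)" by (simp add: nn_integral_cmult_indicator)
    also have "\<dots> < \<infinity>"
      using emeasure_bounded_finite[OF bounded_subset[OF compact_imp_bounded[OF compact_I] interior_subset]]
      by (simp add: ennreal_mult_less_top)
    finally show ?thesis using eq by simp
  qed
  then show "(\<integral>\<^sup>+\<omega>. count_preimage (\<lambda>t. Z t \<omega>) I u \<partial>M) = (\<integral>\<^sup>+t\<in>interior I. rice u t \<partial>lborel)"
    "(\<integral>\<^sup>+t\<in>interior I. rice u t \<partial>lborel) < \<infinity>" by auto
qed

end

section \<open>Changing a field on a null set\<close>

lemma measurable_completion_off_null_set:
  assumes f: "f \<in> measurable M L" and N: "N \<in> null_sets M"
    and eq: "\<And>x. x \<in> space M - N \<Longrightarrow> g x = f x" and g: "\<And>x. x \<in> space M \<Longrightarrow> g x \<in> space L"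
  shows "g \<in> measurable (completion M) L"
proof (rule measurableI)
  show "g x \<in> space L" if "x \<in> space (completion M)" for x using g that by simp
  fix A assume A: "A \<in> sets L"
  have e: "g -` A \<inter> space M = (f -` A \<inter> space M - N) \<union> (g -` A \<inter> space M \<inter> N)"
    using eq by auto
  have m1: "f -` A \<inter> space M - N \<in> sets (completion M)"
    using measurable_sets[OF f A] N by (intro sets_completionI_sets) auto
  \<comment> \<open>An arbitrary subset of a null set; its measurability is where the completion
    enters.\<close>
  have m2: "g -` A \<inter> space M \<inter> N \<in> sets (completion M)"
    using N by (intro null_setsD2[OF null_sets_completion_subset[OF _ null_sets_completionI[OF N]]]) auto
  have "g -` A \<inter> space M \<in> sets (completion M)" by (subst e) (rule sets.Un[OF m1 m2])
  then show "g -` A \<inter> space (completion M) \<in> sets (completion M)" by simp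
qed

lemma measurable_vec_nth:
  fixes f :: "'a \<Rightarrow> real ^ 'n"
  assumes "f \<in> borel_measurable N"
  shows "(\<lambda>\<omega>. f \<omega> $ i) \<in> borel_measurable N"
  by (rule measurable_compose[OF assms borel_measurable_continuous_onI]) (intro continuous_intros)

context prob_space
begin

lemma gaussian_rv_cong_AE:
  assumes "gaussian_rv M X" "AE \<omega> in M. X \<omega> = Y \<omega>" "Y \<in> borel_measurable M"
  shows "gaussian_rv M Y"
proof -
  have "distr M borel Y = distr M borel X"
    by (rule distr_cong_AE) (use assms gaussian_rv_measurable in \<open>auto elim: eventually_mono\<close>)
  then show ?thesis using assms unfolding gaussian_rv_iff_distr by simp
qed

lemma gaussian_rv_add_const:
  assumes "gaussian_rv M X"
  shows "gaussian_rv M (\<lambda>\<omega>. c + X \<omega>)"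
proof -
  have [measurable]: "X \<in> borel_measurable M" using assms by (rule gaussian_rv_measurable)
  obtain \<mu> \<sigma> where \<sigma>: "0 \<le> \<sigma>" and D: "distr M borel X = distr std_normal_distribution borel (\<lambda>x. \<mu> + \<sigma> * x)"
    using gaussian_rv_normal_form[OF assms] .
  have "distr M borel (\<lambda>\<omega>. c + X \<omega>) = distr (distr M borel X) borel (\<lambda>x. c + x)"
    by (subst distr_distr) (auto simp: o_def)
  also have "\<dots> = distr std_normal_distribution borel (\<lambda>x. (c + \<mu>) + \<sigma> * x)"
    unfolding D by (subst distr_distr) (auto simp: o_def add.assoc)
  finally show ?thesis unfolding gaussian_rv_iff_distr using \<sigma> by auto
qed

lemma covariance_cong_AE_completion:
  assumes "X' \<in> borel_measurable M" "Y' \<in> borel_measurable M"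
    and "X \<in> borel_measurable (completion M)" "Y \<in> borel_measurable (completion M)"
    and eq: "AE \<omega> in M. X \<omega> = X' \<omega>" "AE \<omega> in M. Y \<omega> = Y' \<omega>"
  shows "covariance (completion M) X Y = covariance M X' Y'"
proof -
  note [measurable] = assms(1-4)
  have m: "X' \<in> borel_measurable (completion M)" "Y' \<in> borel_measurable (completion M)"
    using assms by (auto intro: measurable_completion)
  have aX: "AE \<omega> in completion M. X \<omega> = X' \<omega>" and aY: "AE \<omega> in completion M. Y \<omega> = Y' \<omega>"
    using eq by (simp_all only: AE_completion_iff)
  have eX: "(\<integral>\<omega>. X \<omega> \<partial>completion M) = expectation X'" 
    by (subst integral_cong_AE[OF assms(3) m(1) aX], rule integral_completion[OF assms(1)])
  have eY: "(\<integral>\<omega>. Y \<omega> \<partial>completion M) = expectation Y'"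
    by (subst integral_cong_AE[OF assms(4) m(2) aY], rule integral_completion[OF assms(2)])
  have "covariance (completion M) X Y = (\<integral>\<omega>. (X' \<omega> - expectation X') * (Y' \<omega> - expectation Y') \<partial>completion M)"
    unfolding covariance_def eX eY
  proof (rule integral_cong_AE)
    show "AE \<omega> in completion M. (X \<omega> - expectation X') * (Y \<omega> - expectation Y') = (X' \<omega> - expectation X') * (Y' \<omega> - expectation Y')"
      using aX aY by eventually_elim simp
  qed (use m in measurable)
  also have "\<dots> = covariance M X' Y'"
    unfolding covariance_def by (rule integral_completion) measurable
  finally show ?thesis .
qed

end

lemma level_count_eq: "level_count I Z u \<omega> = count_preimage (\<lambda>t. Z t \<omega>) I u"
  by (simp add: level_count_def count_preimage_def)

text \<open>At interior points the relative derivative is the ordinary one and therefore unique,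
  which pins down the matrix selected by \<open>jacobian\<close>.\<close>

lemma jacobian_eq:
  fixes f :: "real ^ 'n \<Rightarrow> real ^ 'm"
  assumes "t \<in> interior I" and "(f has_derivative (\<lambda>h. A *v h)) (at t within I)"
  shows "jacobian f (at t within I) = A"
proof -
  have aw: "at t within I = at t" by (rule at_within_interior[OF assms(1)])
  have "(f has_derivative (\<lambda>h. A *v h)) (at t)"
    using assms(2) unfolding aw .
  then have "frechet_derivative f (at t) = (\<lambda>h. A *v h)" by (rule frechet_derivative_at[symmetric])
  then have "matrix (frechet_derivative f (at t)) = matrix (\<lambda>h. A *v h)" by (rule arg_cong)
  also have "\<dots> = A" by simp
  finally show ?thesis unfolding jacobian_def aw .
qed

lemma has_derivative_imp_local_Lipschitz:
  assumes "(f has_derivative f') (at t within S)"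
  shows "\<exists>e>0. \<exists>C. \<forall>s\<in>S. dist s t < e \<longrightarrow> dist (f s) (f t) \<le> C * dist s t"
proof -
  have "bounded_linear f'" using assms by (rule has_derivative_bounded_linear)
  then obtain K where K: "\<And>h. norm (f' h) \<le> norm h * K" using bounded_linear.bounded by blast
  obtain d where d: "d > 0" "\<And>s. s \<in> S \<Longrightarrow> norm (s - t) < d \<Longrightarrow> norm (f s - f t - f' (s - t)) \<le> 1 * norm (s - t)"
  proof -
    from assms have "\<forall>e>0. \<exists>d>0. \<forall>y\<in>S. norm (y - t) < d \<longrightarrow> norm (f y - f t - f' (y - t)) \<le> e * norm (y - t)"
      unfolding has_derivative_within_alt by (rule conjunct2)
    then obtain d where "d > 0" "\<forall>y\<in>S. norm (y - t) < d \<longrightarrow> norm (f y - f t - f' (y - t)) \<le> 1 * norm (y - t)"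
      using zero_less_one by blast
    then show thesis by (intro that[of d]) blast+
  qed
  have "dist (f s) (f t) \<le> (1 + K) * dist s t" if "s \<in> S" "dist s t < d" for s
  proof -
    have "norm (f s - f t) \<le> norm (f s - f t - f' (s - t)) + norm (f' (s - t))"
      using norm_triangle_ineq[of "f s - f t - f' (s - t)" "f' (s - t)"] by simp
    also have "\<dots> \<le> 1 * norm (s - t) + norm (s - t) * K"
      using that by (intro add_mono d(2) K) (auto simp: dist_norm)
    finally show ?thesis by (simp add: dist_norm algebra_simps)
  qed
  then show ?thesis using d(1) by blast
qed

section \<open>The Gaussian space spanned by a field and its derivatives\<close>

definition affine_span :: "(real ^ 'd) set \<Rightarrow> (real ^ 'd \<Rightarrow> 'w \<Rightarrow> real ^ 'd) \<Rightarrow> ('w \<Rightarrow> real) set" where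
  "affine_span I Z = {X. \<exists>T a c. finite T \<and> T \<subseteq> I \<and> X = (\<lambda>\<omega>. c + (\<Sum>t\<in>T. a t \<bullet> Z t \<omega>))}"

lemma affine_spanI:
  "finite T \<Longrightarrow> T \<subseteq> I \<Longrightarrow> (\<lambda>\<omega>. c + (\<Sum>t\<in>T. a t \<bullet> Z t \<omega>)) \<in> affine_span I Z"
  unfolding affine_span_def by (intro CollectI exI[of _ T] exI[of _ a] exI[of _ c] conjI refl)

lemma affine_spanE:
  assumes "X \<in> affine_span I Z"
  obtains T a c where "finite T" "T \<subseteq> I" "X = (\<lambda>\<omega>. c + (\<Sum>t\<in>T. a t \<bullet> Z t \<omega>))"
  using assms unfolding affine_span_def by (elim CollectE exE conjE) (rule that)

lemma affine_span_add:
  assumes "X \<in> affine_span I Z" "Y \<in> affine_span I Z"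
  shows "(\<lambda>\<omega>. X \<omega> + Y \<omega>) \<in> affine_span I Z"
proof -
  obtain T a c where X: "finite T" "T \<subseteq> I" "X = (\<lambda>\<omega>. c + (\<Sum>t\<in>T. a t \<bullet> Z t \<omega>))"
    using assms(1) by (rule affine_spanE)
  obtain T' a' c' where Y: "finite T'" "T' \<subseteq> I" "Y = (\<lambda>\<omega>. c' + (\<Sum>t\<in>T'. a' t \<bullet> Z t \<omega>))"
    using assms(2) by (rule affine_spanE)
  \<comment> \<open>Coefficients are extended by zero to the union of the index sets, which may
    overlap.\<close>
  let ?b = "\<lambda>t. (if t \<in> T then a t else 0) + (if t \<in> T' then a' t else 0)"
  have "X \<omega> + Y \<omega> = (c + c') + (\<Sum>t\<in>T \<union> T'. ?b t \<bullet> Z t \<omega>)" for \<omega>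
  proof -
    have 1: "(\<Sum>t\<in>T. a t \<bullet> Z t \<omega>) = (\<Sum>t\<in>T \<union> T'. (if t \<in> T then a t else 0) \<bullet> Z t \<omega>)"
      using X Y by (intro sum.mono_neutral_cong_left) auto
    have 2: "(\<Sum>t\<in>T'. a' t \<bullet> Z t \<omega>) = (\<Sum>t\<in>T \<union> T'. (if t \<in> T' then a' t else 0) \<bullet> Z t \<omega>)"
      using X Y by (intro sum.mono_neutral_cong_left) auto
    show ?thesis unfolding X(3) Y(3) 1 2 inner_add_left sum.distrib by simp
  qed
  then have "(\<lambda>\<omega>. X \<omega> + Y \<omega>) = (\<lambda>\<omega>. (c + c') + (\<Sum>t\<in>T \<union> T'. ?b t \<bullet> Z t \<omega>))" by (rule ext)
  moreover have "finite (T \<union> T')" "T \<union> T' \<subseteq> I" using X Y by auto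
  ultimately show ?thesis by (simp only: affine_spanI)
qed

lemma affine_span_scale:
  assumes "X \<in> affine_span I Z"
  shows "(\<lambda>\<omega>. b * X \<omega>) \<in> affine_span I Z"
proof -
  obtain T a c where X: "finite T" "T \<subseteq> I" "X = (\<lambda>\<omega>. c + (\<Sum>t\<in>T. a t \<bullet> Z t \<omega>))"
    using assms by (rule affine_spanE)
  then have "(\<lambda>\<omega>. b * X \<omega>) = (\<lambda>\<omega>. b * c + (\<Sum>t\<in>T. (b *\<^sub>R a t) \<bullet> Z t \<omega>))"
    by (simp add: distrib_left sum_distrib_left)
  then show ?thesis using affine_spanI[OF X(1,2)] by (simp only:)
qed

lemma affine_span_const: "(\<lambda>_. c) \<in> affine_span I Z"
  unfolding affine_span_def by (intro CollectI exI[of _ "{}"] exI[of _ c]) auto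

lemma affine_span_nth: "t \<in> I \<Longrightarrow> (\<lambda>\<omega>. Z t \<omega> $ i) \<in> affine_span I Z"
  unfolding affine_span_def
  by (intro CollectI exI[of _ "{t}"] exI[of _ "\<lambda>_. axis i 1"] exI[of _ 0]) (auto simp: inner_axis')

text \<open>Almost sure limits are included in order to contain the derivatives of the field.\<close>

definition gaussian_hull :: "'w measure \<Rightarrow> (real ^ 'd) set \<Rightarrow> (real ^ 'd \<Rightarrow> 'w \<Rightarrow> real ^ 'd) \<Rightarrow> ('w \<Rightarrow> real) set" where
  "gaussian_hull M I Z = {X \<in> borel_measurable M.
     \<exists>Xn. (\<forall>n::nat. Xn n \<in> affine_span I Z) \<and> (AE \<omega> in M. (\<lambda>n. Xn n \<omega>) \<longlonglongrightarrow> X \<omega>)}"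

lemma gaussian_space_gaussian_hull:
  assumes "prob_space M" and "\<And>t. t \<in> I \<Longrightarrow> Z t \<in> borel_measurable M" and "gaussian_field M I Z"
  shows "gaussian_space M (gaussian_hull M I Z)"
proof -
  interpret prob_space M by fact
  show ?thesis
  proof
    fix X Y c
    {
      assume "X \<in> gaussian_hull M I Z"
      then obtain Xn where m: "X \<in> borel_measurable M" and Xn: "\<And>n::nat. Xn n \<in> affine_span I Z" "AE \<omega> in M. (\<lambda>n. Xn n \<omega>) \<longlonglongrightarrow> X \<omega>"
        unfolding gaussian_hull_def by blast
      have "gaussian_rv M (Xn n)" for n
      proof -
        obtain T a c where X: "finite T" "T \<subseteq> I" "Xn n = (\<lambda>\<omega>. c + (\<Sum>t\<in>T. a t \<bullet> Z t \<omega>))"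
          using Xn(1)[of n] by (rule affine_spanE)
        have "gaussian_rv M (\<lambda>\<omega>. \<Sum>t\<in>T. a t \<bullet> Z t \<omega>)"
          using assms(3) X unfolding gaussian_field_def by blast
        then show ?thesis unfolding X(3) by (rule gaussian_rv_add_const)
      qed
      then show "gaussian_rv M X" by (rule gaussian_rv_AE_limit[OF _ m Xn(2)])
    next
      assume "X \<in> gaussian_hull M I Z" "Y \<in> gaussian_hull M I Z"
      then obtain Xn Yn where m [measurable]: "X \<in> borel_measurable M" "Y \<in> borel_measurable M"
        and Xn: "\<And>n::nat. Xn n \<in> affine_span I Z" "AE \<omega> in M. (\<lambda>n. Xn n \<omega>) \<longlonglongrightarrow> X \<omega>"
        and Yn: "\<And>n::nat. Yn n \<in> affine_span I Z" "AE \<omega> in M. (\<lambda>n. Yn n \<omega>) \<longlonglongrightarrow> Y \<omega>"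
        unfolding gaussian_hull_def by blast
      have "AE \<omega> in M. (\<lambda>n. Xn n \<omega> + Yn n \<omega>) \<longlonglongrightarrow> X \<omega> + Y \<omega>"
        using Xn(2) Yn(2) by eventually_elim (rule tendsto_add)
      then show "(\<lambda>\<omega>. X \<omega> + Y \<omega>) \<in> gaussian_hull M I Z"
        unfolding gaussian_hull_def using affine_span_add[OF Xn(1) Yn(1)]
        by (intro CollectI conjI exI[of _ "\<lambda>n \<omega>. Xn n \<omega> + Yn n \<omega>"]) auto
    next
      assume "X \<in> gaussian_hull M I Z"
      then obtain Xn where m [measurable]: "X \<in> borel_measurable M" and Xn: "\<And>n::nat. Xn n \<in> affine_span I Z" "AE \<omega> in M. (\<lambda>n. Xn n \<omega>) \<longlonglongrightarrow> X \<omega>"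
        unfolding gaussian_hull_def by blast
      have "AE \<omega> in M. (\<lambda>n. c * Xn n \<omega>) \<longlonglongrightarrow> c * X \<omega>"
        using Xn(2) by eventually_elim (rule tendsto_mult_left)
      then show "(\<lambda>\<omega>. c * X \<omega>) \<in> gaussian_hull M I Z"
        unfolding gaussian_hull_def using affine_span_scale[OF Xn(1)]
        by (intro CollectI conjI exI[of _ "\<lambda>n \<omega>. c * Xn n \<omega>"]) auto
    next
      show "(\<lambda>_. c) \<in> gaussian_hull M I Z"
        unfolding gaussian_hull_def using affine_span_const
        by (intro CollectI conjI exI[of _ "\<lambda>n \<omega>. c"]) auto
    }
  qed
qed

lemma c1_field_gaussian_hull:
  fixes Z :: "real ^ 'd \<Rightarrow> 'w \<Rightarrow> real ^ 'd"
  assumes M: "prob_space M" and I: "compact I" and Z: "\<And>t. t \<in> I \<Longrightarrow> Z t \<in> borel_measurable M"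
    and G: "gaussian_field M I Z"
    and C1: "\<And>\<omega>. \<omega> \<in> space M \<Longrightarrow> C1_on I (\<lambda>t. Z t \<omega>)"
    and pos: "\<And>t. t \<in> I \<Longrightarrow> positive_definite (var_matrix M (Z t))"
    and fr: "emeasure lborel (frontier I) = 0"
  shows "c1_field M (gaussian_hull M I Z) I Z (field_deriv I Z)"
proof -
  interpret gaussian_space M "gaussian_hull M I Z"
    by (rule gaussian_space_gaussian_hull[OF M Z G])
  have "\<forall>\<omega>\<in>space M. \<exists>J. continuous_on I J \<and> (\<forall>t\<in>I. ((\<lambda>t. Z t \<omega>) has_derivative (\<lambda>h. J t *v h)) (at t within I))"
    using C1 unfolding C1_on_def by (intro ballI)
  \<comment> \<open>One continuous relative derivative is chosen for each sample point. In the
    interior it must coincide with \<open>field_deriv\<close>, which so inherits continuity there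
    and, as \<open>I\<close> is compact, boundedness.\<close>
  from bchoice[OF this] obtain J where J0: "\<forall>\<omega>\<in>space M. continuous_on I (J \<omega>) \<and>
    (\<forall>t\<in>I. ((\<lambda>t. Z t \<omega>) has_derivative (\<lambda>h. J \<omega> t *v h)) (at t within I))" by (elim exE) (rule that)
  have J: "\<And>\<omega>. \<omega> \<in> space M \<Longrightarrow> continuous_on I (J \<omega>)"
    "\<And>\<omega> t. \<omega> \<in> space M \<Longrightarrow> t \<in> I \<Longrightarrow> ((\<lambda>t. Z t \<omega>) has_derivative (\<lambda>h. J \<omega> t *v h)) (at t within I)"
    by (rule J0[rule_format, THEN conjunct1], assumption) (rule J0[rule_format, THEN conjunct2, rule_format])
  have iI: "t \<in> interior I \<Longrightarrow> t \<in> I" for t using interior_subset by blast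
  have DJ: "field_deriv I Z t \<omega> = J \<omega> t" if "\<omega> \<in> space M" "t \<in> interior I" for \<omega> t
    unfolding field_deriv_def by (rule jacobian_eq[OF that(2) J(2)[OF that(1) iI[OF that(2)]]])
  have deriv: "((\<lambda>s. Z s \<omega>) has_derivative (\<lambda>h. field_deriv I Z t \<omega> *v h)) (at t)"
    if "\<omega> \<in> space M" "t \<in> interior I" for \<omega> t
    using J(2)[OF that(1) iI[OF that(2)]] unfolding at_within_interior[OF that(2)] DJ[OF that] .
  show ?thesis
  proof
    show "compact I" by fact
    show "(\<lambda>\<omega>. Z t \<omega> $ i) \<in> gaussian_hull M I Z" if "t \<in> I" for t i
    proof -
      have "(\<lambda>\<omega>. Z t \<omega> $ i) \<in> borel_measurable M"
        using Z[OF that] by (intro measurable_vec_nth)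
      then show ?thesis unfolding gaussian_hull_def using affine_span_nth[OF that]
        by (intro CollectI conjI exI[of _ "\<lambda>n \<omega>. Z t \<omega> $ i"]) auto
    qed
    show "(\<lambda>\<omega>. field_deriv I Z t \<omega> $ i $ k) \<in> gaussian_hull M I Z" if t: "t \<in> interior I" for t i k
    proof -
      obtain e where e: "e > 0" "ball t e \<subseteq> I"
        using t unfolding mem_interior by blast
      \<comment> \<open>Steps shorter than \<open>e\<close> keep the difference quotients inside
        \<open>I\<close>, the only place where the field is controlled; they tend to zero along the
        \<open>k\<close>-th axis.\<close>
      define h where "h n = e / 2 / (real n + 1)" for n
      have h: "0 < h n" "h n < e" for n
      proof -
        show "0 < h n" using e(1) by (simp add: h_def)
        have "h n \<le> e / 2 / 1" unfolding h_def using e(1) by (intro divide_left_mono) auto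
        then show "h n < e" using e(1) by simp
      qed
      have "(\<lambda>n. e / 2 * inverse (real (Suc n))) \<longlonglongrightarrow> e / 2 * 0"
        by (intro tendsto_mult_left LIMSEQ_inverse_real_of_nat)
      also have "(\<lambda>n. e / 2 * inverse (real (Suc n))) = h"
        by (rule ext) (simp only: h_def divide_inverse of_nat_Suc add.commute[of 1])
      finally have h0: "h \<longlonglongrightarrow> 0" by (simp only: mult_zero_right)
      define y where "y n = t + h n *\<^sub>R axis k 1" for n
      have yI: "y n \<in> I" for n
        using e(2) h[of n] by (auto simp: y_def dist_norm)
      \<comment> \<open>The difference is written as a sum with factor \<open>-1\<close> to match
        the closure rules of \<open>affine_span\<close>.\<close>
      define Xn where "Xn n \<omega> = (1 / h n) * (Z (y n) \<omega> $ i + (-1) * Z t \<omega> $ i)" for n \<omega>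
      have XL: "Xn n \<in> affine_span I Z" for n
        unfolding Xn_def[abs_def]
        by (intro affine_span_scale affine_span_add affine_span_nth yI iI t)
      have lim: "(\<lambda>n. Xn n \<omega>) \<longlonglongrightarrow> field_deriv I Z t \<omega> $ i $ k" if \<omega>: "\<omega> \<in> space M" for \<omega>
      proof -
        let ?A = "field_deriv I Z t \<omega>"
        have "((\<lambda>s. (1 / norm (s - t)) *\<^sub>R (Z s \<omega> - (Z t \<omega> + ?A *v (s - t)))) \<longlongrightarrow> 0) (at t)"
          using deriv[OF \<omega> t] unfolding has_derivative_within by blast
        moreover have "y \<longlonglongrightarrow> t"
        proof -
          have "(\<lambda>n. t + h n *\<^sub>R axis k 1) \<longlonglongrightarrow> t + 0 *\<^sub>R axis k (1::real)" by (intro tendsto_intros h0)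
          then show ?thesis by (simp add: y_def[abs_def])
        qed
        moreover have "y n \<noteq> t" for n using h(1)[of n] by (simp add: y_def axis_eq_0_iff)
        ultimately have "(\<lambda>n. (1 / norm (y n - t)) *\<^sub>R (Z (y n) \<omega> - (Z t \<omega> + ?A *v (y n - t)))) \<longlonglongrightarrow> 0"
          unfolding tendsto_at_iff_sequentially o_def by blast
        from tendsto_vec_nth[OF this, of i]
        have "(\<lambda>n. (1 / norm (y n - t)) * (Z (y n) \<omega> $ i - (Z t \<omega> $ i + (?A *v (y n - t)) $ i))) \<longlonglongrightarrow> 0" by simp
        also have "(\<lambda>n. (1 / norm (y n - t)) * (Z (y n) \<omega> $ i - (Z t \<omega> $ i + (?A *v (y n - t)) $ i))) = (\<lambda>n. Xn n \<omega> - ?A $ i $ k)"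
        proof
          fix n
          have 1: "norm (y n - t) = h n" using h(1)[of n] by (simp add: y_def)
          have 2: "(?A *v (y n - t)) $ i = h n * ?A $ i $ k"
            by (simp add: y_def linear_cmul[OF matrix_vector_mul_linear] matrix_vector_mult_basis column_def)
          show "(1 / norm (y n - t)) * (Z (y n) \<omega> $ i - (Z t \<omega> $ i + (?A *v (y n - t)) $ i)) = Xn n \<omega> - ?A $ i $ k"
            unfolding 1 2 Xn_def using h(1)[of n] by (simp add: field_simps)
        qed
        finally show ?thesis by (simp add: LIM_zero_iff)
      qed
      have "(\<lambda>\<omega>. Z s \<omega> $ i) \<in> borel_measurable M" if "s \<in> I" for s
        using Z[OF that] by (intro measurable_vec_nth)
      then have "Xn n \<in> borel_measurable M" for n
        unfolding Xn_def[abs_def] using yI iI[OF t] by (intro borel_measurable_times borel_measurable_add) auto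
      then have "(\<lambda>\<omega>. field_deriv I Z t \<omega> $ i $ k) \<in> borel_measurable M"
        using lim by (rule borel_measurable_LIMSEQ_real[rotated])
      then show ?thesis unfolding gaussian_hull_def using XL lim by blast
    qed
    show "((\<lambda>s. Z s \<omega>) has_derivative (\<lambda>h. field_deriv I Z t \<omega> *v h)) (at t)"
      if "\<omega> \<in> space M" "t \<in> interior I" for \<omega> t by (rule deriv[OF that])
    show "continuous_on (interior I) (\<lambda>t. field_deriv I Z t \<omega>)" if "\<omega> \<in> space M" for \<omega>
    proof -
      have "continuous_on (interior I) (\<lambda>t. field_deriv I Z t \<omega>) \<longleftrightarrow> continuous_on (interior I) (J \<omega>)"
        by (rule continuous_on_cong[OF refl DJ[OF that]])
      then show ?thesis using continuous_on_subset[OF J(1)[OF that] interior_subset] by (rule iffD2)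
    qed
    show "\<exists>C. \<forall>t\<in>interior I. norm (field_deriv I Z t \<omega>) \<le> C" if \<omega>: "\<omega> \<in> space M" for \<omega>
    proof -
      from compact_imp_bounded[OF compact_continuous_image[OF J(1)[OF \<omega>] I]]
      obtain C where "\<forall>x\<in>J \<omega> ` I. norm x \<le> C" unfolding bounded_iff by blast
      then have "norm (field_deriv I Z t \<omega>) \<le> C" if "t \<in> interior I" for t
        unfolding DJ[OF \<omega> that] using iI[OF that] by blast
      then show ?thesis by blast
    qed
    show "\<exists>e>0. \<exists>C. \<forall>s\<in>I. dist s t < e \<longrightarrow> dist (Z s \<omega>) (Z t \<omega>) \<le> C * dist s t"
      if "\<omega> \<in> space M" "t \<in> I" for \<omega> t
      by (rule has_derivative_imp_local_Lipschitz[OF J(2)[OF that]])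
    show "positive_definite (var_matrix M (Z t))" if "t \<in> I" for t by (rule pos[OF that])
    show "emeasure lborel (frontier I) = 0" by (rule fr)
  qed
qed

text \<open>Covariances, densities and integrals are insensitive both to a change of the field on a
  null set and to completing the measure. At interior points the Jacobian is moreover determined by
  the path.\<close>

lemma (in prob_space) rice_integrand_eq_rice:
  fixes Z Z' :: "real ^ 'd \<Rightarrow> 'a \<Rightarrow> real ^ 'd"
  assumes field: "c1_field M H I Z' (field_deriv I Z')"
    and N: "N \<in> null_sets M" and eq: "\<And>t \<omega>. \<omega> \<notin> N \<Longrightarrow> Z' t \<omega> = Z t \<omega>"
    and Z: "\<And>t. t \<in> I \<Longrightarrow> Z t \<in> borel_measurable M"
    and t: "t \<in> interior I"
  shows "rice_integrand M I Z u t = c1_field.rice M Z' (field_deriv I Z') u t"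
proof -
  interpret F: c1_field M H I Z' "field_deriv I Z'" by (rule field)
  have tI: "t \<in> I" using t interior_subset by blast
  let ?X = "field_deriv I Z t" and ?X' = "field_deriv I Z' t"
  have N': "AE \<omega> in M. \<omega> \<notin> N" using N by (rule AE_not_in)
  have X: "?X \<omega> = ?X' \<omega>" if "\<omega> \<notin> N" for \<omega>
    unfolding field_deriv_def using eq[OF that] by simp
  have mX': "(\<lambda>\<omega>. ?X' \<omega> $ i $ k) \<in> borel_measurable M" for i k
    by (rule F.measurable_mem[OF F.D_mem[OF t]])
  have mZ': "(\<lambda>\<omega>. Z' t \<omega> $ j) \<in> borel_measurable M" and mZ: "(\<lambda>\<omega>. Z t \<omega> $ j) \<in> borel_measurable M" for j
    by (rule measurable_vec_nth[OF F.Z_measurable[OF tI]], rule measurable_vec_nth[OF Z[OF tI]])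
  have mX: "(\<lambda>\<omega>. ?X \<omega> $ i $ k) \<in> borel_measurable (completion M)" for i k
    by (rule measurable_completion_off_null_set[OF mX' N]) (use X in auto)
  have mZc: "(\<lambda>\<omega>. Z t \<omega> $ j) \<in> borel_measurable (completion M)" for j
    by (rule measurable_completion[OF mZ])
  have aX: "AE \<omega> in M. ?X \<omega> $ i $ k = ?X' \<omega> $ i $ k" for i k
    using N' by eventually_elim (simp add: X)
  have aZ: "AE \<omega> in M. Z t \<omega> $ j = Z' t \<omega> $ j" for j
    using N' by eventually_elim (simp add: eq)
  have cov: "cov_matrix (completion M) (\<lambda>\<omega>. ?X \<omega> $ i) (Z t) = cov_matrix M (\<lambda>\<omega>. ?X' \<omega> $ i) (Z' t)" for i
    by (simp add: vec_eq_iff cov_matrix_nth covariance_cong_AE_completion[OF mX' mZ' mX mZc aX aZ])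
  have var: "var_matrix (completion M) (Z t) = var_matrix M (Z' t)"
    unfolding var_matrix_def
    by (simp add: vec_eq_iff cov_matrix_nth covariance_cong_AE_completion[OF mZ' mZ' mZc mZc aZ aZ])
  have reg: "regression_coeff (completion M) (\<lambda>\<omega>. ?X \<omega> $ i) (Z t) = regression_coeff M (\<lambda>\<omega>. ?X' \<omega> $ i) (Z' t)" for i
    unfolding regression_coeff_def cov var ..
  have ex: "regression_expectation (completion M) (\<lambda>A. ennreal \<bar>det A\<bar>) ?X (Z t) u =
    (\<integral>\<^sup>+\<omega>. ennreal \<bar>det (\<chi> i. ?X' \<omega> $ i - regression_coeff M (\<lambda>\<omega>. ?X' \<omega> $ i) (Z' t) *v Z' t \<omega>
    + regression_coeff M (\<lambda>\<omega>. ?X' \<omega> $ i) (Z' t) *v u)\<bar> \<partial>M)"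
    unfolding regression_expectation_def reg Let_def nn_integral_completion
  proof (rule nn_integral_cong_AE)
    show "AE \<omega> in M. ennreal \<bar>det (\<chi> i. ?X \<omega> $ i - regression_coeff M (\<lambda>\<omega>. ?X' \<omega> $ i) (Z' t) *v Z t \<omega>
      + regression_coeff M (\<lambda>\<omega>. ?X' \<omega> $ i) (Z' t) *v u)\<bar> =
      ennreal \<bar>det (\<chi> i. ?X' \<omega> $ i - regression_coeff M (\<lambda>\<omega>. ?X' \<omega> $ i) (Z' t) *v Z' t \<omega>
      + regression_coeff M (\<lambda>\<omega>. ?X' \<omega> $ i) (Z' t) *v u)\<bar>"
      using N' by eventually_elim (simp add: X eq)
  qed
  have "distr M lborel (Z t) = distr M lborel (Z' t)"
  proof (rule distr_cong_AE)
    show "AE \<omega> in M. Z t \<omega> = Z' t \<omega>" using N' by eventually_elim (simp add: eq)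
    show "Z t \<in> M \<rightarrow>\<^sub>M lborel" "Z' t \<in> M \<rightarrow>\<^sub>M lborel"
      using Z[OF tI] F.Z_measurable[OF tI] by simp_all
  qed simp_all
  then have "distributed M lborel (Z t) p \<longleftrightarrow> distributed M lborel (Z' t) p" for p
    unfolding distributed_def using Z[OF tI] F.Z_measurable[OF tI] by simp
  then have "density_at M (Z t) = density_at M (Z' t)"
    unfolding density_at_def by simp
  then show ?thesis unfolding rice_integrand_def F.rice_def ex by simp
qed

section \<open>Reduction of almost surely smooth fields to smooth ones\<close>

theorem theorem2p1:
  fixes M :: "'w measure"
    and I :: "(real ^ 'd) set"
    and Z :: "real ^ 'd \<Rightarrow> 'w \<Rightarrow> real ^ 'd"
    and u :: "real ^ 'd"
  assumes "prob_space M"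
    and "compact I"
    and "\<And>t. t \<in> I \<Longrightarrow> Z t \<in> borel_measurable M"
    and A0: "gaussian_field M I Z"
    and A1: "AE \<omega> in M. C1_on I (\<lambda>t. Z t \<omega>)"
    and A2: "\<And>t. t \<in> I \<Longrightarrow> positive_definite (var_matrix M (Z t))"
    and A3: "AE \<omega> in M. \<not> (\<exists>t \<in> interior I. Z t \<omega> = u \<and> det (field_deriv I Z t \<omega>) = 0)"
    and A4: "emeasure lborel (frontier I) = 0"
  shows "level_count I Z u \<in> borel_measurable (completion M) \<and>
         (\<lambda>t. rice_integrand M I Z u t * indicator I t) \<in> borel_measurable lebesgue \<and>
         (\<integral>\<^sup>+\<omega>. level_count I Z u \<omega> \<partial>completion M)
           = (\<integral>\<^sup>+t\<in>I. rice_integrand M I Z u t \<partial>lebesgue) \<and>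
         (\<integral>\<^sup>+\<omega>. level_count I Z u \<omega> \<partial>completion M) < \<infinity> \<and>
         (\<integral>\<^sup>+t\<in>I. rice_integrand M I Z u t \<partial>lebesgue) < \<infinity>"
proof -
  interpret prob_space M by fact
  note Zm = assms(3)
  obtain N where N: "{\<omega> \<in> space M. \<not> C1_on I (\<lambda>t. Z t \<omega>)} \<subseteq> N" "emeasure M N = 0" "N \<in> sets M"
    using A1 by (rule AE_E)
  have Nn: "N \<in> null_sets M" using N by auto
  \<comment> \<open>Exceptional paths are replaced by zero, so every path is continuously
    differentiable. Gaussianity and variances depend on the field only up to null sets and are
    preserved.\<close>
  define Z' where "Z' t \<omega> = (if \<omega> \<in> N then 0 else Z t \<omega>)" for t \<omega>
  have eq: "Z' t \<omega> = Z t \<omega>" if "\<omega> \<notin> N" for t \<omega> using that by (simp add: Z'_def)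
  have AEN: "AE \<omega> in M. \<omega> \<notin> N" using Nn by (rule AE_not_in)
  have Zm': "Z' t \<in> borel_measurable M" if "t \<in> I" for t
    unfolding Z'_def[abs_def] using N(3) Zm[OF that] by measurable
  have G: "gaussian_field M I Z'"
    unfolding gaussian_field_def
  proof (intro allI impI, elim conjE)
    fix T a assume T: "finite T" "T \<subseteq> I"
    have "gaussian_rv M (\<lambda>\<omega>. \<Sum>t\<in>T. a t \<bullet> Z t \<omega>)" using A0 T unfolding gaussian_field_def by blast
    then show "gaussian_rv M (\<lambda>\<omega>. \<Sum>t\<in>T. a t \<bullet> Z' t \<omega>)"
    proof (rule gaussian_rv_cong_AE)
      show "AE \<omega> in M. (\<Sum>t\<in>T. a t \<bullet> Z t \<omega>) = (\<Sum>t\<in>T. a t \<bullet> Z' t \<omega>)"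
        using AEN by eventually_elim (simp add: eq)
      show "(\<lambda>\<omega>. \<Sum>t\<in>T. a t \<bullet> Z' t \<omega>) \<in> borel_measurable M"
        using Zm' T by (intro borel_measurable_sum borel_measurable_inner) auto
    qed
  qed
  have C1: "C1_on I (\<lambda>t. Z' t \<omega>)" if \<omega>: "\<omega> \<in> space M" for \<omega>
  proof (cases "\<omega> \<in> N")
    case True
    have z: "((\<lambda>t. 0 :: real ^ 'd) has_derivative (\<lambda>h. (0 :: real ^ 'd ^ 'd) *v h)) (at t within I)" for t
      by (simp add: has_derivative_const)
    have e: "(\<lambda>t. Z' t \<omega>) = (\<lambda>_. 0)" using True by (simp add: Z'_def)
    show ?thesis
      unfolding C1_on_def e by (intro exI[of _ "\<lambda>_. 0"] conjI ballI continuous_on_const z)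
  next
    case False
    then have "C1_on I (\<lambda>t. Z t \<omega>)" using N(1) \<omega> by blast
    then show ?thesis by (simp only: eq[OF False])
  qed
  have pos: "positive_definite (var_matrix M (Z' t))" if t: "t \<in> I" for t
  proof -
    have "var_matrix M (Z' t) = var_matrix M (Z t)"
    proof -
      have mZ: "(\<lambda>\<omega>. Z t \<omega> $ j) \<in> borel_measurable M" and mZ': "(\<lambda>\<omega>. Z' t \<omega> $ j) \<in> borel_measurable M" for j
        by (rule measurable_vec_nth[OF Zm[OF t]], rule measurable_vec_nth[OF Zm'[OF t]])
      have aZ: "AE \<omega> in M. Z t \<omega> $ j = Z' t \<omega> $ j" for j
        using AEN by eventually_elim (simp add: eq)
      have r: "AE \<omega> in M. Z t \<omega> $ j = Z t \<omega> $ j" for j by simp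
      \<comment> \<open>Both sides equal the covariance of the coordinates of \<open>Z t\<close>
        under the completed measure.\<close>
      have "covariance M (\<lambda>\<omega>. Z' t \<omega> $ i) (\<lambda>\<omega>. Z' t \<omega> $ j) = covariance M (\<lambda>\<omega>. Z t \<omega> $ i) (\<lambda>\<omega>. Z t \<omega> $ j)" for i j
        using covariance_cong_AE_completion[OF mZ' mZ' measurable_completion[OF mZ] measurable_completion[OF mZ] aZ aZ, of i j]
          covariance_cong_AE_completion[OF mZ mZ measurable_completion[OF mZ] measurable_completion[OF mZ] r r, of i j]
        by simp
      then show ?thesis by (simp add: var_matrix_def vec_eq_iff cov_matrix_nth)
    qed
    then show ?thesis using A2[OF t] by simp
  qed
  have field: "c1_field M (gaussian_hull M I Z') I Z' (field_deriv I Z')"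
    by (rule c1_field_gaussian_hull[OF assms(1,2) Zm' G C1 pos A4])
  interpret F: c1_field M "gaussian_hull M I Z'" I Z' "field_deriv I Z'" by (rule field)
  have rice: "rice_integrand M I Z u t = F.rice u t" if "t \<in> interior I" for t
    by (rule rice_integrand_eq_rice[OF field Nn eq Zm that])
  have level: "level_count I Z u \<omega> = count_preimage (\<lambda>t. Z' t \<omega>) I u" if "\<omega> \<notin> N" for \<omega>
    unfolding level_count_eq eq[OF that] ..
  have fr: "frontier I \<in> null_sets lborel"
    using A4 by (intro null_setsI) auto
  have offI: "rice_integrand M I Z u t * indicator I t = F.rice u t * indicator (interior I) t"
    if "t \<notin> frontier I" for t
  proof (cases "t \<in> interior I")
    case True
    then show ?thesis using rice F.interior_I by simp
  next
    case False
    then have "t \<notin> I" using that assms(2) by (auto simp: frontier_def compact_imp_closed)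
    then show ?thesis using False by simp
  qed
  have m1: "level_count I Z u \<in> borel_measurable (completion M)"
    by (rule measurable_completion_off_null_set[OF F.count_measurable[OF closed_imp_fsigma[OF compact_imp_closed[OF assms(2)]] order_refl] Nn])
       (use level in auto)
  have m2: "(\<lambda>t. rice_integrand M I Z u t * indicator I t) \<in> borel_measurable lebesgue"
    by (rule measurable_completion_off_null_set[OF _ fr]) (use F.rice_formula(1) offI in auto)
  have "(\<integral>\<^sup>+\<omega>. level_count I Z u \<omega> \<partial>completion M) = (\<integral>\<^sup>+\<omega>. count_preimage (\<lambda>t. Z' t \<omega>) I u \<partial>M)"
    unfolding nn_integral_completion by (rule nn_integral_cong_AE) (use AEN level in auto)
  also have "\<dots> = (\<integral>\<^sup>+t\<in>interior I. F.rice u t \<partial>lborel)" by (rule F.rice_formula(2))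
  finally have i1: "(\<integral>\<^sup>+\<omega>. level_count I Z u \<omega> \<partial>completion M) = (\<integral>\<^sup>+t\<in>interior I. F.rice u t \<partial>lborel)" .
  have i2: "(\<integral>\<^sup>+t\<in>I. rice_integrand M I Z u t \<partial>lebesgue) = (\<integral>\<^sup>+t\<in>interior I. F.rice u t \<partial>lborel)"
    unfolding nn_integral_completion
    by (rule nn_integral_cong_AE) (use AE_not_in[OF fr] offI in \<open>auto elim: eventually_mono\<close>)
  show ?thesis
    using m1 m2 F.rice_formula(3) unfolding i1 i2 by blast
qed

end
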